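(* Let $\alpha>0$ be fixed, let $\lambda$ be a fourth root of unity, and let $\mu\neq0$ be a measure on $\mathbb{R}$ that is $\alpha$-periodic, i.e. $\delta_\alpha*\mu=\mu$. Then the following are equivalent. (1) $\mu$ is an eigenmeasure of $\mathcal{F}$ with eigenvalue $\lambda$. (2) $\mu$ is a strict eigenmeasure of $\mathcal{F}$ with eigenvalue $\lambda$. (3) $\alpha=\sqrt n$ for some $n\in\mathbb{N}$ and $\mu=\varrho*\delta_{\alpha\mathbb{Z}}$ with $\varrho=\sum_{m=0}^{n-1}c_m\delta_{m/\alpha}$, i.e. $\mu=\sum_{m=0}^{n-1}\sum_{k\in\mathbb{Z}}c_m\,\delta_{m/\sqrt n+k\sqrt n}$, where $c=(c_0,\dots,c_{n-1})^T\in\mathbb{C}^n$ satisfies $U_nc=\lambda c$.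
   Context: All measures are complex Radon measures on $\mathbb{R}$; $\delta_x$ is the unit point mass at $x$, $\delta_A=\sum_{x\in A}\delta_x$, $*$ is convolution. The Fourier transform $\mathcal{F}$ is $\widehat{g}(y)=\int e^{-2\pi ixy}g(x)\,dx$, extended to tempered distributions by duality. A measure is tempered if it defines a tempered distribution; it is transformable if its distributional transform is a measure. A non-trivial tempered measure $\mu$ is an eigenmeasure with eigenvalue $\lambda$ if it is transformable and $\mathcal{F}(\mu)=\lambda\mu$; it is a strict eigenmeasure if it is transformable in the strict sense (there is a measure $\widehat\mu$ with $\check f\in L^1(|\widehat\mu|)$ and $\mu(f)=\widehat\mu(\check f)$ for all $f$ in the span of $\{g*h:g,h\in C_c(\mathbb{R})\}$, $\check f(y)=\widehat f(-y)$) and $\widehat\mu=\lambda\mu$ as measures. $U_n$ is the unitary discrete Fourier matrix with entries $(U_n)_{k\ell}=\omega^{k\ell}/\sqrt n$, $\omega=e^{-2\pi i/n}$, $0\le k,\ell\le n-1$. *)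

theory Defs
  imports "HOL-Analysis.Analysis"
begin

text \<open>A complex Radon measure on the real line is represented (polar/density
decomposition) by a pair (nu, h): a locally finite positive Borel measure nu and a
locally nu-integrable density h, the measure being h nu.  Then the integral of f is
the integral of f * h with respect to nu, and f is in L1 of the total variation iff
f * h is nu-integrable.\<close>

type_synonym cmeasure = "real measure \<times> (real \<Rightarrow> complex)"

definition radon :: "cmeasure \<Rightarrow> bool" where
  "radon \<mu> \<longleftrightarrow> sets (fst \<mu>) = sets borel
     \<and> (\<forall>K. compact K \<longrightarrow> emeasure (fst \<mu>) K < \<infinity>)
     \<and> snd \<mu> \<in> borel_measurable (fst \<mu>)
     \<and> (\<forall>K. compact K \<longrightarrow> set_integrable (fst \<mu>) K (snd \<mu>))"

definition mint :: "cmeasure \<Rightarrow> (real \<Rightarrow> complex) \<Rightarrow> complex" where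
  "mint \<mu> f = (\<integral>x. f x * snd \<mu> x \<partial>(fst \<mu>))"

definition mintegrable :: "cmeasure \<Rightarrow> (real \<Rightarrow> complex) \<Rightarrow> bool" where
  "mintegrable \<mu> f \<longleftrightarrow> integrable (fst \<mu>) (\<lambda>x. f x * snd \<mu> x)"

definition Cc :: "(real \<Rightarrow> complex) \<Rightarrow> bool" where
  "Cc f \<longleftrightarrow> continuous_on UNIV f \<and> bounded {x. f x \<noteq> 0}"

definition meq :: "cmeasure \<Rightarrow> cmeasure \<Rightarrow> bool" where
  "meq \<mu> \<nu> \<longleftrightarrow> (\<forall>f. Cc f \<longrightarrow> mint \<mu> f = mint \<nu> f)"

definition mscale :: "complex \<Rightarrow> cmeasure \<Rightarrow> cmeasure" where
  "mscale c \<mu> = (fst \<mu>, \<lambda>x. c * snd \<mu> x)"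

definition nontrivial :: "cmeasure \<Rightarrow> bool" where
  "nontrivial \<mu> \<longleftrightarrow> (\<exists>f. Cc f \<and> mint \<mu> f \<noteq> 0)"

definition mtranslate :: "real \<Rightarrow> cmeasure \<Rightarrow> (real \<Rightarrow> complex) \<Rightarrow> complex" where
  "mtranslate a \<mu> f = mint \<mu> (\<lambda>x. f (x + a))"

primrec nderiv :: "nat \<Rightarrow> (real \<Rightarrow> complex) \<Rightarrow> real \<Rightarrow> complex" where
  "nderiv 0 f = f"
| "nderiv (Suc j) f = (\<lambda>x. vector_derivative (nderiv j f) (at x))"

definition smooth :: "(real \<Rightarrow> complex) \<Rightarrow> bool" where
  "smooth f \<longleftrightarrow> (\<forall>j x. nderiv j f differentiable (at x))"

definition Cc_inf :: "(real \<Rightarrow> complex) \<Rightarrow> bool" where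
  "Cc_inf f \<longleftrightarrow> smooth f \<and> bounded {x. f x \<noteq> 0}"

definition schwartz :: "(real \<Rightarrow> complex) \<Rightarrow> bool" where
  "schwartz f \<longleftrightarrow> smooth f \<and>
     (\<forall>j k. \<exists>C. \<forall>x. \<bar>x\<bar> ^ k * norm (nderiv j f x) \<le> C)"

definition sseminorm :: "nat \<Rightarrow> nat \<Rightarrow> (real \<Rightarrow> complex) \<Rightarrow> real" where
  "sseminorm j k f = (SUP x. \<bar>x\<bar> ^ k * norm (nderiv j f x))"

definition fourier :: "(real \<Rightarrow> complex) \<Rightarrow> real \<Rightarrow> complex" where
  "fourier g y = (\<integral>x. exp (- 2 * of_real pi * \<i> * of_real (x * y)) * g x \<partial>lborel)"

definition fourier_check :: "(real \<Rightarrow> complex) \<Rightarrow> real \<Rightarrow> complex" where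
  "fourier_check g y = fourier g (- y)"

definition conv :: "(real \<Rightarrow> complex) \<Rightarrow> (real \<Rightarrow> complex) \<Rightarrow> real \<Rightarrow> complex" where
  "conv g h x = (\<integral>y. g (x - y) * h y \<partial>lborel)"

definition Cc_conv_span :: "(real \<Rightarrow> complex) \<Rightarrow> bool" where
  "Cc_conv_span f \<longleftrightarrow> (\<exists>(N::nat) a g h. (\<forall>i<N. Cc (g i) \<and> Cc (h i)) \<and>
      f = (\<lambda>x. \<Sum>i<N. a i * conv (g i) (h i) x))"

definition tempered_ext :: "cmeasure \<Rightarrow> ((real \<Rightarrow> complex) \<Rightarrow> complex) \<Rightarrow> bool" where
  "tempered_ext \<mu> T \<longleftrightarrow>
     (\<forall>\<phi> \<psi>. schwartz \<phi> \<longrightarrow> schwartz \<psi> \<longrightarrow> T (\<lambda>x. \<phi> x + \<psi> x) = T \<phi> + T \<psi>)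
   \<and> (\<forall>c \<phi>. schwartz \<phi> \<longrightarrow> T (\<lambda>x. c * \<phi> x) = c * T \<phi>)
   \<and> (\<exists>N C. \<forall>\<phi>. schwartz \<phi> \<longrightarrow>
          norm (T \<phi>) \<le> C * (\<Sum>j\<le>N. \<Sum>k\<le>N. sseminorm j k \<phi>))
   \<and> (\<forall>\<phi>. Cc_inf \<phi> \<longrightarrow> T \<phi> = mint \<mu> \<phi>)"

definition tempered :: "cmeasure \<Rightarrow> bool" where
  "tempered \<mu> \<longleftrightarrow> (\<exists>T. tempered_ext \<mu> T)"

definition dist_fourier_is :: "cmeasure \<Rightarrow> cmeasure \<Rightarrow> bool" where
  "dist_fourier_is \<mu> \<nu> \<longleftrightarrow> radon \<nu> \<and>
     (\<exists>T. tempered_ext \<mu> T \<and> (\<forall>\<phi>. Cc_inf \<phi> \<longrightarrow> T (fourier \<phi>) = mint \<nu> \<phi>))"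

definition eigenmeasure :: "cmeasure \<Rightarrow> complex \<Rightarrow> bool" where
  "eigenmeasure \<mu> lam \<longleftrightarrow> radon \<mu> \<and> nontrivial \<mu> \<and> tempered \<mu> \<and>
     (\<exists>\<nu>. dist_fourier_is \<mu> \<nu> \<and> meq \<nu> (mscale lam \<mu>))"

definition strict_fourier_is :: "cmeasure \<Rightarrow> cmeasure \<Rightarrow> bool" where
  "strict_fourier_is \<mu> \<nu> \<longleftrightarrow> radon \<nu> \<and>
     (\<forall>f. Cc_conv_span f \<longrightarrow> mintegrable \<nu> (fourier_check f) \<and> mint \<mu> f = mint \<nu> (fourier_check f))"

definition strict_eigenmeasure :: "cmeasure \<Rightarrow> complex \<Rightarrow> bool" where
  "strict_eigenmeasure \<mu> lam \<longleftrightarrow> radon \<mu> \<and> nontrivial \<mu> \<and> tempered \<mu> \<and>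
     (\<exists>\<nu>. strict_fourier_is \<mu> \<nu> \<and> meq \<nu> (mscale lam \<mu>))"

definition dft :: "nat \<Rightarrow> (nat \<Rightarrow> complex) \<Rightarrow> nat \<Rightarrow> complex" where
  "dft n c k = (\<Sum>l<n. exp (- 2 * of_real pi * \<i> / of_nat n) ^ (k * l) * c l)
                  / of_real (sqrt (real n))"

end

theory Submission
  imports Defs
begin

text \<open>
  Let \<open>\<mu>\<close> be \<open>\<alpha>\<close>-periodic. For either notion of eigenmeasure, \<open>\<mu>(f)\<close> is, up to a nonzero factor, the limit
  of \<open>\<mu>\<close> applied to truncations of the Fourier transform of a test function \<open>f\<close>. Translating the transform
  by \<open>\<alpha>\<close> multiplies \<open>f\<close> by a character \<open>e\<close> of period \<open>1 / \<alpha>\<close> and, by periodicity, does not change the limit.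
  Hence \<open>(1 - e) \<mu> = 0\<close>, so \<open>\<mu>\<close> is a sum of point masses on \<open>\<int> / \<alpha>\<close>, and periodicity then forces
  \<open>\<alpha>\<^sup>2 = n\<close> to be an integer. For an \<open>n\<close>-periodic weight on \<open>\<int> / \<surd>n\<close> the Poisson summation formula turns the
  Fourier transform into the discrete Fourier transform of the weight, which gives the eigenvector condition
  and, read backwards, the converse. For \<open>f = g * h\<close> the absolute convergence comes from Bessel's inequality.
\<close>

subsection \<open>Smooth functions\<close>

text \<open>Neither definition lets a Fourier transform be put into \<open>mint \<mu>\<close>
  directly: it need not be integrable against \<open>\<mu>\<close>, and a functional
  \<open>T\<close> with \<open>tempered_ext \<mu> T\<close> is tied to \<open>\<mu>\<close> on
  \<open>Cc_inf\<close> only. Truncations repair this; their centre stays a parameter because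
  translation by \<open>\<alpha>\<close> moves the truncation too. The two notions differ in the
  class of test functions, the sign of the character and the nonzero factor, so necessity is argued
  once with parameters \<open>X\<close>, \<open>s\<close>, \<open>a\<close>: \<open>Cc_inf\<close>,
  \<open>1\<close>, \<open>lam\<close> for eigenmeasures and \<open>Cc_conv_span\<close>,
  \<open>- 1\<close>, \<open>inverse lam\<close> for strict ones. Since a measure is a pair of a
  positive measure and a density, \<open>(1 - e) \<mu> = 0\<close> must be turned from an identity
  on test functions into an almost everywhere statement about the density. A finite matrix appears
  because the points \<open>m / sqrt n\<close> and the frequencies \<open>j / sqrt n\<close> of a
  \<open>sqrt n\<close>-periodic sum lie in one and the same lattice, with products in
  \<open>\<int> / n\<close>.\<close>

lemma nderiv_eqI:
  assumes "F 0 = f" "\<And>j x. (F j has_vector_derivative F (Suc j) x) (at x)"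
  shows "nderiv j f = F j"
proof (induction j)
  case 0
  then show ?case using assms(1) by simp
next
  case (Suc j)
  then show ?case
    using assms(2)[of j] by (auto simp: vector_derivative_at)
qed

text \<open>Smoothness is always proved by exhibiting the whole tower of derivatives at once, since
  \<open>nderiv\<close> iterates a derivative that is defined by choice; the same tower then gives
  closed forms for \<open>nderiv\<close>.\<close>

lemma smoothI:
  assumes "F 0 = f" "\<And>j x. (F j has_vector_derivative F (Suc j) x) (at x)"
  shows "smooth f"
  unfolding smooth_def nderiv_eqI[where F=F, OF assms]
  using assms(2) differentiableI_vector by blast

lemma smooth_nderiv:
  "smooth f \<Longrightarrow> (nderiv j f has_vector_derivative nderiv (Suc j) f x) (at x)"
  unfolding smooth_def by (simp add: vector_derivative_works[symmetric])

lemma continuous_nderiv: "smooth f \<Longrightarrow> continuous_on S (nderiv j f)"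
  by (meson continuous_at_imp_continuous_on has_vector_derivative_continuous smooth_nderiv)

lemma smooth_imp_continuous: "smooth f \<Longrightarrow> continuous_on S f"
  using continuous_nderiv[of f S 0] by simp

lemma nderiv_diff:
  assumes "smooth f" "smooth g"
  shows "nderiv j (\<lambda>x. f x - g x) = (\<lambda>x. nderiv j f x - nderiv j g x)"
  by (rule nderiv_eqI[where F="\<lambda>j x. nderiv j f x - nderiv j g x"])
     (auto intro!: has_vector_derivative_diff smooth_nderiv assms simp del: nderiv.simps(2))

lemma smooth_diff: "smooth f \<Longrightarrow> smooth g \<Longrightarrow> smooth (\<lambda>x. f x - g x)"
  by (rule smoothI[where F="\<lambda>j x. nderiv j f x - nderiv j g x"])
     (auto intro!: has_vector_derivative_diff smooth_nderiv simp del: nderiv.simps(2))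

lemma smooth_nderiv_smooth: "smooth f \<Longrightarrow> smooth (nderiv k f)"
  by (rule smoothI[where F="\<lambda>j. nderiv (j + k) f"])
     (use smooth_nderiv in \<open>auto simp del: nderiv.simps(2)\<close>)

lemma nderiv_const: "nderiv j (\<lambda>_. c) = (\<lambda>_. if j = 0 then c else 0)"
  by (rule nderiv_eqI[where F="\<lambda>j _. if j = 0 then c else 0"]) auto

lemma smooth_const: "smooth (\<lambda>_. c)"
  by (rule smoothI[where F="\<lambda>j _. if j = 0 then c else 0"]) auto

lemma nderiv_affine_deriv:
  assumes "smooth f"
  shows "((\<lambda>x. of_real r ^ j * nderiv j f (r * x + s)) has_vector_derivative
           of_real r ^ Suc j * nderiv (Suc j) f (r * x + s)) (at x)"
proof -
  have "((\<lambda>x. r * x + s) has_vector_derivative r) (at x)"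
    by (auto intro!: derivative_eq_intros simp flip: has_real_derivative_iff_has_vector_derivative)
  from vector_diff_chain_at[OF this smooth_nderiv[OF assms, of j]]
  have "((\<lambda>x. nderiv j f (r * x + s)) has_vector_derivative r *\<^sub>R nderiv (Suc j) f (r * x + s)) (at x)"
    by (simp add: o_def)
  from has_vector_derivative_mult_right[OF this, of "of_real r ^ j"]
  show ?thesis by (simp add: scaleR_conv_of_real algebra_simps)
qed

lemma nderiv_affine:
  assumes "smooth f"
  shows "nderiv j (\<lambda>x. f (r * x + s)) = (\<lambda>x. of_real r ^ j * nderiv j f (r * x + s))"
  by (rule nderiv_eqI[where F="\<lambda>j x. of_real r ^ j * nderiv j f (r * x + s)"])
     (simp, rule nderiv_affine_deriv[OF assms])

lemma smooth_affine:
  assumes "smooth f"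
  shows "smooth (\<lambda>x. f (r * x + s))"
  by (rule smoothI[where F="\<lambda>j x. of_real r ^ j * nderiv j f (r * x + s)"])
     (simp, rule nderiv_affine_deriv[OF assms])

lemma leibniz_has_vector_derivative:
  assumes "smooth f" "smooth g"
  shows "((\<lambda>x. \<Sum>i\<le>j. of_nat (j choose i) * (nderiv i f x * nderiv (j - i) g x)) has_vector_derivative
           (\<Sum>i\<le>Suc j. of_nat (Suc j choose i) * (nderiv i f x * nderiv (Suc j - i) g x))) (at x)"
proof -
  let ?u = "\<lambda>i. nderiv i f x" and ?v = "\<lambda>i. nderiv i g x"
  have "((\<lambda>x. \<Sum>i\<le>j. of_nat (j choose i) * (nderiv i f x * nderiv (j - i) g x)) has_vector_derivative
         (\<Sum>i\<le>j. of_nat (j choose i) * (?u i * ?v (Suc (j - i)) + ?u (Suc i) * ?v (j - i)))) (at x)"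
    by (intro has_vector_derivative_sum has_vector_derivative_mult_right
          has_vector_derivative_mult smooth_nderiv assms)
  moreover have "(\<Sum>i\<le>j. of_nat (j choose i) * (?u i * ?v (Suc (j - i)) + ?u (Suc i) * ?v (j - i)))
       = (\<Sum>i\<le>Suc j. of_nat (Suc j choose i) * (?u i * ?v (Suc j - i)))"
  proof -
    \<comment> \<open>Pascal's rule. The sum may be extended to \<open>Suc j\<close> because
      \<open>j choose Suc j\<close> is 0; \<open>s2\<close> and \<open>s3\<close> then split off the
      index 0 so that the binomial coefficients can be added termwise.\<close>
    have s1: "(\<Sum>i\<le>j. of_nat (j choose i) * (?u i * ?v (Suc (j - i))))
        = (\<Sum>i\<le>Suc j. of_nat (j choose i) * (?u i * ?v (Suc j - i)))"
      by (simp add: Suc_diff_le del: nderiv.simps(2))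
    have s2: "(\<Sum>i\<le>Suc j. of_nat (Suc j choose i) * (?u i * ?v (Suc j - i)))
        = ?u 0 * ?v (Suc j) + (\<Sum>i\<le>j. of_nat (Suc j choose Suc i) * (?u (Suc i) * ?v (j - i)))"
      by (subst sum.atMost_Suc_shift) (simp del: nderiv.simps(2))
    have s3: "(\<Sum>i\<le>Suc j. of_nat (j choose i) * (?u i * ?v (Suc j - i)))
        = ?u 0 * ?v (Suc j) + (\<Sum>i\<le>j. of_nat (j choose Suc i) * (?u (Suc i) * ?v (j - i)))"
      by (subst sum.atMost_Suc_shift) (simp del: nderiv.simps(2))
    show ?thesis
      unfolding distrib_left sum.distrib s1 s2 s3
      by (simp add: distrib_right sum.distrib del: nderiv.simps(2))
  qed
  ultimately show ?thesis by simp
qed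

lemma nderiv_mult:
  assumes "smooth f" "smooth g"
  shows "nderiv j (\<lambda>x. f x * g x) =
           (\<lambda>x. \<Sum>i\<le>j. of_nat (j choose i) * (nderiv i f x * nderiv (j - i) g x))"
  by (rule nderiv_eqI[where F="\<lambda>j x. \<Sum>i\<le>j. of_nat (j choose i) * (nderiv i f x * nderiv (j - i) g x)"])
     (simp, rule leibniz_has_vector_derivative[OF assms])

lemma smooth_mult:
  assumes "smooth f" "smooth g"
  shows "smooth (\<lambda>x. f x * g x)"
  by (rule smoothI[where F="\<lambda>j x. \<Sum>i\<le>j. of_nat (j choose i) * (nderiv i f x * nderiv (j - i) g x)"])
     (simp, rule leibniz_has_vector_derivative[OF assms])

lemma smooth_exp: "smooth (\<lambda>x. exp (c * of_real x))"
proof (rule smoothI[where F="\<lambda>j x. c ^ j * exp (c * of_real x)"])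
  fix j x
  have "((\<lambda>z. c ^ j * exp (c * z)) has_field_derivative c ^ Suc j * exp (c * of_real x)) (at (of_real x))"
    by (auto intro!: derivative_eq_intros)
  from field_vector_diff_chain_at[OF has_vector_derivative_of_real[OF DERIV_ident] this]
  show "((\<lambda>x. c ^ j * exp (c * of_real x)) has_vector_derivative c ^ Suc j * exp (c * of_real x)) (at x)"
    by (simp add: o_def)
qed simp

lemma smooth_id: "smooth of_real"
  by (rule smoothI[where F="\<lambda>j x. if j = 0 then of_real x else if j = 1 then 1 else 0"])
     (use has_vector_derivative_of_real[OF DERIV_ident] in auto)

text \<open>Locality of differentiation, applied below with a constant \<open>g\<close> to find all
  derivatives wherever a step, a cutoff or a compactly supported function is locally
  constant.\<close>

lemma nderiv_eq_on_open:
  assumes "smooth f" "smooth g" "open S" "\<And>x. x \<in> S \<Longrightarrow> f x = g x" "x \<in> S"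
  shows "nderiv j f x = nderiv j g x"
  using assms(5)
proof (induction j arbitrary: x)
  case 0
  then show ?case using assms(4) by simp
next
  case (Suc j)
  have "(nderiv j g has_vector_derivative nderiv (Suc j) f x) (at x)"
    by (rule has_vector_derivative_transform_within_open[OF smooth_nderiv[OF assms(1)] assms(3)])
       (use Suc in auto)
  then show ?case
    using smooth_nderiv[OF assms(2)] vector_derivative_unique_at by blast
qed

lemma smooth_antiderivative:
  assumes "\<And>x. (f has_vector_derivative g x) (at x)" "smooth g"
  shows "smooth f"
proof (rule smoothI[where F="\<lambda>j. case j of 0 \<Rightarrow> f | Suc i \<Rightarrow> nderiv i g"])
  fix j x
  show "((case j of 0 \<Rightarrow> f | Suc i \<Rightarrow> nderiv i g) has_vector_derivative
          (case Suc j of 0 \<Rightarrow> f | Suc i \<Rightarrow> nderiv i g) x) (at x)"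
    using assms(1) smooth_nderiv[OF assms(2)] by (cases j) (auto simp del: nderiv.simps(2))
qed simp

subsection \<open>A smooth step function\<close>

text \<open>The classical flat functions \<open>p(1/x) exp(-1/x)\<close>, continued by 0. The
  polynomial factor makes the family closed under differentiation, so smoothness needs only one
  derivative computation.\<close>

definition flat :: "real poly \<Rightarrow> real \<Rightarrow> real" where
  "flat p x = (if x \<le> 0 then 0 else poly p (1 / x) * exp (- (1 / x)))"

lemma poly_times_exp_minus_tendsto_0:
  fixes p :: "real poly"
  shows "((\<lambda>u. poly p u * exp (- u)) \<longlongrightarrow> 0) at_top"
proof -
  have "((\<lambda>u. \<Sum>i\<le>degree p. coeff p i * (u ^ i / exp u)) \<longlongrightarrow> (\<Sum>i\<le>degree p. coeff p i * 0)) at_top"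
    by (intro tendsto_sum tendsto_mult tendsto_const tendsto_power_div_exp_0)
  moreover have "(\<lambda>u. poly p u * exp (- u)) = (\<lambda>u. \<Sum>i\<le>degree p. coeff p i * (u ^ i / exp u))"
    by (auto simp: poly_altdef sum_distrib_right sum_divide_distrib exp_minus field_simps)
  ultimately show ?thesis by simp
qed

text \<open>With \<open>u = 1/x\<close> and \<open>u' = - u^2\<close>, the derivative of
  \<open>p(u) exp(-u)\<close> is \<open>u^2 (p(u) - p'(u)) exp(-u)\<close>; the two
  \<open>pCons 0\<close> are the factor \<open>u^2\<close>.\<close>

lemma flat_has_real_derivative:
  "(flat p has_real_derivative flat (pCons 0 (pCons 0 (p - pderiv p))) x) (at x)"
proof -
  consider "x < 0" | "x = 0" | "x > 0" by linarith
  then show ?thesis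
  proof cases
    case 1
    have "((\<lambda>_. 0) has_real_derivative 0) (at x)" by simp
    then have "(flat p has_real_derivative 0) (at x)"
      by (rule has_field_derivative_transform_within_open[where S="{..<0}"])
         (use 1 in \<open>auto simp: flat_def\<close>)
    then show ?thesis using 1 by (simp add: flat_def)
  next
    case 2
    \<comment> \<open>The right difference quotient at 0 is \<open>u p(u) exp(-u)\<close> with
      \<open>u = 1/y\<close>; dividing by \<open>y\<close> multiplies the polynomial by
      \<open>u\<close>, whence \<open>pCons 0 p\<close>.\<close>
    have "((\<lambda>u. poly (pCons 0 p) u * exp (- u)) \<longlongrightarrow> 0) at_top"
      by (rule poly_times_exp_minus_tendsto_0)
    then have "((\<lambda>y. poly (pCons 0 p) (inverse y) * exp (- inverse y)) \<longlongrightarrow> 0) (at_right 0)"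
      using filterlim_compose filterlim_inverse_at_top_right by blast
    then have "((\<lambda>y. (flat p y - flat p 0) / (y - 0)) \<longlongrightarrow> 0) (at_right 0)"
      by (rule tendsto_cong[THEN iffD1, rotated])
         (auto simp: flat_def eventually_at_right_less divide_simps intro!: eventually_at_rightI[of 0 1])
    moreover have "((\<lambda>y. (flat p y - flat p 0) / (y - 0)) \<longlongrightarrow> 0) (at_left 0)"
      by (rule tendsto_eventually) (auto simp: flat_def intro!: eventually_at_leftI[of "-1"])
    ultimately show ?thesis
      unfolding 2 has_field_derivative_iff flat_def[of "pCons _ _"]
      by (simp add: filterlim_split_at)
  next
    case 3
    have "((\<lambda>x. poly p (1 / x) * exp (- (1 / x))) has_real_derivative
        flat (pCons 0 (pCons 0 (p - pderiv p))) x) (at x)"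
      using 3
      by (auto intro!: derivative_eq_intros DERIV_chain2[OF poly_DERIV] simp: flat_def field_simps power2_eq_square)
    then show ?thesis
      by (rule has_field_derivative_transform_within_open[where S="{0<..}"])
         (use 3 in \<open>auto simp: flat_def\<close>)
  qed
qed

lemma smooth_flat: "smooth (\<lambda>x. of_real (flat p x))"
proof (rule smoothI[where F="\<lambda>j x. of_real (flat (((\<lambda>p. pCons 0 (pCons 0 (p - pderiv p))) ^^ j) p) x)"])
qed (auto intro!: has_vector_derivative_of_real flat_has_real_derivative)

lemma exists_smooth_step:
  "\<exists>\<sigma>::real \<Rightarrow> real. smooth (\<lambda>x. of_real (\<sigma> x)) \<and> (\<forall>x\<le>0. \<sigma> x = 0) \<and> (\<forall>x\<ge>1. \<sigma> x = 1)
     \<and> (\<forall>x. 0 \<le> \<sigma> x \<and> \<sigma> x \<le> 1)"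
proof -
  \<comment> \<open>A smooth bump, positive exactly on the open interval from 0 to 1; the step is
    its integral divided by the total mass.\<close>
  define \<gamma> where "\<gamma> = (\<lambda>x. flat 1 x * flat 1 (1 - x))"
  have sm: "smooth (\<lambda>x. of_real (\<gamma> x))"
    using smooth_mult[OF smooth_flat[of 1] smooth_affine[OF smooth_flat[of 1], of "-1" 1]]
    by (simp add: \<gamma>_def)
  have nn: "\<gamma> x \<ge> 0" for x by (auto simp: \<gamma>_def flat_def)
  have z: "\<gamma> x = 0" if "x \<le> 0 \<or> x \<ge> 1" for x using that by (auto simp: \<gamma>_def flat_def)
  have "continuous_on UNIV (\<lambda>x. flat 1 x)"
    using flat_has_real_derivative DERIV_continuous_on by (metis has_field_derivative_at_within)
  note c = continuous_on_compose2[OF this _ subset_UNIV]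
  have cont: "continuous_on S \<gamma>" for S unfolding \<gamma>_def
    by (rule continuous_on_mult; rule c; intro continuous_intros)
  \<comment> \<open>Starting the integral at -1 keeps every \<open>x \<ge> 0\<close> in the interior
    of the interval of integration, so the one-sided derivative below is a full one.\<close>
  define G where "G = (\<lambda>x. integral {-1..x} \<gamma>)"
  have int: "\<gamma> integrable_on {a..b}" for a b by (intro integrable_continuous_interval cont)
  have dG: "(G has_real_derivative \<gamma> x) (at x)" for x
  proof (cases "x < 0")
    case True
    have "G y = 0" if "y < 0" for y
      unfolding G_def using that z by (intro integral_unique has_integral_is_0) auto
    moreover have d0: "((\<lambda>_. 0) has_real_derivative 0) (at x)" by simp
    ultimately have "(G has_real_derivative 0) (at x)"
      by (intro has_field_derivative_transform_within_open[OF d0, where S="{..<0}"])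
         (use True in auto)
    then show ?thesis using z True by simp
  next
    case False
    have "((\<lambda>u. integral {-1..u} \<gamma>) has_real_derivative \<gamma> x) (at x within {-1..x+1})"
      by (rule integral_has_real_derivative[OF cont]) (use False in auto)
    then show ?thesis
      using False by (simp add: G_def at_within_interior[of x "{-1..x+1}"])
  qed
  have mono: "G x \<le> G y" if "x \<le> y" for x y
    unfolding G_def using that nn int by (intro integral_subset_le) auto
  have G0: "G x = 0" if "x \<le> 0" for x
    unfolding G_def using that z by (intro integral_unique has_integral_is_0) auto
  have G1: "G x = G 1" if "x \<ge> 1" for x
  proof -
    have "G 1 + integral {1..x} \<gamma> = G x"
      unfolding G_def using that int by (intro Henstock_Kurzweil_Integration.integral_combine) auto
    moreover have "integral {1..x} \<gamma> = 0"
      using z by (intro integral_unique has_integral_is_0) auto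
    ultimately show ?thesis by simp
  qed
  have "G 1 \<noteq> 0"
  proof
    assume "G 1 = 0"
    then have "(\<gamma> has_integral 0) (cbox (-1) 1)"
      using int[of "-1" 1] unfolding G_def by (metis integrable_integral interval_cbox)
    then have "\<gamma> (1/2) = 0"
      by (rule has_integral_0_cbox_imp_0[rotated 2]) (use cont nn in \<open>auto simp: content_real_if\<close>)
    then show False by (simp add: \<gamma>_def flat_def)
  qed
  moreover have "G 1 \<ge> 0" using mono[of 0 1] G0[of 0] by simp
  ultimately have pos: "G 1 > 0" by simp
  have "((\<lambda>x. complex_of_real (G x)) has_vector_derivative of_real (\<gamma> x)) (at x)" for x
    by (intro has_vector_derivative_of_real dG)
  then have "smooth (\<lambda>x. complex_of_real (G x))"
    by (rule smooth_antiderivative[OF _ sm])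
  then have "smooth (\<lambda>x. of_real (1 / G 1) * complex_of_real (G x))"
    by (intro smooth_mult smooth_const)
  then have sm': "smooth (\<lambda>x. of_real (G x / G 1))" by simp
  have "0 \<le> G x \<and> G x \<le> G 1" for x
    using mono[of x 1] mono[of 0 x] G0[of 0] G0[of x] G1[of x] pos
    by (cases "x \<le> 0"; cases "x \<le> 1") auto
  moreover have "G x / G 1 = 1" if "x \<ge> 1" for x using G1[OF that] pos by simp
  ultimately show ?thesis
    using pos G0 sm' by (intro exI[of _ "\<lambda>x. G x / G 1"] conjI allI impI) simp_all
qed

definition smooth_step :: "real \<Rightarrow> real" where
  "smooth_step = (SOME \<sigma>. smooth (\<lambda>x. of_real (\<sigma> x)) \<and> (\<forall>x\<le>0. \<sigma> x = 0) \<and> (\<forall>x\<ge>1. \<sigma> x = 1)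
     \<and> (\<forall>x. 0 \<le> \<sigma> x \<and> \<sigma> x \<le> 1))"

lemma smooth_step:
  shows smooth_smooth_step: "smooth (\<lambda>x. of_real (smooth_step x))"
    and smooth_step_eq_0: "\<And>x. x \<le> 0 \<Longrightarrow> smooth_step x = 0"
    and smooth_step_eq_1: "\<And>x. x \<ge> 1 \<Longrightarrow> smooth_step x = 1"
    and smooth_step_ge_0: "\<And>x. 0 \<le> smooth_step x"
    and smooth_step_le_1: "\<And>x. smooth_step x \<le> 1"
  using someI_ex[OF exists_smooth_step, folded smooth_step_def] by auto

lemma nderiv_smooth_step_bounded:
  "\<exists>M. \<forall>x. norm (nderiv j (\<lambda>x. of_real (smooth_step x)) x) \<le> M"
proof -
  let ?f = "\<lambda>x. complex_of_real (smooth_step x)"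
  have "compact (nderiv j ?f ` {0..1})"
    by (intro compact_continuous_image continuous_nderiv smooth_smooth_step) simp
  then obtain M where M: "\<And>x. x \<in> {0..1} \<Longrightarrow> norm (nderiv j ?f x) \<le> M"
    using compact_imp_bounded bounded_iff by (metis imageI)
  have "norm (nderiv j ?f x) \<le> max M 1" for x
  proof -
    consider "x \<in> {0..1}" | "x < 0" | "x > 1" by force
    then show ?thesis
    proof cases
      case 1
      then show ?thesis using M by force
    next
      case 2
      have "nderiv j ?f x = nderiv j (\<lambda>_. 0) x"
        by (rule nderiv_eq_on_open[where S="{..<0}"])
           (use 2 smooth_smooth_step smooth_const smooth_step_eq_0 in auto)
      then show ?thesis by (simp add: nderiv_const le_max_iff_disj)
    next
      case 3
      have "nderiv j ?f x = nderiv j (\<lambda>_. 1) x"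
        by (rule nderiv_eq_on_open[where S="{1<..}"])
           (use 3 smooth_smooth_step smooth_const smooth_step_eq_1 in auto)
      then show ?thesis by (simp add: nderiv_const le_max_iff_disj)
    qed
  qed
  then show ?thesis by blast
qed

text \<open>Difference of two steps: it rises on \<open>[a - e, a]\<close> and falls on
  \<open>[b, b + e]\<close>. The arguments have the shape \<open>r * x + s\<close> required by
  \<open>nderiv_affine\<close>.\<close>

definition plateau :: "real \<Rightarrow> real \<Rightarrow> real \<Rightarrow> real \<Rightarrow> complex" where
  "plateau a b e x = of_real (smooth_step ((1/e) * x + (1 - a/e))) - of_real (smooth_step ((1/e) * x + (- b/e)))"

lemma smooth_plateau: "smooth (plateau a b e)"
  unfolding plateau_def by (intro smooth_diff smooth_affine[OF smooth_smooth_step])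

lemma norm_plateau_le: "norm (plateau a b e x) \<le> 1"
proof -
  have "\<bar>smooth_step ((1/e) * x + (1 - a/e)) - smooth_step ((1/e) * x + (- b/e))\<bar> \<le> 1"
    using smooth_step_ge_0 smooth_step_le_1 by (smt (verit))
  then show ?thesis unfolding plateau_def by (metis norm_of_real of_real_diff)
qed

lemma plateau_eq_1:
  assumes "e > 0" "a \<le> x" "x \<le> b"
  shows "plateau a b e x = 1"
  using assms unfolding plateau_def
  by (subst smooth_step_eq_1, simp add: field_simps, subst smooth_step_eq_0) (auto simp: field_simps)

lemma plateau_eq_0:
  assumes "e > 0" "x \<le> a - e \<or> x \<ge> b + e" "a \<le> b"
  shows "plateau a b e x = 0"
proof (cases "x \<ge> b + e")
  case True
  then show ?thesis using assms unfolding plateau_def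
    by (subst (1 2) smooth_step_eq_1) (auto simp: field_simps)
next
  case False
  then show ?thesis using assms unfolding plateau_def
    by (subst (1 2) smooth_step_eq_0) (auto simp: field_simps)
qed

text \<open>Uniformity in the endpoints is the point: with ramps of width 1, each plateau is a
  difference of two translates of one fixed step. Truncations of growing length therefore have
  uniformly bounded derivatives.\<close>

lemma nderiv_plateau_bounded:
  "\<exists>M. \<forall>a b x. norm (nderiv j (plateau a b 1) x) \<le> M"
proof -
  let ?f = "\<lambda>x. complex_of_real (smooth_step x)"
  obtain M where M: "\<And>x. norm (nderiv j ?f x) \<le> M"
    using nderiv_smooth_step_bounded by blast
  have "nderiv j (plateau a b 1) x = nderiv j ?f (x + (1 - a)) - nderiv j ?f (x + (- b))" for a b x
  proof -
    have p: "plateau a b 1 = (\<lambda>x. ?f (1 * x + (1 - a)) - ?f (1 * x + (- b)))"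
      by (auto simp: plateau_def)
    show ?thesis
      unfolding p nderiv_diff[OF smooth_affine[OF smooth_smooth_step] smooth_affine[OF smooth_smooth_step]]
        nderiv_affine[OF smooth_smooth_step] by simp
  qed
  then have "norm (nderiv j (plateau a b 1) x) \<le> M + M" for a b x
    by (simp only:) (intro order_trans[OF norm_triangle_ineq4] add_mono M)
  then show ?thesis by blast
qed

subsection \<open>Schwartz functions\<close>

lemma Cc_inf_imp_Cc: "Cc_inf f \<Longrightarrow> Cc f"
  by (simp add: Cc_inf_def Cc_def smooth_imp_continuous)

lemma Cc_obtain_radius:
  assumes "Cc f"
  obtains R where "R > 0" "\<And>x. \<bar>x\<bar> > R \<Longrightarrow> f x = 0"
proof -
  obtain B where "B > 0" "\<And>x. f x \<noteq> 0 \<Longrightarrow> \<bar>x\<bar> \<le> B"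
    using assms unfolding Cc_def bounded_pos by auto
  then show ?thesis using that[of B] by force
qed

lemma CcI:
  assumes "continuous_on UNIV f" "\<And>x. \<bar>x\<bar> > R \<Longrightarrow> f x = 0"
  shows "Cc f"
  unfolding Cc_def bounded_iff using assms by (auto intro!: exI[of _ R]) (meson leI)

lemma Cc_infI:
  assumes "smooth f" "\<And>x. \<bar>x\<bar> > R \<Longrightarrow> f x = 0"
  shows "Cc_inf f"
  unfolding Cc_inf_def bounded_iff using assms by (auto intro!: exI[of _ R]) (meson leI)

lemma Cc_mult: "continuous_on UNIV g \<Longrightarrow> Cc f \<Longrightarrow> Cc (\<lambda>x. g x * f x)"
  unfolding Cc_def by (auto intro!: continuous_intros elim!: bounded_subset)

lemma Cc_inf_mult: "smooth g \<Longrightarrow> Cc_inf f \<Longrightarrow> Cc_inf (\<lambda>x. g x * f x)"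
  unfolding Cc_inf_def by (auto intro!: smooth_mult elim!: bounded_subset)

lemma Cc_bounded:
  assumes "Cc f"
  obtains B where "B > 0" "\<And>x. norm (f x) \<le> B"
proof -
  obtain R where R: "R > 0" "\<And>x. \<bar>x\<bar> > R \<Longrightarrow> f x = 0" using Cc_obtain_radius[OF assms] by blast
  have "compact (f ` {-R..R})"
    using assms by (intro compact_continuous_image) (auto simp: Cc_def intro: continuous_on_subset)
  then obtain B where B: "\<And>x. x \<in> {-R..R} \<Longrightarrow> norm (f x) \<le> B"
    using compact_imp_bounded bounded_iff by (metis imageI)
  have "norm (f x) \<le> max B 1" for x
    using B[of x] R(2)[of x] by (cases "\<bar>x\<bar> > R") (auto simp: le_max_iff_disj abs_le_iff not_less)
  then show ?thesis using that[of "max B 1"] by auto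
qed

lemma Cc_inf_plateau:
  assumes "e > 0" "a \<le> b"
  shows "Cc_inf (plateau a b e)"
  by (rule Cc_infI[OF smooth_plateau, of "\<bar>a\<bar> + \<bar>b\<bar> + e"]) (use assms in \<open>auto intro!: plateau_eq_0\<close>)

lemma Cc_inf_nderiv:
  assumes "Cc_inf f"
  shows "Cc_inf (nderiv j f)"
proof -
  have sm: "smooth f" using assms by (simp add: Cc_inf_def)
  obtain R where R: "\<And>x. \<bar>x\<bar> > R \<Longrightarrow> f x = 0"
    using Cc_obtain_radius[OF Cc_inf_imp_Cc[OF assms]] by blast
  show ?thesis
  proof (rule Cc_infI[OF smooth_nderiv_smooth[OF sm]])
    fix x :: real assume x: "\<bar>x\<bar> > R"
    have "nderiv j f x = nderiv j (\<lambda>_. 0) x"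
      by (rule nderiv_eq_on_open[OF sm smooth_const, where S="{x. \<bar>x\<bar> > R}"])
         (use x R in \<open>auto intro!: open_Collect_less continuous_intros\<close>)
    then show "nderiv j f x = 0" by (simp add: nderiv_const)
  qed
qed

lemma Cc_inf_imp_schwartz:
  assumes "Cc_inf f"
  shows "schwartz f"
  unfolding schwartz_def
proof (intro conjI allI)
  show "smooth f" using assms by (simp add: Cc_inf_def)
  fix j k
  have "Cc (\<lambda>x. of_real (\<bar>x\<bar> ^ k) * nderiv j f x)"
    by (intro Cc_mult Cc_inf_imp_Cc Cc_inf_nderiv assms continuous_intros)
  then obtain B where "\<And>x. norm (of_real (\<bar>x\<bar> ^ k) * nderiv j f x) \<le> B"
    using Cc_bounded by blast
  then show "\<exists>C. \<forall>x. \<bar>x\<bar> ^ k * norm (nderiv j f x) \<le> C"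
    by (auto simp: norm_mult norm_power)
qed

lemma schwartz_diff:
  assumes "schwartz f" "schwartz g"
  shows "schwartz (\<lambda>x. f x - g x)"
  unfolding schwartz_def
proof (intro conjI allI)
  have sm: "smooth f" "smooth g" using assms by (auto simp: schwartz_def)
  then show "smooth (\<lambda>x. f x - g x)" by (rule smooth_diff)
  fix j k
  obtain C D where "\<And>x. \<bar>x\<bar> ^ k * norm (nderiv j f x) \<le> C" "\<And>x. \<bar>x\<bar> ^ k * norm (nderiv j g x) \<le> D"
    using assms unfolding schwartz_def by meson
  moreover have "\<bar>x\<bar> ^ k * norm (nderiv j f x - nderiv j g x)
     \<le> \<bar>x\<bar> ^ k * norm (nderiv j f x) + \<bar>x\<bar> ^ k * norm (nderiv j g x)" for x
    unfolding distrib_left[symmetric] by (intro mult_left_mono norm_triangle_ineq4) auto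
  ultimately show "\<exists>C. \<forall>x. \<bar>x\<bar> ^ k * norm (nderiv j (\<lambda>x. f x - g x) x) \<le> C"
    unfolding nderiv_diff[OF sm] by (intro exI[of _ "C + D"]) (meson add_mono order_trans)
qed

section \<open>Seminorms and truncation\<close>

lemma sseminorm_upper:
  assumes "schwartz f"
  shows "\<bar>x\<bar> ^ k * norm (nderiv j f x) \<le> sseminorm j k f"
proof -
  obtain C where "\<And>x. \<bar>x\<bar> ^ k * norm (nderiv j f x) \<le> C"
    using assms unfolding schwartz_def by meson
  then show ?thesis unfolding sseminorm_def by (intro cSUP_upper bdd_aboveI2) auto
qed

lemma sseminorm_le:
  assumes "\<And>x. \<bar>x\<bar> ^ k * norm (nderiv j f x) \<le> C"
  shows "sseminorm j k f \<le> C"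
  unfolding sseminorm_def by (intro cSUP_least assms) auto

lemma sseminorm_nonneg: "schwartz f \<Longrightarrow> sseminorm j k f \<ge> 0"
  by (rule order_trans[OF _ sseminorm_upper[where x=0]]) auto

text \<open>Centred at \<open>- b\<close>, so that \<open>cutoff 0 N (x + \<alpha>)\<close> equals
  \<open>cutoff \<alpha> N x\<close>: a translation merely changes the parameter.\<close>

abbreviation cutoff :: "real \<Rightarrow> nat \<Rightarrow> real \<Rightarrow> complex" where
  "cutoff b N \<equiv> plateau (- b - real N) (real N - b) 1"

lemma cutoff_eq_1: "\<bar>x + b\<bar> \<le> real N \<Longrightarrow> cutoff b N x = 1"
  by (rule plateau_eq_1) auto

lemma Cc_inf_cutoff: "Cc_inf (cutoff b N)"
  by (rule Cc_inf_plateau) auto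

text \<open>The error \<open>f (1 - cutoff)\<close> lives where
  \<open>\<bar>x\<bar> \<ge> N - \<bar>b\<bar>\<close>. Rapid decay of \<open>f\<close> affords one
  more power of \<open>\<bar>x\<bar>\<close> than the seminorm asks for, and this spare power yields
  the rate \<open>1 / (N - \<bar>b\<bar>)\<close>.\<close>

lemma sseminorm_cutoff_tendsto_0:
  assumes "schwartz f"
  shows "(\<lambda>N. sseminorm j k (\<lambda>x. f x - f x * cutoff b N x)) \<longlonglongrightarrow> 0"
proof -
  have sm: "smooth f" using assms by (simp add: schwartz_def)
  have "\<forall>i. \<exists>C. \<forall>x. \<bar>x\<bar> ^ Suc k * norm (nderiv i f x) \<le> C"
    using assms unfolding schwartz_def by blast
  then obtain C where C: "\<And>i x. \<bar>x\<bar> ^ Suc k * norm (nderiv i f x) \<le> C i" by metis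
  have "\<forall>i. \<exists>M. \<forall>a b x. norm (nderiv i (plateau a b 1) x) \<le> M"
    using nderiv_plateau_bounded by blast
  then obtain M where M: "\<And>i a b x. norm (nderiv i (plateau a b 1) x) \<le> M i" by metis
  \<comment> \<open>Bound for the Leibniz sum: \<open>C i\<close> for the derivatives of
    \<open>f\<close> weighted with \<open>\<bar>x\<bar> ^ Suc k\<close>, and
    \<open>1 + M (j - i)\<close> for those of \<open>1 - cutoff b N\<close>, for all
    \<open>N\<close> at once.\<close>
  define D where "D = (\<Sum>i\<le>j. real (j choose i) * (C i * (1 + M (j - i))))"
  have C0: "C i \<ge> 0" for i using C[of 0 i] by (simp add: zero_le_mult_iff)
  have M0: "M i \<ge> 0" for i using M[of i] norm_ge_zero order_trans by blast
  have sch: "schwartz (\<lambda>x. f x - f x * cutoff b N x)" for N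
    by (intro schwartz_diff assms Cc_inf_imp_schwartz Cc_inf_mult sm Cc_inf_cutoff)
  have main: "sseminorm j k (\<lambda>x. f x - f x * cutoff b N x) \<le> D / (real N - \<bar>b\<bar>)" if N: "real N > \<bar>b\<bar>" for N
  proof (rule sseminorm_le)
    fix x
    let ?h = "\<lambda>x. 1 - cutoff b N x"
    have smh: "smooth ?h" by (intro smooth_diff smooth_const smooth_plateau)
    have eq: "(\<lambda>x. f x - f x * cutoff b N x) = (\<lambda>x. f x * ?h x)" by (simp add: algebra_simps)
    have D0: "D / (real N - \<bar>b\<bar>) \<ge> 0"
      unfolding D_def using N C0 M0
      by (intro divide_nonneg_nonneg sum_nonneg mult_nonneg_nonneg) (auto simp: add_nonneg_nonneg)
    show "\<bar>x\<bar> ^ k * norm (nderiv j (\<lambda>x. f x - f x * cutoff b N x) x) \<le> D / (real N - \<bar>b\<bar>)"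
    proof (cases "\<bar>x + b\<bar> < real N")
      case True
      have "nderiv i ?h x = nderiv i (\<lambda>_. 0) x" for i
        by (rule nderiv_eq_on_open[OF smh smooth_const, where S="{x. \<bar>x + b\<bar> < real N}"])
           (use True cutoff_eq_1 in \<open>auto intro!: open_Collect_less continuous_intros\<close>)
      then have "nderiv j (\<lambda>x. f x - f x * cutoff b N x) x = 0"
        unfolding eq nderiv_mult[OF sm smh] by (simp add: nderiv_const)
      then show ?thesis using D0 by simp
    next
      case False
      then have x: "\<bar>x\<bar> \<ge> real N - \<bar>b\<bar>" "\<bar>x\<bar> > 0" using N by auto
      have h: "norm (nderiv i ?h x) \<le> 1 + M i" for i
      proof -
        have "nderiv i ?h x = (if i = 0 then 1 else 0) - nderiv i (cutoff b N) x"
          unfolding nderiv_diff[OF smooth_const smooth_plateau] nderiv_const by simp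
        also have "norm \<dots> \<le> norm (if i = 0 then 1 else 0 :: complex) + norm (nderiv i (cutoff b N) x)"
          by (rule norm_triangle_ineq4)
        also have "\<dots> \<le> 1 + M i" using M by (intro add_mono) auto
        finally show ?thesis .
      qed
      have "\<bar>x\<bar> * (\<bar>x\<bar> ^ k * norm (nderiv j (\<lambda>x. f x - f x * cutoff b N x) x))
          = \<bar>x\<bar> ^ Suc k * norm (\<Sum>i\<le>j. of_nat (j choose i) * (nderiv i f x * nderiv (j - i) ?h x))"
        unfolding eq nderiv_mult[OF sm smh] by simp
      also have "\<dots> \<le> \<bar>x\<bar> ^ Suc k * (\<Sum>i\<le>j. real (j choose i) * (norm (nderiv i f x) * norm (nderiv (j - i) ?h x)))"
        by (intro mult_left_mono sum_norm_le) (auto simp: norm_mult)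
      also have "\<dots> = (\<Sum>i\<le>j. real (j choose i) * ((\<bar>x\<bar> ^ Suc k * norm (nderiv i f x)) * norm (nderiv (j - i) ?h x)))"
        by (simp only: sum_distrib_left mult_ac)
      also have "\<dots> \<le> D" unfolding D_def
        by (intro sum_mono mult_left_mono mult_mono C h) (use C0 in auto)
      finally have "\<bar>x\<bar> ^ k * norm (nderiv j (\<lambda>x. f x - f x * cutoff b N x) x) \<le> D / \<bar>x\<bar>"
        using x by (simp add: field_simps)
      also have "\<dots> \<le> D / (real N - \<bar>b\<bar>)"
        using x N D0 by (intro divide_left_mono) (auto simp: zero_le_divide_iff)
      finally show ?thesis .
    qed
  qed
  have "filterlim (\<lambda>N. real N - \<bar>b\<bar>) at_top sequentially"
    using filterlim_tendsto_add_at_top[OF tendsto_const[of "- \<bar>b\<bar>"] filterlim_real_sequentially] by simp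
  then have lim: "(\<lambda>N. D / (real N - \<bar>b\<bar>)) \<longlonglongrightarrow> 0"
    by (intro real_tendsto_divide_at_top[OF tendsto_const])
  have "eventually (\<lambda>N. real N > \<bar>b\<bar>) sequentially"
    using filterlim_real_sequentially filterlim_at_top_dense by blast
  then have up: "eventually (\<lambda>N. sseminorm j k (\<lambda>x. f x - f x * cutoff b N x) \<le> D / (real N - \<bar>b\<bar>)) sequentially"
    by eventually_elim (rule main)
  have "eventually (\<lambda>N. 0 \<le> sseminorm j k (\<lambda>x. f x - f x * cutoff b N x)) sequentially"
    by (simp add: sseminorm_nonneg[OF sch])
  then show ?thesis by (rule tendsto_sandwich[OF _ up tendsto_const lim])
qed

text \<open>Leads from the functional back to the measure: the seminorm bound makes \<open>T\<close>
  continuous, and on truncations \<open>T\<close> is integration against \<open>\<mu>\<close>. The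
  limit does not depend on the centre \<open>b\<close>, which is what the translation argument
  exploits.\<close>

lemma tempered_ext_cutoff:
  assumes T: "tempered_ext \<mu> T" and f: "schwartz f"
  shows "(\<lambda>N. mint \<mu> (\<lambda>x. f x * cutoff b N x)) \<longlonglongrightarrow> T f"
proof -
  obtain K C where bd: "\<And>\<phi>. schwartz \<phi> \<Longrightarrow> norm (T \<phi>) \<le> C * (\<Sum>j\<le>K. \<Sum>k\<le>K. sseminorm j k \<phi>)"
    using T unfolding tempered_ext_def by blast
  have sm: "smooth f" using f by (simp add: schwartz_def)
  have cc: "Cc_inf (\<lambda>x. f x * cutoff b N x)" for N
    by (intro Cc_inf_mult sm Cc_inf_cutoff)
  have cc': "schwartz (\<lambda>x. (-1) * (f x * cutoff b N x))" for N
    by (intro Cc_inf_imp_schwartz Cc_inf_mult[OF smooth_const] cc)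
  have bound: "norm (T f - mint \<mu> (\<lambda>x. f x * cutoff b N x))
     \<le> C * (\<Sum>j\<le>K. \<Sum>k\<le>K. sseminorm j k (\<lambda>x. f x - f x * cutoff b N x))" for N
  proof -
    have "T (\<lambda>x. f x + (-1) * (f x * cutoff b N x)) = T f + T (\<lambda>x. (-1) * (f x * cutoff b N x))"
      using T f cc' unfolding tempered_ext_def by blast
    also have "T (\<lambda>x. (-1) * (f x * cutoff b N x)) = (-1) * T (\<lambda>x. f x * cutoff b N x)"
      using T Cc_inf_imp_schwartz[OF cc] unfolding tempered_ext_def by blast
    also have "T (\<lambda>x. f x * cutoff b N x) = mint \<mu> (\<lambda>x. f x * cutoff b N x)"
      using T cc unfolding tempered_ext_def by blast
    finally have "T f - mint \<mu> (\<lambda>x. f x * cutoff b N x) = T (\<lambda>x. f x - f x * cutoff b N x)"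
      by simp
    then show ?thesis
      using bd[OF schwartz_diff[OF f Cc_inf_imp_schwartz[OF cc]]] by simp
  qed
  have "(\<lambda>N. C * (\<Sum>j\<le>K. \<Sum>k\<le>K. sseminorm j k (\<lambda>x. f x - f x * cutoff b N x)))
      \<longlonglongrightarrow> C * (\<Sum>j\<le>K. \<Sum>k\<le>K. 0)"
    by (intro tendsto_mult tendsto_sum tendsto_const sseminorm_cutoff_tendsto_0 f)
  then have lim: "(\<lambda>N. C * (\<Sum>j\<le>K. \<Sum>k\<le>K. sseminorm j k (\<lambda>x. f x - f x * cutoff b N x)))
      \<longlonglongrightarrow> 0"
    by simp
  have "(\<lambda>N. T f - mint \<mu> (\<lambda>x. f x * cutoff b N x)) \<longlonglongrightarrow> 0"
    by (rule Lim_null_comparison[OF always_eventually[OF allI[OF bound]] lim])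
  from tendsto_diff[OF tendsto_const[of "T f"] this] show ?thesis by simp
qed

subsection \<open>The Fourier transform of compactly supported functions\<close>

definition uchar :: "real \<Rightarrow> complex" where
  "uchar t = exp (2 * of_real pi * \<i> * of_real t)"

lemma uchar_eq_cis: "uchar t = cis (2 * pi * t)"
  by (simp add: uchar_def cis_conv_exp mult_ac)

lemma uchar_add: "uchar (s + t) = uchar s * uchar t"
  by (simp add: uchar_eq_cis cis_mult distrib_left)

lemma uchar_diff: "uchar (s - t) = uchar s * uchar (- t)"
  using uchar_add[of s "-t"] by simp

lemma norm_uchar [simp]: "norm (uchar t) = 1"
  by (simp add: uchar_eq_cis)

lemma uchar_0 [simp]: "uchar 0 = 1"
  by (simp add: uchar_eq_cis)

lemma cnj_uchar [simp]: "cnj (uchar t) = uchar (- t)"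
  by (simp add: uchar_eq_cis cis_cnj)

lemma uchar_of_int [simp]: "uchar (of_int k) = 1"
  by (simp add: uchar_eq_cis cis_multiple_2pi)

lemma uchar_eq_1_iff: "uchar t = 1 \<longleftrightarrow> t \<in> \<int>"
proof
  assume "uchar t = 1"
  then obtain n :: int where "2 * pi * t = of_int (2 * n) * pi"
    unfolding uchar_def exp_eq_1 by auto
  then have "t = of_int n" by simp
  then show "t \<in> \<int>" by simp
qed (auto elim: Ints_cases)

lemma uchar_power: "uchar t ^ n = uchar (real n * t)"
  by (induction n) (simp_all add: distrib_right uchar_add)

lemma continuous_on_uchar [continuous_intros]:
  "continuous_on S f \<Longrightarrow> continuous_on S (\<lambda>x. uchar (f x))"
  unfolding uchar_def by (intro continuous_intros)

lemma smooth_uchar: "smooth (\<lambda>x. uchar (c * x))"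
  using smooth_exp[of "2 * of_real pi * \<i> * of_real c"] by (simp add: uchar_def mult_ac)

lemma uchar_has_vector_derivative:
  "((\<lambda>y. uchar (c * y)) has_vector_derivative 2 * of_real pi * \<i> * of_real c * uchar (c * y)) (at y within S)"
proof -
  have "((\<lambda>z. exp (2 * of_real pi * \<i> * of_real c * z)) has_field_derivative
      2 * of_real pi * \<i> * of_real c * exp (2 * of_real pi * \<i> * of_real c * of_real y)) (at (of_real y))"
    by (auto intro!: derivative_eq_intros)
  from field_vector_diff_chain_at[OF has_vector_derivative_of_real[OF DERIV_ident] this]
  show ?thesis by (auto simp: o_def uchar_def mult_ac intro: has_vector_derivative_at_within)
qed

lemma fourier_eq: "fourier g y = (\<integral>x. uchar (- (x * y)) * g x \<partial>lborel)"
  by (simp add: fourier_def uchar_def)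

lemma Cc_continuous: "Cc f \<Longrightarrow> continuous_on S f"
  unfolding Cc_def by (auto intro: continuous_on_subset)

lemma Cc_integrable:
  assumes "Cc f"
  shows "integrable lborel f"
proof -
  obtain R where "\<And>x. \<bar>x\<bar> > R \<Longrightarrow> f x = 0" using Cc_obtain_radius[OF assms] by blast
  then have "(\<lambda>x. indicator {-R..R} x *\<^sub>R f x) = f"
    by (auto simp: indicator_def fun_eq_iff)
  then show ?thesis
    using borel_integrable_compact[of "{-R..R}" f] Cc_continuous[OF assms] by auto
qed

lemma integral_lborel_eq_Icc:
  fixes f :: "real \<Rightarrow> complex"
  assumes "continuous_on UNIV f" "\<And>x. x \<notin> {a..b} \<Longrightarrow> f x = 0"
  shows "(\<integral>x. f x \<partial>lborel) = integral {a..b} f"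
proof -
  have "Cc f" by (rule CcI[OF assms(1), of "\<bar>a\<bar> + \<bar>b\<bar>"]) (rule assms(2), auto)
  then have "(f has_integral (\<integral>x. f x \<partial>lborel)) UNIV"
    by (intro has_integral_integral_lborel Cc_integrable)
  moreover have "f = (\<lambda>x. if x \<in> {a..b} then f x else 0)" using assms(2) by auto
  ultimately have "(f has_integral (\<integral>x. f x \<partial>lborel)) {a..b}"
    by (metis has_integral_restrict_UNIV)
  then show ?thesis by (simp add: integral_unique)
qed

lemma fourier_eq_Icc:
  assumes "continuous_on UNIV g" "\<And>x. x \<notin> {a..b} \<Longrightarrow> g x = 0"
  shows "fourier g y = integral {a..b} (\<lambda>x. uchar (- (x * y)) * g x)"
  unfolding fourier_eq
  by (rule integral_lborel_eq_Icc) (use assms in \<open>auto intro!: continuous_intros\<close>)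

lemma fourier_has_vector_derivative:
  assumes "Cc g"
  shows "(fourier g has_vector_derivative fourier (\<lambda>x. (- 2 * of_real pi * \<i> * of_real x) * g x) y) (at y)"
proof -
  obtain R where R: "\<And>x. \<bar>x\<bar> > R \<Longrightarrow> g x = 0" using Cc_obtain_radius[OF assms] by blast
  have c: "continuous_on S g" for S using Cc_continuous[OF assms] .
  have z: "g x = 0" if "x \<notin> {-R..R}" for x using R[of x] that by auto
  have "((\<lambda>y. integral (cbox (-R) R) (\<lambda>x. uchar (- (x * y)) * g x)) has_vector_derivative
      integral (cbox (-R) R) (\<lambda>x. uchar (- (x * y)) * ((- 2 * of_real pi * \<i> * of_real x) * g x))) (at y within UNIV)"
  proof (rule leibniz_rule_vector_derivative)
    show "((\<lambda>y. uchar (- (t * y)) * g t) has_vector_derivative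
        uchar (- (t * x)) * ((- 2 * of_real pi * \<i> * of_real t) * g t)) (at x within UNIV)" for x t
      using has_vector_derivative_mult_left[OF uchar_has_vector_derivative[of "-t" x UNIV], of "g t"]
      by (simp add: mult_ac)
    show "(\<lambda>x. uchar (- (x * y)) * g x) integrable_on cbox (-R) R" for y
      by (intro integrable_continuous continuous_intros c)
    have "continuous_on (UNIV \<times> cbox (-R) R) (\<lambda>p::real \<times> real. g (snd p))"
      by (intro continuous_on_compose2[OF c[of UNIV]] continuous_intros) auto
    then show "continuous_on (UNIV \<times> cbox (-R) R)
        (\<lambda>(y, x). uchar (- (x * y)) * ((- 2 * of_real pi * \<i> * of_real x) * g x))"
      by (auto simp: split_beta intro!: continuous_intros)
  qed auto
  moreover have "fourier g = (\<lambda>y. integral (cbox (-R) R) (\<lambda>x. uchar (- (x * y)) * g x))"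
    using fourier_eq_Icc[OF c z] by auto
  moreover have "fourier (\<lambda>x. (- 2 * of_real pi * \<i> * of_real x) * g x) y =
      integral {-R..R} (\<lambda>x. uchar (- (x * y)) * ((- 2 * of_real pi * \<i> * of_real x) * g x))"
    by (rule fourier_eq_Icc) (auto intro!: continuous_intros c simp: z)
  ultimately show ?thesis by simp
qed

lemma continuous_on_fourier:
  assumes "Cc g"
  shows "continuous_on S (fourier g)"
  by (meson assms continuous_at_imp_continuous_on fourier_has_vector_derivative has_vector_derivative_continuous)

lemma fourier_iterated_derivative:
  assumes "Cc g"
  shows "((\<lambda>y. fourier (\<lambda>x. (- 2 * of_real pi * \<i> * of_real x) ^ j * g x) y) has_vector_derivative
    fourier (\<lambda>x. (- 2 * of_real pi * \<i> * of_real x) ^ Suc j * g x) y) (at y)"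
proof -
  have "Cc (\<lambda>x. (- 2 * of_real pi * \<i> * of_real x) ^ j * g x)"
    by (intro Cc_mult assms continuous_intros)
  from fourier_has_vector_derivative[OF this, of y] show ?thesis
    unfolding mult.assoc[symmetric] power_Suc .
qed

lemma fourier_nderiv_1:
  assumes "Cc_inf g"
  shows "fourier (nderiv (Suc 0) g) y = (2 * of_real pi * \<i> * of_real y) * fourier g y"
proof -
  have cc: "Cc g" "Cc (nderiv (Suc 0) g)" using assms Cc_inf_imp_Cc Cc_inf_nderiv by blast+
  have sm: "smooth g" using assms by (simp add: Cc_inf_def)
  obtain R1 where R1: "\<And>x. \<bar>x\<bar> > R1 \<Longrightarrow> g x = 0" using Cc_obtain_radius[OF cc(1)] by blast
  obtain R2 where R2: "\<And>x. \<bar>x\<bar> > R2 \<Longrightarrow> nderiv (Suc 0) g x = 0" using Cc_obtain_radius[OF cc(2)] by blast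
  \<comment> \<open>The margin 1 makes \<open>g\<close> vanish at the endpoints \<open>R\<close> and
    \<open>- R\<close> themselves, so integration by parts has no boundary terms.\<close>
  define R where "R = \<bar>R1\<bar> + \<bar>R2\<bar> + 1"
  have z1: "g x = 0" if "x \<notin> {-R<..<R}" for x using R1[of x] that by (auto simp: R_def)
  have z2: "nderiv (Suc 0) g x = 0" if "x \<notin> {-R<..<R}" for x using R2[of x] that by (auto simp: R_def)
  let ?e = "\<lambda>x. uchar (- y * x)"
  let ?c = "2 * of_real pi * \<i> * of_real (- y) :: complex"
  have d: "((\<lambda>x. ?e x * g x) has_vector_derivative ?e x * nderiv (Suc 0) g x + (?c * ?e x) * g x) (at x within S)" for x S
    using has_vector_derivative_mult[OF uchar_has_vector_derivative[of "-y" x S]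
      has_vector_derivative_at_within[OF smooth_nderiv[OF sm, of 0 x], of S]]
    by simp
  have "((\<lambda>x. ?e x * nderiv (Suc 0) g x + (?c * ?e x) * g x) has_integral ?e R * g R - ?e (-R) * g (-R)) {-R..R}"
    by (rule fundamental_theorem_of_calculus) (use d in \<open>auto simp: R_def\<close>)
  then have "integral {-R..R} (\<lambda>x. ?e x * nderiv (Suc 0) g x + (?c * ?e x) * g x) = 0"
    using z1[of R] z1[of "-R"] by (simp add: integral_unique)
  also have "integral {-R..R} (\<lambda>x. ?e x * nderiv (Suc 0) g x + (?c * ?e x) * g x)
      = integral {-R..R} (\<lambda>x. ?e x * nderiv (Suc 0) g x) + integral {-R..R} (\<lambda>x. ?c * (?e x * g x))"
    unfolding mult.assoc[of ?c]
    by (intro Henstock_Kurzweil_Integration.integral_add integrable_continuous_interval continuous_intros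
          Cc_continuous[OF cc(1)] Cc_continuous[OF cc(2)])
  also have "integral {-R..R} (\<lambda>x. ?e x * nderiv (Suc 0) g x) = fourier (nderiv (Suc 0) g) y"
    by (subst fourier_eq_Icc[where a="-R" and b=R])
       (use z2 Cc_continuous[OF cc(2)] in \<open>auto simp: mult_ac\<close>)
  also have "integral {-R..R} (\<lambda>x. ?c * (?e x * g x)) = ?c * fourier g y"
    unfolding integral_mult_right
    by (subst fourier_eq_Icc[where a="-R" and b=R])
       (use z1 Cc_continuous[OF cc(1)] in \<open>auto simp: mult.commute[of y]\<close>)
  finally show ?thesis by (simp add: algebra_simps add_eq_0_iff)
qed

lemma fourier_nderiv:
  assumes "Cc_inf g"
  shows "fourier (nderiv k g) y = (2 * of_real pi * \<i> * of_real y) ^ k * fourier g y"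
proof (induction k)
  case (Suc k)
  have "fourier (nderiv (Suc k) g) y = fourier (nderiv (Suc 0) (nderiv k g)) y" by simp
  also have "\<dots> = (2 * of_real pi * \<i> * of_real y) * fourier (nderiv k g) y"
    by (rule fourier_nderiv_1[OF Cc_inf_nderiv[OF assms]])
  finally show ?case using Suc by simp
qed simp

lemma norm_fourier_le: "norm (fourier g y) \<le> (\<integral>x. norm (g x) \<partial>lborel)"
  unfolding fourier_eq using integral_norm_bound[of lborel "\<lambda>x. uchar (- (x * y)) * g x"]
  by (simp add: norm_mult)

lemma fourier_decay:
  assumes "Cc_inf g"
  shows "\<bar>y\<bar> ^ k * norm (fourier g y) \<le> (\<integral>x. norm (nderiv k g x) \<partial>lborel)"
proof -
  have "1 * \<bar>y\<bar> \<le> (2 * pi) * \<bar>y\<bar>"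
    using pi_ge_two by (intro mult_right_mono) auto
  also have "\<dots> = norm (2 * of_real pi * \<i> * of_real y :: complex)"
    by (simp add: norm_mult)
  finally have "\<bar>y\<bar> ^ k \<le> norm ((2 * of_real pi * \<i> * of_real y :: complex) ^ k)"
    unfolding norm_power by (intro power_mono) auto
  then have "\<bar>y\<bar> ^ k * norm (fourier g y) \<le> norm ((2 * of_real pi * \<i> * of_real y :: complex) ^ k) * norm (fourier g y)"
    by (rule mult_right_mono) simp
  also have "\<dots> = norm (fourier (nderiv k g) y)"
    unfolding fourier_nderiv[OF assms] norm_mult ..
  finally show ?thesis using norm_fourier_le order_trans by blast
qed

text \<open>Differentiating under the integral multiplies \<open>g\<close> by powers of
  \<open>- 2 pi i x\<close>, which keeps it in \<open>Cc_inf\<close>; decay of each such transform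
  comes from integration by parts.\<close>

lemma schwartz_fourier:
  assumes "Cc_inf g"
  shows "schwartz (fourier g)"
  unfolding schwartz_def
proof (intro conjI allI)
  let ?F = "\<lambda>j. fourier (\<lambda>x. (- 2 * of_real pi * \<i> * of_real x) ^ j * g x)"
  have F: "?F 0 = fourier g" "\<And>j x. (?F j has_vector_derivative ?F (Suc j) x) (at x)"
    using fourier_iterated_derivative[OF Cc_inf_imp_Cc[OF assms]] by auto
  show "smooth (fourier g)" by (rule smoothI[where F="?F", OF F])
  fix j k
  have "smooth (\<lambda>x. (- 2 * of_real pi * \<i> * of_real x) ^ j)"
  proof (induction j)
    case (Suc j)
    have "smooth (\<lambda>x. - 2 * of_real pi * \<i> * of_real x)"
      by (intro smooth_mult smooth_const smooth_id)
    from smooth_mult[OF this Suc] show ?case by simp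
  qed (simp add: smooth_const)
  then have "Cc_inf (\<lambda>x. (- 2 * of_real pi * \<i> * of_real x) ^ j * g x)"
    using assms by (rule Cc_inf_mult)
  from fourier_decay[OF this] show "\<exists>C. \<forall>x. \<bar>x\<bar> ^ k * norm (nderiv j (fourier g) x) \<le> C"
    unfolding nderiv_eqI[where F="?F", OF F] by blast
qed

lemma fourier_modulation: "fourier (\<lambda>x. uchar (- (t * x)) * g x) y = fourier g (y + t)"
  unfolding fourier_eq mult.assoc[symmetric] uchar_add[symmetric]
  by (simp add: algebra_simps)

subsection \<open>Convolutions\<close>

lemma conv_eq_Icc:
  assumes "Cc g" "Cc h" "\<And>x. x \<notin> {a..b} \<Longrightarrow> h x = 0"
  shows "conv g h x = integral {a..b} (\<lambda>y. g (x - y) * h y)"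
  unfolding conv_def
proof (rule integral_lborel_eq_Icc)
  show "continuous_on UNIV (\<lambda>y. g (x - y) * h y)"
    by (intro continuous_on_mult Cc_continuous[OF assms(2)] continuous_on_compose2[OF Cc_continuous[OF assms(1), of UNIV]])
       (auto intro!: continuous_intros)
qed (use assms(3) in auto)

lemma Cc_conv:
  assumes "Cc g" "Cc h"
  shows "Cc (conv g h)"
proof -
  obtain R1 where R1: "\<And>x. \<bar>x\<bar> > R1 \<Longrightarrow> g x = 0" using Cc_obtain_radius[OF assms(1)] by blast
  obtain R2 where R2: "\<And>x. \<bar>x\<bar> > R2 \<Longrightarrow> h x = 0" using Cc_obtain_radius[OF assms(2)] by blast
  have z: "h x = 0" if "x \<notin> {-R2..R2}" for x using R2[of x] that by auto
  have "continuous_on UNIV (\<lambda>x. integral (cbox (-R2) R2) (\<lambda>y. g (x - y) * h y))"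
    by (rule integral_continuous_on_param)
       (auto simp: split_beta intro!: continuous_intros continuous_on_compose2[OF Cc_continuous[OF assms(1), of UNIV]]
          continuous_on_compose2[OF Cc_continuous[OF assms(2), of UNIV]])
  then have "continuous_on UNIV (conv g h)"
    using conv_eq_Icc[OF assms z] by (simp add: fun_eq_iff cong: continuous_on_cong)
  moreover have "conv g h x = 0" if "\<bar>x\<bar> > R1 + R2" for x
  proof -
    have "g (x - y) * h y = 0" for y
      using R1[of "x - y"] R2[of y] that by (cases "\<bar>y\<bar> > R2") auto
    then show ?thesis unfolding conv_def by (simp only: Bochner_Integration.integral_zero)
  qed
  ultimately show ?thesis by (rule CcI)
qed

lemma fourier_conv:
  assumes "Cc g" "Cc h"
  shows "fourier (conv g h) y = fourier g y * fourier h y"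
proof -
  obtain R1 where R1: "\<And>x. \<bar>x\<bar> > R1 \<Longrightarrow> g x = 0" using Cc_obtain_radius[OF assms(1)] by blast
  obtain R2 where R2: "\<And>x. \<bar>x\<bar> > R2 \<Longrightarrow> h x = 0" using Cc_obtain_radius[OF assms(2)] by blast
  let ?f = "\<lambda>x t. uchar (- (x * y)) * (g (x - t) * h t)"
  \<comment> \<open>The integrand of the double integral vanishes outside this rectangle, so
    Fubini's theorem needs only continuity on a compact set.\<close>
  let ?K = "{-(R1 + R2)..R1 + R2} \<times> {-R2..R2}"
  have z: "?f x t = 0" if "(x, t) \<notin> ?K" for x t
  proof (rule ccontr)
    assume "\<not> ?thesis"
    then have "\<not> \<bar>x - t\<bar> > R1" "\<not> \<bar>t\<bar> > R2" using R1 R2 by auto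
    then show False using that by auto
  qed
  have "continuous_on ?K (case_prod ?f)"
    by (auto simp: split_beta intro!: continuous_intros continuous_on_compose2[OF Cc_continuous[OF assms(1), of UNIV]]
          continuous_on_compose2[OF Cc_continuous[OF assms(2), of UNIV]])
  then have "integrable lborel (\<lambda>p. indicator ?K p *\<^sub>R case_prod ?f p)"
    by (intro borel_integrable_compact compact_Times) auto
  also have "(\<lambda>p. indicator ?K p *\<^sub>R case_prod ?f p) = case_prod ?f"
    using z by (auto simp: indicator_def fun_eq_iff simp del: mult_eq_0_iff)
  finally have int: "integrable (lborel \<Otimes>\<^sub>M lborel) (case_prod ?f)"
    by (simp add: lborel_prod)
  have "fourier (conv g h) y = (\<integral>x. (\<integral>t. ?f x t \<partial>lborel) \<partial>lborel)"
    unfolding fourier_eq conv_def by simp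
  also have "\<dots> = (\<integral>t. (\<integral>x. ?f x t \<partial>lborel) \<partial>lborel)"
    by (rule lborel_pair.Fubini_integral[OF int, symmetric])
  also have "\<dots> = (\<integral>t. fourier g y * (uchar (- (t * y)) * h t) \<partial>lborel)"
  proof (rule Bochner_Integration.integral_cong)
    fix t
    have "(\<integral>x. ?f x t \<partial>lborel) = (\<integral>x. ?f (t + 1 * x) t \<partial>lborel)"
      using lborel_integral_real_affine[of 1 "\<lambda>x. ?f x t" t] by simp
    also have "\<dots> = (\<integral>x. (uchar (- (x * y)) * g x) * (uchar (- (t * y)) * h t) \<partial>lborel)"
    proof (rule Bochner_Integration.integral_cong)
      fix x
      have "uchar (- ((t + 1 * x) * y)) = uchar (- (x * y)) * uchar (- (t * y))"
        unfolding uchar_add[symmetric] by (simp add: algebra_simps)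
      then show "?f (t + 1 * x) t = (uchar (- (x * y)) * g x) * (uchar (- (t * y)) * h t)" by simp
    qed simp
    also have "\<dots> = fourier g y * (uchar (- (t * y)) * h t)"
      unfolding fourier_eq by simp
    finally show "(\<integral>x. ?f x t \<partial>lborel) = fourier g y * (uchar (- (t * y)) * h t)" .
  qed simp
  also have "\<dots> = fourier g y * fourier h y" unfolding fourier_eq[of h] by simp
  finally show ?thesis .
qed

text \<open>A character is a homomorphism and therefore passes into both factors. This makes
  \<open>Cc_conv_span\<close> stable under modulation.\<close>

lemma conv_modulation:
  "uchar (t * x) * conv g h x = conv (\<lambda>x. uchar (t * x) * g x) (\<lambda>x. uchar (t * x) * h x) x"
proof -
  have "uchar (t * (x - y)) * g (x - y) * (uchar (t * y) * h y) = uchar (t * x) * (g (x - y) * h y)" for y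
  proof -
    have "uchar (t * x) = uchar (t * (x - y)) * uchar (t * y)"
      unfolding uchar_add[symmetric] by (simp add: algebra_simps)
    then show ?thesis by simp
  qed
  then show ?thesis unfolding conv_def by (simp only: integral_mult_right_zero)
qed

subsection \<open>Uniqueness of Fourier coefficients\<close>

lemma integral_uchar:
  fixes j :: int
  assumes "L > 0"
  shows "integral {0..L} (\<lambda>x. uchar (of_int j / L * x)) = (if j = 0 then of_real L else 0)"
proof (cases "j = 0")
  case False
  define c where "c = of_int j / L"
  have c: "c \<noteq> 0" using False assms by (simp add: c_def)
  let ?d = "2 * of_real pi * \<i> * of_real c :: complex"
  have d: "?d \<noteq> 0" using c by simp
  have "((\<lambda>x. inverse ?d * uchar (c * x)) has_vector_derivative uchar (c * x)) (at x within {0..L})" for x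
    using has_vector_derivative_mult_right[OF uchar_has_vector_derivative[of c x "{0..L}"], of "inverse ?d"] d
    by (simp add: field_simps)
  then have "((\<lambda>x. uchar (c * x)) has_integral inverse ?d * uchar (c * L) - inverse ?d * uchar (c * 0)) {0..L}"
    using assms by (intro fundamental_theorem_of_calculus) auto
  moreover have "uchar (c * L) = 1" using assms by (simp add: c_def)
  ultimately show ?thesis using False by (simp add: c_def integral_unique)
qed (use assms in \<open>simp add: scaleR_conv_of_real\<close>)

text \<open>Orthogonality to all characters of period \<open>L\<close>, stated for continuous
  functions on one closed period. The condition is linear and stable under multiplication by
  characters, hence by polynomials in the real and imaginary parts of
  \<open>uchar (x / L)\<close>.\<close>

definition coeffs_vanish :: "real \<Rightarrow> (real \<Rightarrow> complex) \<Rightarrow> bool" where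
  "coeffs_vanish L H \<longleftrightarrow> continuous_on {0..L} H \<and>
     (\<forall>j::int. integral {0..L} (\<lambda>x. H x * uchar (of_int j / L * x)) = 0)"

lemma coeffs_vanish_lincomb:
  assumes "coeffs_vanish L H" "coeffs_vanish L K"
  shows "coeffs_vanish L (\<lambda>x. a * H x + b * K x)"
  unfolding coeffs_vanish_def
proof (intro conjI allI)
  have c: "continuous_on {0..L} H" "continuous_on {0..L} K"
    using assms by (auto simp: coeffs_vanish_def)
  then show "continuous_on {0..L} (\<lambda>x. a * H x + b * K x)"
    by (intro continuous_intros)
  fix j :: int
  have "integral {0..L} (\<lambda>x. (a * H x + b * K x) * uchar (of_int j / L * x)) =
     integral {0..L} (\<lambda>x. a * (H x * uchar (of_int j / L * x)) + b * (K x * uchar (of_int j / L * x)))"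
    by (simp add: algebra_simps)
  also have "\<dots> = integral {0..L} (\<lambda>x. a * (H x * uchar (of_int j / L * x)))
      + integral {0..L} (\<lambda>x. b * (K x * uchar (of_int j / L * x)))"
    by (intro Henstock_Kurzweil_Integration.integral_add integrable_continuous_interval continuous_intros c)
  finally show "integral {0..L} (\<lambda>x. (a * H x + b * K x) * uchar (of_int j / L * x)) = 0"
    using assms unfolding coeffs_vanish_def integral_mult_right by simp
qed

lemma coeffs_vanish_shift:
  assumes "coeffs_vanish L H"
  shows "coeffs_vanish L (\<lambda>x. H x * uchar (of_int m / L * x))"
  unfolding coeffs_vanish_def
proof (intro conjI allI)
  show "continuous_on {0..L} (\<lambda>x. H x * uchar (of_int m / L * x))"
    using assms unfolding coeffs_vanish_def by (intro continuous_intros) auto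
  fix j :: int
  have "H x * uchar (of_int m / L * x) * uchar (of_int j / L * x) = H x * uchar (of_int (m + j) / L * x)" for x
    unfolding mult.assoc[of "H x"] uchar_add[symmetric] of_int_add add_divide_distrib distrib_right ..
  then show "integral {0..L} (\<lambda>x. H x * uchar (of_int m / L * x) * uchar (of_int j / L * x)) = 0"
    using assms unfolding coeffs_vanish_def by (simp only:)
qed

text \<open>The multiplicative step works because the hypothesis is quantified over all \<open>H\<close>.\<close>

lemma coeffs_vanish_polynomial:
  assumes "real_polynomial_function p" "coeffs_vanish L H"
  shows "coeffs_vanish L (\<lambda>x. H x * of_real (p (uchar (x / L))))"
  using assms
proof (induction p arbitrary: H rule: real_polynomial_function.induct)
  case (linear f)
  interpret f: bounded_linear f by fact
  \<comment> \<open>A real linear \<open>f\<close> is determined by \<open>f 1\<close> and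
    \<open>f \<i>\<close>; on the unit circle the real part is \<open>(u + 1/u) / 2\<close> and the
    imaginary part \<open>(u - 1/u) / (2 \<i>)\<close>, with \<open>u = uchar t\<close>.\<close>
  define A B where "A = of_real (f 1) / 2 + of_real (f \<i>) / (2 * \<i>)"
    and "B = of_real (f 1) / 2 - of_real (f \<i>) / (2 * \<i>)"
  have f: "of_real (f (uchar t)) = A * uchar t + B * uchar (- t)" for t
  proof -
    have "f (uchar t) = f (Re (uchar t) *\<^sub>R 1 + Im (uchar t) *\<^sub>R \<i>)"
      by (intro arg_cong[of _ _ f]) (simp add: complex_eq_iff)
    also have "\<dots> = Re (uchar t) * f 1 + Im (uchar t) * f \<i>"
      by (simp only: f.add f.scaleR real_scaleR_def)
    finally show ?thesis
      unfolding cnj_uchar[symmetric] A_def B_def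
      by (auto simp: complex_eq_iff field_simps uchar_eq_cis)
  qed
  have "coeffs_vanish L (\<lambda>x. A * (H x * uchar (of_int 1 / L * x)) + B * (H x * uchar (of_int (-1) / L * x)))"
    by (intro coeffs_vanish_lincomb coeffs_vanish_shift linear)
  then show ?case by (simp add: f algebra_simps)
next
  case (const c)
  then show ?case
    using coeffs_vanish_lincomb[OF const const, of "of_real c" 0] by (simp add: mult_ac)
next
  case (add f g)
  then show ?case
    using coeffs_vanish_lincomb[OF add(3,4)[OF add(5)], of 1 1] by (simp add: algebra_simps)
next
  case (mult f g)
  then show ?case
    using mult(4)[OF mult(3)[OF mult(5)]] by (simp add: mult_ac)
qed

lemma periodic_add_int:
  fixes F :: "real \<Rightarrow> 'a"
  assumes "\<And>x. F (x + L) = F x"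
  shows "F (x + of_int k * L) = F x"
proof -
  have nat: "F (x + real n * L) = F x" for n x
  proof (induction n arbitrary: x)
    case (Suc n)
    have "F (x + real (Suc n) * L) = F ((x + real n * L) + L)" by (simp add: algebra_simps)
    then show ?case using Suc assms by simp
  qed simp
  show ?thesis
  proof (cases "k \<ge> 0")
    case True
    then show ?thesis using nat[of x "nat k"] by simp
  next
    case False
    then show ?thesis using nat[of "x + of_int k * L" "nat (- k)"] by simp
  qed
qed

text \<open>Every branch of the argument jumps somewhere. Periodicity of \<open>F\<close> makes the
  lifts through \<open>Arg2pi\<close> (cut along the positive axis) and \<open>Arg\<close> (cut
  along the negative axis) the same function, so continuity at each point can be read from a branch
  that is continuous there.\<close>

lemma continuous_on_circle_lift:
  fixes F :: "real \<Rightarrow> complex"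
  assumes L: "L > 0" and F: "continuous_on UNIV F" "\<And>x. F (x + L) = F x"
  obtains G where "continuous_on (sphere 0 1) G" "\<And>x. G (uchar (x / L)) = F x"
proof -
  have eqF: "F (L * s) = F (L * t)" if "uchar s = uchar t" for s t
  proof -
    have "uchar (s - t) = uchar t * uchar (- t)" using that by (simp add: uchar_diff)
    also have "\<dots> = 1" using uchar_diff[of t t] by simp
    finally obtain k :: int where "s - t = of_int k" by (auto simp: uchar_eq_1_iff elim: Ints_cases)
    then have "L * s = L * t + of_int k * L" by (simp add: algebra_simps)
    then show ?thesis using periodic_add_int[of F L, OF F(2)] by simp
  qed
  define G where "G z = F (L * (Arg2pi z / (2 * pi)))" for z
  have u1: "uchar (Arg2pi z / (2 * pi)) = sgn z" if "z \<noteq> 0" for z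
    using that Arg2pi_eq[of z] by (simp add: uchar_eq_cis cis_conv_exp sgn_eq mult_ac field_simps)
  have u2: "uchar (Arg z / (2 * pi)) = sgn z" if "z \<noteq> 0" for z
    using that by (simp add: uchar_eq_cis cis_Arg)
  have alt: "G z = F (L * (Arg z / (2 * pi)))" if "z \<noteq> 0" for z
    unfolding G_def using that by (intro eqF) (simp add: u1 u2)
  have Fat: "isCont F x" for x using F(1) continuous_on_eq_continuous_at by blast
  have "isCont G z" if "z \<noteq> 0" for z
  proof (cases "z \<in> \<real>\<^sub>\<ge>\<^sub>0")
    case False
    then have "isCont Arg2pi z" by (rule continuous_at_Arg2pi)
    then have "isCont (\<lambda>z. L * (Arg2pi z / (2 * pi))) z" by (intro continuous_intros) auto
    then show ?thesis unfolding G_def by (rule isCont_o2[OF _ Fat])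
  next
    case True
    then have "z \<notin> \<real>\<^sub>\<le>\<^sub>0" using that by (auto simp: complex_nonneg_Reals_iff complex_nonpos_Reals_iff complex_eq_iff)
    then have "isCont Arg z" by (rule continuous_at_Arg)
    then have "isCont (\<lambda>z. L * (Arg z / (2 * pi))) z" by (intro continuous_intros) auto
    then have c: "isCont (\<lambda>z. F (L * (Arg z / (2 * pi)))) z" by (rule isCont_o2[OF _ Fat])
    have "eventually (\<lambda>w. w \<noteq> 0) (nhds z)" using that by (rule t1_space_nhds)
    then have "eventually (\<lambda>w. G w = F (L * (Arg w / (2 * pi)))) (nhds z)"
      by eventually_elim (rule alt)
    then show ?thesis using c by (simp add: isCont_cong)
  qed
  then have "continuous_on (sphere 0 1) G"
    by (intro continuous_at_imp_continuous_on ballI) (metis mem_sphere_0 norm_zero zero_neq_one)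
  moreover have "G (uchar (x / L)) = F x" for x
  proof -
    have "G (uchar (x / L)) = F (L * (x / L))"
      unfolding G_def by (intro eqF, subst u1) (auto simp: sgn_eq uchar_eq_cis)
    then show ?thesis using L by simp
  qed
  ultimately show ?thesis by (rule that)
qed

text \<open>Stone-Weierstrass on the circle approximates the conjugate of the lifted function within
  \<open>e\<close> by a polynomial function \<open>g\<close>. Since \<open>F\<close> is orthogonal
  to \<open>g (uchar (x / L))\<close>, the integral of \<open>\<bar>F\<bar>^2\<close> over a period
  is at most \<open>e * (B * L)\<close> for every \<open>e > 0\<close>, hence 0, and continuity
  gives \<open>F = 0\<close>.\<close>

lemma fourier_coefficients_unique:
  assumes L: "L > 0" and F: "continuous_on UNIV F" "\<And>x. F (x + L) = F x"
    and coeff: "\<And>j::int. integral {0..L} (\<lambda>x. F x * uchar (of_int j / L * x)) = 0"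
  shows "F x = 0"
proof -
  obtain G where G: "continuous_on (sphere 0 1) G" "\<And>x. G (uchar (x / L)) = F x"
    using continuous_on_circle_lift[OF L F] by blast
  have c: "continuous_on S F" for S using F(1) continuous_on_subset by blast
  have van: "coeffs_vanish L F" using coeff c by (simp add: coeffs_vanish_def)
  obtain B where B: "B > 0" "\<And>x. x \<in> {0..L} \<Longrightarrow> norm (F x) \<le> B"
    using compact_imp_bounded[OF compact_continuous_image[OF c compact_Icc, of 0 L]]
    unfolding bounded_pos by auto
  have small: "norm (integral {0..L} (\<lambda>x. F x * cnj (F x))) \<le> e * (B * L)" if "e > 0" for e
  proof -
    have "continuous_on (sphere 0 1) (\<lambda>z. cnj (G z))" using G(1) by (intro continuous_intros)
    from Stone_Weierstrass_polynomial_function[OF compact_sphere this that]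
    obtain g where g: "polynomial_function g" "\<And>z. z \<in> sphere 0 1 \<Longrightarrow> norm (cnj (G z) - g z) < e"
      by blast
    have "real_polynomial_function (Re \<circ> g)" "real_polynomial_function (Im \<circ> g)"
      using g(1) bounded_linear_Re bounded_linear_Im unfolding polynomial_function_def by blast+
    from coeffs_vanish_lincomb[OF coeffs_vanish_polynomial[OF this(1) van] coeffs_vanish_polynomial[OF this(2) van], of 1 \<i>]
    have "coeffs_vanish L (\<lambda>x. F x * g (uchar (x / L)))"
      by (simp add: distrib_left[symmetric] mult.left_commute[of \<i>] complex_eq[symmetric])
    then have cg: "continuous_on {0..L} (\<lambda>x. F x * g (uchar (x / L)))"
      and 0: "integral {0..L} (\<lambda>x. F x * g (uchar (x / L))) = 0"
      unfolding coeffs_vanish_def by (auto dest: spec[of _ 0])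
    have "integral {0..L} (\<lambda>x. F x * cnj (F x)) = integral {0..L} (\<lambda>x. F x * cnj (F x) - F x * g (uchar (x / L)))"
      using 0 cg by (subst Henstock_Kurzweil_Integration.integral_diff)
        (auto intro!: integrable_continuous_interval continuous_intros c)
    also have "norm \<dots> \<le> e * B * (L - 0)"
    proof (rule integral_bound)
      show "continuous_on {0..L} (\<lambda>x. F x * cnj (F x) - F x * g (uchar (x / L)))"
        by (intro continuous_intros c cg)
      fix x assume x: "x \<in> {0..L}"
      have "F x * cnj (F x) - F x * g (uchar (x / L)) = (cnj (G (uchar (x / L))) - g (uchar (x / L))) * F x"
        unfolding G(2) by (simp add: algebra_simps)
      also have "norm \<dots> \<le> e * B"
        unfolding norm_mult using g(2)[of "uchar (x / L)"] B(2)[OF x] that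
        by (intro mult_mono) auto
      finally show "norm (F x * cnj (F x) - F x * g (uchar (x / L))) \<le> e * B" .
    qed (use L in auto)
    finally show ?thesis by (simp add: mult_ac)
  qed
  have "norm (integral {0..L} (\<lambda>x. F x * cnj (F x))) \<le> 0"
  proof (rule field_le_epsilon)
    fix e :: real assume "e > 0"
    then show "norm (integral {0..L} (\<lambda>x. F x * cnj (F x))) \<le> 0 + e"
      using small[of "e / (B * L)"] B L by simp
  qed
  moreover have "(\<lambda>x. F x * cnj (F x)) integrable_on {0..L}"
    by (intro integrable_continuous_interval continuous_intros c)
  ultimately have "((\<lambda>x. F x * cnj (F x)) has_integral 0) {0..L}"
    by (simp add: has_integral_integral)
  from has_integral_linear[OF this bounded_linear_Re]
  have "((\<lambda>x. (norm (F x))\<^sup>2) has_integral 0) (cbox 0 L)"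
    by (simp add: o_def complex_norm_square[symmetric] del: of_real_power)
  moreover have "continuous_on (cbox 0 L) (\<lambda>x. (norm (F x))\<^sup>2)"
    by (intro continuous_intros c)
  ultimately have z: "F x = 0" if "x \<in> {0..L}" for x
    using has_integral_0_cbox_imp_0[of 0 L "\<lambda>x. (norm (F x))\<^sup>2" x] that L by auto
  have "F x = F (frac (x / L) * L + of_int \<lfloor>x / L\<rfloor> * L)"
    using L by (simp add: frac_def algebra_simps)
  also have "\<dots> = F (frac (x / L) * L)" by (rule periodic_add_int[of F L, OF F(2)])
  also have "\<dots> = 0"
    using L frac_lt_1[of "x / L"] by (intro z) (auto intro: mult_left_le_one_le)
  finally show ?thesis .
qed

subsection \<open>Poisson summation\<close>

lemma trigonometric_series:
  fixes c :: "int \<Rightarrow> complex"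
  assumes L: "L > 0" and summable: "(\<lambda>j. norm (c j)) summable_on UNIV"
  defines "S \<equiv> \<lambda>x. \<Sum>\<^sub>\<infinity>j. c j * uchar (of_int j / L * x)"
  shows continuous_on_trigonometric_series: "continuous_on A S"
    and trigonometric_series_periodic: "S (x + L) = S x"
    and integral_trigonometric_series:
      "integral {0..L} (\<lambda>x. S x * uchar (of_int m / L * x)) = of_real L * c (- m)"
proof -
  have ul: "uniform_limit Y (\<lambda>J x. \<Sum>j\<in>J. c j * uchar (of_int j / L * x)) S (finite_subsets_at_top UNIV)" for Y
    unfolding S_def by (rule Weierstrass_m_test_general[where M="\<lambda>j. norm (c j)"])
      (auto simp: norm_mult summable)
  have "continuous_on A (\<lambda>x. \<Sum>j\<in>J. c j * uchar (of_int j / L * x))" for J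
    by (intro continuous_on_sum continuous_on_mult continuous_on_uchar continuous_on_const continuous_on_id)
  then show "continuous_on A S"
    by (intro uniform_limit_theorem[OF always_eventually ul]) auto
  have "uchar (of_int j / L * (x + L)) = uchar (of_int j / L * x)" for j :: int
    using L uchar_add[of "of_int j / L * x" "of_int j"] by (simp add: distrib_left)
  then show "S (x + L) = S x" unfolding S_def by simp
  let ?t = "\<lambda>(j::int) x. c j * uchar (of_int (j + m) / L * x)"
  have tm: "?t j x = c j * uchar (of_int j / L * x) * uchar (of_int m / L * x)" for j x
    unfolding mult.assoc[of "c j"] uchar_add[symmetric] of_int_add add_divide_distrib distrib_right ..
  have "(\<Sum>\<^sub>\<infinity>j. ?t j x) = S x * uchar (of_int m / L * x)" for x
    unfolding tm S_def by (rule infsum_cmult_left')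
  moreover have "uniform_limit {0..L} (\<lambda>J x. \<Sum>j\<in>J. ?t j x) (\<lambda>x. \<Sum>\<^sub>\<infinity>j. ?t j x) (finite_subsets_at_top UNIV)"
    by (rule Weierstrass_m_test_general[where M="\<lambda>j. norm (c j)"]) (auto simp: norm_mult summable)
  ultimately have ul2: "uniform_limit {0..L} (\<lambda>J x. \<Sum>j\<in>J. ?t j x) (\<lambda>x. S x * uchar (of_int m / L * x)) (finite_subsets_at_top UNIV)"
    by simp
  have ct: "continuous_on {0..L} (\<lambda>x. ?t j x)" for j by (intro continuous_on_mult continuous_on_uchar continuous_on_const continuous_on_id)
  have ct': "continuous_on {0..L} (\<lambda>x. \<Sum>j\<in>J. ?t j x)" for J by (rule continuous_on_sum) (rule ct)
  obtain I K where IK: "\<And>J. ((\<lambda>x. \<Sum>j\<in>J. ?t j x) has_integral I J) {0..L}"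
      "((\<lambda>x. S x * uchar (of_int m / L * x)) has_integral K) {0..L}"
      "(I \<longlongrightarrow> K) (finite_subsets_at_top UNIV)"
    by (rule uniform_limit_integral[OF ul2 ct' finite_subsets_at_top_neq_bot]) (rule that)
  \<comment> \<open>By orthogonality the integral of a finite partial sum is already the final value
    once the index \<open>- m\<close> is included; the net \<open>I\<close> is eventually
    constant.\<close>
  have "I J = of_real L * c (- m)" if J: "finite J" "- m \<in> J" for J
  proof -
    have "I J = integral {0..L} (\<lambda>x. \<Sum>j\<in>J. ?t j x)" by (rule integral_unique[OF IK(1), symmetric])
    also have "\<dots> = (\<Sum>j\<in>J. integral {0..L} (?t j))"
      using J ct by (intro Henstock_Kurzweil_Integration.integral_sum integrable_continuous_interval) auto
    also have "\<dots> = (\<Sum>j\<in>J. if j = - m then of_real L * c j else 0)"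
      unfolding integral_mult_right integral_uchar[OF L]
      by (intro sum.cong) (auto simp: add_eq_0_iff2)
    finally show ?thesis using J by simp
  qed
  then have "eventually (\<lambda>J. I J = of_real L * c (- m)) (finite_subsets_at_top UNIV)"
    unfolding eventually_finite_subsets_at_top by (intro exI[of _ "{- m}"]) auto
  then have "(I \<longlongrightarrow> of_real L * c (- m)) (finite_subsets_at_top UNIV)"
    by (rule tendsto_eventually)
  then have "K = of_real L * c (- m)"
    using IK(3) tendsto_unique[OF finite_subsets_at_top_neq_bot] by blast
  then show "integral {0..L} (\<lambda>x. S x * uchar (of_int m / L * x)) = of_real L * c (- m)"
    using IK(2) by (simp add: integral_unique)
qed

text \<open>An unordered sum over all integers, so that one notion serves both a compactly supported
  function, where the sum is locally finite, and its Fourier transform, where it is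
  infinite.\<close>

definition periodize :: "real \<Rightarrow> (real \<Rightarrow> complex) \<Rightarrow> real \<Rightarrow> complex" where
  "periodize L f x = (\<Sum>\<^sub>\<infinity>k::int. f (x + of_int k * L))"

lemma periodize_eq_sum:
  assumes "L > 0" "\<And>x. \<bar>x\<bar> > R \<Longrightarrow> f x = 0" "R + \<bar>x\<bar> < real K * L"
  shows "periodize L f x = (\<Sum>k\<in>{- int K..int K}. f (x + of_int k * L))"
proof -
  have "f (x + of_int k * L) = 0" if "k \<notin> {- int K..int K}" for k
  proof (rule assms(2))
    have "real K \<le> \<bar>of_int k\<bar>" using that by auto
    then have "real K * L \<le> \<bar>of_int k * L\<bar>" using assms(1) by (simp add: abs_mult)
    then show "\<bar>x + of_int k * L\<bar> > R" using assms(3) by linarith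
  qed
  then have "periodize L f x = (\<Sum>\<^sub>\<infinity>k\<in>{- int K..int K}. f (x + of_int k * L))"
    unfolding periodize_def by (intro infsum_cong_neutral) auto
  then show ?thesis by simp
qed

lemma periodize_periodic: "periodize L f (x + L) = periodize L f x"
proof -
  have "(\<Sum>\<^sub>\<infinity>k::int. f (x + of_int (k + 1) * L)) = (\<Sum>\<^sub>\<infinity>k::int. f (x + of_int k * L))"
    by (rule infsum_reindex_bij_betw[where g="\<lambda>k. k + 1"])
       (rule bij_betw_byWitness[where f'="\<lambda>k. k - 1"], auto)
  then show ?thesis by (simp add: periodize_def algebra_simps)
qed

lemma continuous_on_periodize:
  assumes L: "L > 0" and f: "Cc f"
  shows "continuous_on A (periodize L f)"
proof (rule continuous_at_imp_continuous_on, rule ballI)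
  fix x
  obtain R where R: "\<And>x. \<bar>x\<bar> > R \<Longrightarrow> f x = 0" using Cc_obtain_radius[OF f] by blast
  obtain K :: nat where "(R + \<bar>x\<bar> + 1) / L < real K" using reals_Archimedean2 by blast
  then have K: "R + \<bar>x\<bar> + 1 < real K * L" using L by (simp add: field_simps)
  have fc: "isCont f y" for y
    using Cc_continuous[OF f, of UNIV] continuous_on_eq_continuous_at by blast
  have "isCont (\<lambda>y. \<Sum>k\<in>{- int K..int K}. f (y + of_int k * L)) x"
    by (intro continuous_intros isCont_o2[OF _ fc])
  moreover have "eventually (\<lambda>y. y \<in> ball x 1) (nhds x)"
    by (intro eventually_nhds_in_open) auto
  then have "eventually (\<lambda>y. periodize L f y = (\<Sum>k\<in>{- int K..int K}. f (y + of_int k * L))) (nhds x)"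
  proof eventually_elim
    case (elim y)
    then have "\<bar>y\<bar> < \<bar>x\<bar> + 1" by (auto simp: dist_real_def)
    then show ?case using K by (intro periodize_eq_sum[OF L R]) auto
  qed
  ultimately show "isCont (periodize L f) x" by (simp add: isCont_cong)
qed

lemma sum_integral_shifts:
  fixes \<phi> :: "real \<Rightarrow> complex"
  assumes "L > 0" "continuous_on UNIV \<phi>"
  shows "(\<Sum>k\<in>{a..<a + int M}. integral {0..L} (\<lambda>x. \<phi> (x + of_int k * L)))
     = integral {of_int a * L..of_int (a + int M) * L} \<phi>"
proof (induction M)
  case (Suc M)
  let ?b = "a + int M"
  have int: "\<phi> integrable_on {u..v}" for u v
    using assms(2) by (intro integrable_continuous_interval) (auto intro: continuous_on_subset)
  have "{a..<a + int (Suc M)} = insert ?b {a..<?b}" by auto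
  then have "(\<Sum>k\<in>{a..<a + int (Suc M)}. integral {0..L} (\<lambda>x. \<phi> (x + of_int k * L)))
     = integral {0..L} (\<lambda>x. \<phi> (x + of_int ?b * L)) + integral {of_int a * L..of_int ?b * L} \<phi>"
    using Suc by simp
  also have "integral {0..L} (\<lambda>x. \<phi> (x + of_int ?b * L)) = integral {of_int ?b * L..L + of_int ?b * L} \<phi>"
    using has_integral_shift_Icc_real[of \<phi> "of_int ?b * L" _ 0 L] int[THEN integrable_integral]
    by (intro integral_unique) (simp add: o_def add_ac)
  also have "integral {of_int ?b * L..L + of_int ?b * L} \<phi> + integral {of_int a * L..of_int ?b * L} \<phi>
      = integral {of_int a * L..L + of_int ?b * L} \<phi>"
    using assms(1) int
    by (subst add.commute, intro Henstock_Kurzweil_Integration.integral_combine) (auto simp: mult_right_mono)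
  finally show ?case by (simp add: algebra_simps)
qed simp

text \<open>Unfolding: the translates of one period tile the line and the character has period
  \<open>L\<close>, so the coefficient of the periodization is an integral over the whole
  line.\<close>

lemma integral_periodize:
  assumes L: "L > 0" and f: "Cc f"
  shows "integral {0..L} (\<lambda>x. periodize L f x * uchar (of_int m / L * x)) = fourier f (of_int (- m) / L)"
proof -
  obtain R where R: "R > 0" "\<And>x. \<bar>x\<bar> > R \<Longrightarrow> f x = 0" using Cc_obtain_radius[OF f] by blast
  \<comment> \<open>Large enough for all \<open>x\<close> in \<open>{0..L}\<close> simultaneously,
    so a single finite sum represents the periodization on the whole period.\<close>
  obtain K :: nat where "(R + L) / L < real K" using reals_Archimedean2 by blast
  then have K: "R + L < real K * L" using L by (simp add: field_simps)
  let ?\<phi> = "\<lambda>x. f x * uchar (of_int m / L * x)"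
  have c: "continuous_on A ?\<phi>" for A
    by (intro continuous_on_mult continuous_on_uchar continuous_on_const continuous_on_id Cc_continuous[OF f])
  have eq: "periodize L f x * uchar (of_int m / L * x) = (\<Sum>k\<in>{- int K..int K}. ?\<phi> (x + of_int k * L))"
    if "x \<in> {0..L}" for x
  proof -
    have "uchar (of_int m / L * (x + of_int k * L)) = uchar (of_int m / L * x)" for k :: int
      using L uchar_add[of "of_int m / L * x" "of_int (m * k)"] uchar_of_int[of "m * k"]
      by (simp add: distrib_left)
    then show ?thesis
      using periodize_eq_sum[OF L R(2), where x=x and K=K] that K by (simp add: sum_distrib_right)
  qed
  have "integral {0..L} (\<lambda>x. periodize L f x * uchar (of_int m / L * x))
      = integral {0..L} (\<lambda>x. \<Sum>k\<in>{- int K..int K}. ?\<phi> (x + of_int k * L))"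
    by (intro Henstock_Kurzweil_Integration.integral_cong eq)
  also have "\<dots> = (\<Sum>k\<in>{- int K..int K}. integral {0..L} (\<lambda>x. ?\<phi> (x + of_int k * L)))"
    by (intro Henstock_Kurzweil_Integration.integral_sum integrable_continuous_interval
          continuous_on_compose2[OF c[of UNIV]]) (auto intro!: continuous_intros)
  also have "{- int K..int K} = {- int K..<- int K + int (2 * K + 1)}" by auto
  also have "(\<Sum>k\<in>\<dots>. integral {0..L} (\<lambda>x. ?\<phi> (x + of_int k * L)))
      = integral {of_int (- int K) * L..of_int (- int K + int (2 * K + 1)) * L} ?\<phi>"
    by (rule sum_integral_shifts[OF L c])
  also have "\<dots> = fourier f (of_int (- m) / L)"
  proof (subst fourier_eq_Icc)
    show "f x = 0" if "x \<notin> {of_int (- int K) * L..of_int (- int K + int (2 * K + 1)) * L}" for x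
      using that K L by (intro R(2)) (auto simp: algebra_simps)
  qed (use Cc_continuous[OF f] in \<open>auto simp: mult_ac\<close>)
  finally show ?thesis .
qed

text \<open>Both sides are continuous and \<open>L\<close>-periodic with equal Fourier coefficients.
  Summability on the dual lattice is assumed in place of smoothness of \<open>f\<close>, so that
  convolutions of merely continuous functions are covered.\<close>

lemma poisson_summation:
  assumes L: "L > 0" and f: "Cc f"
    and summable: "(\<lambda>j::int. norm (fourier f (of_int j / L))) summable_on UNIV"
  shows "periodize L f x = (\<Sum>\<^sub>\<infinity>j::int. fourier f (of_int j / L) * uchar (of_int j / L * x)) / of_real L"
proof -
  let ?S = "\<lambda>x. \<Sum>\<^sub>\<infinity>j::int. fourier f (of_int j / L) * uchar (of_int j / L * x)"
  let ?F = "\<lambda>x. periodize L f x - ?S x / of_real L"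
  note S = trigonometric_series[OF L summable]
  have c: "continuous_on A (periodize L f)" "continuous_on A ?S" for A
    using continuous_on_periodize[OF L f] S(1) by blast+
  have "?F x = 0"
  proof (rule fourier_coefficients_unique[OF L, where F="?F"])
    show "continuous_on UNIV ?F" using L by (intro continuous_intros c) auto
    show "?F (x + L) = ?F x" for x by (simp only: S(2) periodize_periodic)
    fix j :: int
    have "integral {0..L} (\<lambda>x. ?F x * uchar (of_int j / L * x)) =
      integral {0..L} (\<lambda>x. periodize L f x * uchar (of_int j / L * x) - (1 / of_real L) * (?S x * uchar (of_int j / L * x)))"
      by (simp add: algebra_simps)
    also have "\<dots> = fourier f (of_int (- j) / L) - (1 / of_real L) * (of_real L * fourier f (of_int (- j) / L))"
      using L by (subst Henstock_Kurzweil_Integration.integral_diff)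
        (auto intro!: integrable_continuous_interval continuous_intros c
          simp only: integral_mult_right S(3) integral_periodize[OF L f])
    finally show "integral {0..L} (\<lambda>x. ?F x * uchar (of_int j / L * x)) = 0" using L by simp
  qed
  then show ?thesis by simp
qed

text \<open>The values are the Fourier coefficients of the periodization \<open>P\<close>. Its
  orthogonal projection \<open>S\<close> onto finitely many characters has squared norm
  \<open>(\<Sum> \<bar>c j\<bar>^2) / L\<close>, which cannot exceed that of
  \<open>P\<close>.\<close>

lemma bessel:
  assumes L: "L > 0" and f: "Cc f"
  shows "(\<lambda>j::int. (norm (fourier f (of_int j / L)))\<^sup>2) summable_on UNIV"
proof (rule nonneg_bounded_partial_sums_imp_summable_on)
  let ?P = "periodize L f" and ?c = "\<lambda>j::int. fourier f (of_int j / L)"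
  define M where "M = Re (integral {0..L} (\<lambda>x. ?P x * cnj (?P x)))"
  have bd: "(\<Sum>j\<in>J. (norm (?c j))\<^sup>2) \<le> L * M" if J: "finite J" for J
  proof -
    \<comment> \<open>The division by \<open>L\<close> compensates that each character has squared
      norm \<open>L\<close> over a period; it makes \<open>S\<close> and \<open>P\<close> agree in
      the coefficients indexed by \<open>J\<close>.\<close>
    define S where "S x = (\<Sum>j\<in>J. ?c j * uchar (of_int j / L * x)) / of_real L" for x
    define Q where "Q x = ?P x - S x" for x
    have cP: "continuous_on A ?P" for A by (rule continuous_on_periodize[OF L f])
    have cS: "continuous_on A S" for A
      unfolding S_def using L
      by (intro continuous_on_divide continuous_on_sum continuous_on_mult continuous_on_uchar continuous_on_const continuous_on_id) auto
    have cQ: "continuous_on A Q" for A unfolding Q_def by (intro continuous_intros cP cS)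
    have cnjS: "cnj (S x) = (\<Sum>j\<in>J. (cnj (?c j) / of_real L) * uchar (of_int (- j) / L * x))" for x
      by (simp add: S_def sum_divide_distrib)
    have S0: "integral {0..L} (\<lambda>x. S x * uchar (of_int (- i) / L * x)) = ?c i" if "i \<in> J" for i
    proof -
      have t: "S x * uchar (of_int (- i) / L * x) = (\<Sum>j\<in>J. (?c j / of_real L) * uchar (of_int (j - i) / L * x))" for x
        unfolding S_def sum_divide_distrib sum_distrib_right
      proof (intro sum.cong refl)
        fix j
        have "uchar (of_int (j - i) / L * x) = uchar (of_int j / L * x) * uchar (of_int (- i) / L * x)"
          unfolding uchar_add[symmetric] by (simp add: diff_divide_distrib algebra_simps)
        then show "?c j * uchar (of_int j / L * x) / of_real L * uchar (of_int (- i) / L * x)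
           = ?c j / of_real L * uchar (of_int (j - i) / L * x)" by simp
      qed
      have "integral {0..L} (\<lambda>x. S x * uchar (of_int (- i) / L * x))
          = (\<Sum>j\<in>J. integral {0..L} (\<lambda>x. (?c j / of_real L) * uchar (of_int (j - i) / L * x)))"
        unfolding t using J
        by (intro Henstock_Kurzweil_Integration.integral_sum integrable_continuous_interval
            continuous_on_mult continuous_on_uchar continuous_on_const continuous_on_id) auto
      also have "\<dots> = (\<Sum>j\<in>J. if j = i then ?c j else 0)"
        unfolding integral_mult_right integral_uchar[OF L] using L by (intro sum.cong) auto
      finally show ?thesis using that J by simp
    qed
    have P0: "integral {0..L} (\<lambda>x. ?P x * uchar (of_int (- i) / L * x)) = ?c i" for i
      using integral_periodize[OF L f, of "- i"] by simp
    have Q0: "integral {0..L} (\<lambda>x. Q x * uchar (of_int (- i) / L * x)) = 0" if "i \<in> J" for i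
    proof -
      have "integral {0..L} (\<lambda>x. Q x * uchar (of_int (- i) / L * x)) =
          integral {0..L} (\<lambda>x. ?P x * uchar (of_int (- i) / L * x) - S x * uchar (of_int (- i) / L * x))"
        by (simp add: Q_def algebra_simps)
      also have "\<dots> = ?c i - ?c i"
        using that by (subst Henstock_Kurzweil_Integration.integral_diff)
          (auto intro!: integrable_continuous_interval continuous_on_mult continuous_on_uchar continuous_on_const continuous_on_id cP cS
            simp only: P0 S0)
      finally show ?thesis by simp
    qed
    have orth: "integral {0..L} (\<lambda>x. H x * cnj (S x))
        = (\<Sum>j\<in>J. (cnj (?c j) / of_real L) * integral {0..L} (\<lambda>x. H x * uchar (of_int (- j) / L * x)))"
      if H: "continuous_on {0..L} H" for H
    proof -
      have "integral {0..L} (\<lambda>x. H x * cnj (S x))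
        = integral {0..L} (\<lambda>x. \<Sum>j\<in>J. (cnj (?c j) / of_real L) * (H x * uchar (of_int (- j) / L * x)))"
        unfolding cnjS by (simp add: sum_distrib_left mult_ac)
      also have "\<dots> = (\<Sum>j\<in>J. integral {0..L} (\<lambda>x. (cnj (?c j) / of_real L) * (H x * uchar (of_int (- j) / L * x))))"
        using J by (intro Henstock_Kurzweil_Integration.integral_sum integrable_continuous_interval
            continuous_on_mult continuous_on_uchar continuous_on_const continuous_on_id H) auto
      finally show ?thesis unfolding integral_mult_right .
    qed
    have "integral {0..L} (\<lambda>x. Q x * cnj (S x)) = 0"
      by (subst orth[OF cQ]) (intro sum.neutral ballI, simp only: Q0 mult_zero_right)
    moreover have "integral {0..L} (\<lambda>x. ?P x * cnj (S x)) = of_real ((\<Sum>j\<in>J. (norm (?c j))\<^sup>2) / L)"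
      unfolding orth[OF cP] P0
      by (simp add: sum_divide_distrib complex_norm_square mult.commute del: of_real_power)
    \<comment> \<open>Writing \<open>Q = P - S\<close>, the square is expanded so that, besides the
      integral of \<open>\<bar>P\<bar>^2\<close>, only the known pairings of \<open>Q\<close> and
      \<open>P\<close> with \<open>S\<close> occur.\<close>
    moreover have "integral {0..L} (\<lambda>x. Q x * cnj (Q x)) =
        integral {0..L} (\<lambda>x. ?P x * cnj (?P x)) - integral {0..L} (\<lambda>x. Q x * cnj (S x))
         - cnj (integral {0..L} (\<lambda>x. ?P x * cnj (S x)))"
    proof -
      have "integral {0..L} (\<lambda>x. Q x * cnj (Q x)) =
          integral {0..L} (\<lambda>x. ?P x * cnj (?P x) - Q x * cnj (S x) - cnj (?P x * cnj (S x)))"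
        by (intro Henstock_Kurzweil_Integration.integral_cong) (simp add: Q_def algebra_simps)
      also have "\<dots> = integral {0..L} (\<lambda>x. ?P x * cnj (?P x)) - integral {0..L} (\<lambda>x. Q x * cnj (S x))
         - integral {0..L} (\<lambda>x. cnj (?P x * cnj (S x)))"
        by (subst Henstock_Kurzweil_Integration.integral_diff, (intro integrable_continuous_interval continuous_intros cP cS cQ)+)+
           simp
      finally show ?thesis by (simp add: integral_cnj)
    qed
    moreover have "Re (integral {0..L} (\<lambda>x. Q x * cnj (Q x))) \<ge> 0"
    proof -
      have "(\<lambda>x. Q x * cnj (Q x)) integrable_on {0..L}"
        by (intro integrable_continuous_interval continuous_intros cQ)
      from has_integral_linear[OF integrable_integral[OF this] bounded_linear_Re]
      show ?thesis by (rule has_integral_nonneg) (simp add: o_def complex_norm_square[symmetric] del: of_real_power)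
    qed
    ultimately have "(\<Sum>j\<in>J. (norm (?c j))\<^sup>2) / L \<le> M" by (simp add: M_def)
    then show ?thesis using L by (simp add: field_simps)
  qed
  show "eventually (\<lambda>J. (\<Sum>j\<in>J. (norm (?c j))\<^sup>2) \<le> L * M) (finite_subsets_at_top UNIV)"
    using bd by (intro eventually_finite_subsets_at_top_weakI) auto
qed auto

subsection \<open>The discrete Fourier transform and lattice sums\<close>

text \<open>The sign \<open>s = 1\<close> gives the discrete Fourier matrix itself and
  \<open>s = - 1\<close> its inverse. The latter belongs to \<open>fourier_check\<close>, so one
  sign parameter serves both notions of eigenmeasure.\<close>

definition gdft :: "int \<Rightarrow> nat \<Rightarrow> (nat \<Rightarrow> complex) \<Rightarrow> nat \<Rightarrow> complex" where
  "gdft s n c k = (\<Sum>l<n. uchar (of_int (- s * int k * int l) / real n) * c l) / of_real (sqrt (real n))"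

lemma dft_eq_gdft: "dft n c k = gdft 1 n c k"
proof -
  have "exp (- 2 * of_real pi * \<i> / of_nat n) ^ (k * l) = uchar (of_int (- 1 * int k * int l) / real n)" for l
  proof -
    have "exp (- 2 * of_real pi * \<i> / of_nat n) = uchar (- (1 / real n))"
      by (simp add: uchar_def)
    then show ?thesis by (simp add: uchar_power)
  qed
  then show ?thesis by (simp add: dft_def gdft_def)
qed

lemma sum_uchar:
  assumes "n > 0"
  shows "(\<Sum>k<n. uchar (of_int (d * int k) / real n)) = (if int n dvd d then of_nat n else 0)"
proof -
  define z where "z = uchar (of_int d / real n)"
  have zp: "uchar (of_int (d * int k) / real n) = z ^ k" for k
    unfolding z_def uchar_power by (simp add: mult_ac)
  have zn: "z ^ n = 1"
    unfolding z_def uchar_power using assms by simp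
  have z1: "z = 1 \<longleftrightarrow> int n dvd d"
  proof
    assume "z = 1"
    then obtain k :: int where "of_int d / real n = of_int k"
      unfolding z_def uchar_eq_1_iff by (auto elim: Ints_cases)
    then have "real_of_int d = of_int (k * int n)" using assms by (simp add: field_simps)
    then have "d = k * int n" by linarith
    then show "int n dvd d" by simp
  next
    assume "int n dvd d"
    then show "z = 1" unfolding z_def using assms by (auto elim!: dvdE)
  qed
  show ?thesis
  proof (cases "z = 1")
    case True
    then show ?thesis using z1 unfolding zp by simp
  next
    case False
    then show ?thesis using z1 geometric_sum[of z n] zn unfolding zp by simp
  qed
qed

lemma gdft_inverse:
  assumes "n > 0" "m < n" "s = 1 \<or> s = - 1"
  shows "gdft (- s) n (gdft s n c) m = c m"
proof -
  have "gdft (- s) n (gdft s n c) m =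
      (\<Sum>k<n. uchar (of_int (s * int m * int k) / real n) *
        (\<Sum>l<n. uchar (of_int (- s * int k * int l) / real n) * c l)) / of_nat n"
    using assms(1) unfolding gdft_def
    by (simp add: sum_divide_distrib[symmetric] flip: of_real_mult)
  also have "(\<Sum>k<n. uchar (of_int (s * int m * int k) / real n) *
        (\<Sum>l<n. uchar (of_int (- s * int k * int l) / real n) * c l))
     = (\<Sum>k<n. \<Sum>l<n. uchar (of_int (s * (int m - int l) * int k) / real n) * c l)"
    unfolding sum_distrib_left mult.assoc[symmetric] uchar_add[symmetric]
    by (simp add: algebra_simps diff_divide_distrib)
  also have "\<dots> = (\<Sum>l<n. (\<Sum>k<n. uchar (of_int (s * (int m - int l) * int k) / real n)) * c l)"
    unfolding sum_distrib_right by (rule sum.swap)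
  also have "\<dots> = (\<Sum>l<n. if l = m then of_nat n * c l else 0)"
  proof (intro sum.cong refl)
    fix l assume l: "l \<in> {..<n}"
    have "int n dvd s * (int m - int l) \<longleftrightarrow> int n dvd (int m - int l)"
      using assms(3) by (auto simp: dvd_diff_commute)
    also have "\<dots> \<longleftrightarrow> l = m"
    proof
      assume "int n dvd int m - int l"
      then have "int m mod int n = int l mod int n" by (simp add: mod_eq_dvd_iff)
      then show "l = m" using assms(2) l by simp
    qed simp
    finally show "(\<Sum>k<n. uchar (of_int (s * (int m - int l) * int k) / real n)) * c l
        = (if l = m then of_nat n * c l else 0)"
      unfolding sum_uchar[OF assms(1)] by simp
  qed
  finally show ?thesis using assms by simp
qed

text \<open>The exponent is symmetric in its two indices, so the matrix moves across the bilinear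
  pairing unchanged. This is how a transform of sampled values becomes a transform of the
  weights.\<close>

lemma gdft_symmetric: "(\<Sum>l<n. c l * gdft s n d l) = (\<Sum>m<n. gdft s n c m * d m)"
proof -
  have "(\<Sum>l<n. c l * gdft s n d l)
      = (\<Sum>l<n. \<Sum>m<n. uchar (of_int (- s * int l * int m) / real n) * c l * d m / of_real (sqrt (real n)))"
    unfolding gdft_def by (simp add: sum_distrib_left sum_divide_distrib mult_ac)
  also have "\<dots> = (\<Sum>m<n. \<Sum>l<n. uchar (of_int (- s * int l * int m) / real n) * c l * d m / of_real (sqrt (real n)))"
    by (rule sum.swap)
  also have "\<dots> = (\<Sum>m<n. gdft s n c m * d m)"
    unfolding gdft_def sum_distrib_right sum_divide_distrib by (simp add: mult_ac)
  finally show ?thesis .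
qed

lemma gdft_cong: "(\<And>l. l < n \<Longrightarrow> c l = d l) \<Longrightarrow> gdft s n c k = gdft s n d k"
  unfolding gdft_def by (intro arg_cong2[where f="(/)"] sum.cong) auto

lemma gdft_cmult: "gdft s n (\<lambda>l. a * c l) k = a * gdft s n c k"
  unfolding gdft_def by (simp add: sum_distrib_left mult_ac)

section \<open>Sums over the integers with periodic weights\<close>

lemma infsum_residues:
  fixes g :: "int \<Rightarrow> complex"
  assumes n: "n > 0" and g: "g summable_on UNIV"
  shows "infsum g UNIV = (\<Sum>m<n. \<Sum>\<^sub>\<infinity>k. g (int m + k * int n))"
proof -
  let ?h = "\<lambda>(m, k). int m + k * int n"
  have bij: "bij_betw ?h ({..<n} \<times> UNIV) UNIV"
    by (rule bij_betw_byWitness[where f'="\<lambda>j. (nat (j mod int n), j div int n)"])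
       (use n in \<open>auto simp: nat_less_iff\<close>)
  have "infsum g UNIV = infsum (\<lambda>p. g (?h p)) ({..<n} \<times> UNIV)"
    by (rule infsum_reindex_bij_betw[OF bij, symmetric])
  also have "\<dots> = infsum (\<lambda>(m, k). g (int m + k * int n)) ({..<n} \<times> UNIV)"
    by (intro infsum_cong) auto
  also have "\<dots> = (\<Sum>\<^sub>\<infinity>m\<in>{..<n}. \<Sum>\<^sub>\<infinity>k. g (int m + k * int n))"
  proof (rule infsum_Sigma'_banach[symmetric])
    have "(\<lambda>p. g (?h p)) summable_on ({..<n} \<times> UNIV)"
      using g summable_on_reindex_bij_betw[OF bij, of g] by simp
    then show "(\<lambda>(m, k). g (int m + k * int n)) summable_on {..<n} \<times> UNIV"
      by (rule summable_on_cong[THEN iffD1, rotated]) auto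
  qed
  finally show ?thesis by simp
qed

text \<open>Integration against the measure in condition (3), with the double sum merged into one:
  \<open>m / sqrt n + k sqrt n\<close> is \<open>j / sqrt n\<close> for \<open>j = m + k n\<close>,
  and the weights are extended with period \<open>n\<close>.\<close>

definition lattice_sum :: "nat \<Rightarrow> (nat \<Rightarrow> complex) \<Rightarrow> (real \<Rightarrow> complex) \<Rightarrow> complex" where
  "lattice_sum n c F = (\<Sum>\<^sub>\<infinity>j::int. c (nat (j mod int n)) * F (of_int j / sqrt (real n)))"

lemma lattice_sum_summable:
  fixes F :: "real \<Rightarrow> complex"
  assumes n: "n > 0" and F: "(\<lambda>j::int. norm (F (of_int j / sqrt (real n)))) summable_on UNIV"
  shows "(\<lambda>j::int. norm (c (nat (j mod int n)) * F (of_int j / sqrt (real n)))) summable_on UNIV"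
proof (rule summable_on_comparison_test)
  define B where "B = (\<Sum>l<n. norm (c l))"
  show "(\<lambda>j::int. B * norm (F (of_int j / sqrt (real n)))) summable_on UNIV"
    by (rule summable_on_cmult_right[OF F])
  fix j :: int
  have "nat (j mod int n) < n" using n by (simp add: nat_less_iff)
  then have "norm (c (nat (j mod int n))) \<le> B"
    unfolding B_def by (intro member_le_sum) auto
  then show "norm (c (nat (j mod int n)) * F (of_int j / sqrt (real n))) \<le> B * norm (F (of_int j / sqrt (real n)))"
    unfolding norm_mult by (rule mult_right_mono) simp
qed auto

lemma lattice_sum_eq:
  assumes n: "n > 0" and F: "(\<lambda>j::int. norm (F (of_int j / sqrt (real n)))) summable_on UNIV"
  shows "lattice_sum n c F = (\<Sum>m<n. \<Sum>\<^sub>\<infinity>k::int. c m * F (real m / sqrt (real n) + of_int k * sqrt (real n)))"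
proof -
  have "lattice_sum n c F = (\<Sum>m<n. \<Sum>\<^sub>\<infinity>k. c (nat ((int m + k * int n) mod int n)) * F (of_int (int m + k * int n) / sqrt (real n)))"
    unfolding lattice_sum_def
    by (rule infsum_residues[OF n abs_summable_summable[OF lattice_sum_summable[OF n F]]])
  also have "\<dots> = (\<Sum>m<n. \<Sum>\<^sub>\<infinity>k::int. c m * F (real m / sqrt (real n) + of_int k * sqrt (real n)))"
  proof (intro sum.cong refl infsum_cong)
    fix m k assume "m \<in> {..<n}"
    moreover have "of_int (int m + k * int n) / sqrt (real n) = real m / sqrt (real n) + of_int k * sqrt (real n)"
      using n by (simp add: field_simps flip: real_sqrt_mult)
    ultimately show "c (nat ((int m + k * int n) mod int n)) * F (of_int (int m + k * int n) / sqrt (real n))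
       = c m * F (real m / sqrt (real n) + of_int k * sqrt (real n))"
      by simp
  qed
  finally show ?thesis .
qed

lemma lattice_sum_periodize:
  assumes n: "n > 0" and F: "(\<lambda>j::int. norm (F (of_int j / sqrt (real n)))) summable_on UNIV"
  shows "lattice_sum n c F = (\<Sum>m<n. c m * periodize (sqrt (real n)) F (real m / sqrt (real n)))"
  unfolding lattice_sum_eq[OF assms] periodize_def by (simp add: infsum_cmult_right')

lemma finite_lattice_support:
  assumes "Cc f" "L > 0"
  shows "finite {j::int. f (of_int j / L) \<noteq> 0}"
proof -
  obtain R where R: "\<And>x. \<bar>x\<bar> > R \<Longrightarrow> f x = 0" using Cc_obtain_radius[OF assms(1)] by blast
  have "{j::int. f (of_int j / L) \<noteq> 0} \<subseteq> {- \<lceil>R * L\<rceil>..\<lceil>R * L\<rceil>}"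
  proof
    fix j :: int assume "j \<in> {j. f (of_int j / L) \<noteq> 0}"
    then have "\<bar>of_int j / L\<bar> \<le> R" using R not_le by blast
    then have "\<bar>of_int j\<bar> \<le> R * L" using assms(2) by (simp add: abs_divide field_simps)
    then show "j \<in> {- \<lceil>R * L\<rceil>..\<lceil>R * L\<rceil>}"
      by simp linarith
  qed
  then show ?thesis by (rule finite_subset) simp
qed

lemma Cc_lattice_summable:
  assumes "Cc f" "L > 0"
  shows "(\<lambda>j::int. norm (f (of_int j / L))) summable_on UNIV"
proof (rule summable_on_cong_neutral[THEN iffD1])
  show "(\<lambda>j::int. norm (f (of_int j / L))) summable_on {j::int. f (of_int j / L) \<noteq> 0}"
    by (rule summable_on_finite[OF finite_lattice_support[OF assms]])
qed simp_all

text \<open>Poisson summation is applied at the points \<open>m / sqrt n\<close>. Sorting the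
  frequencies by residue modulo \<open>n\<close> relates the vector \<open>P\<close> of periodized
  values of \<open>f\<close> to the vector \<open>Q\<close> of periodized values of its transform by
  the inverse discrete transform. Inverting and using symmetry puts the matrix on
  \<open>c\<close>.\<close>

lemma lattice_sum_fourier:
  fixes s :: int
  assumes n: "n > 0" and f: "Cc f" and s: "s = 1 \<or> s = - 1"
    and summable: "(\<lambda>j::int. norm (fourier f (of_int j / sqrt (real n)))) summable_on UNIV"
  shows "lattice_sum n c (\<lambda>x. fourier f (of_int s * x)) = lattice_sum n (gdft s n c) f"
proof -
  let ?L = "sqrt (real n)"
  have L: "?L > 0" using n by simp
  let ?g = "\<lambda>x. fourier f (of_int s * x)"
  have bij: "bij_betw (\<lambda>j. s * j) UNIV (UNIV :: int set)"
    by (rule bij_betw_byWitness[where f'="\<lambda>j. s * j"]) (use s in auto)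
  have eqg: "?g (of_int j / ?L) = fourier f (of_int (s * j) / ?L)" for j :: int by simp
  have gsum: "(\<lambda>j::int. norm (?g (of_int j / ?L))) summable_on UNIV"
    unfolding eqg using summable summable_on_reindex_bij_betw[OF bij, of "\<lambda>j. norm (fourier f (of_int j / ?L))"] by simp
  define P where "P m = periodize ?L f (real m / ?L)" for m :: nat
  define Q where "Q m = periodize ?L ?g (real m / ?L)" for m :: nat
  have PQ: "P m = gdft (- s) n Q m" for m
  proof -
    let ?u = "\<lambda>j::int. uchar (of_int (s * int m * j) / real n)"
    have "P m = (\<Sum>\<^sub>\<infinity>j::int. fourier f (of_int j / ?L) * uchar (of_int j / ?L * (real m / ?L))) / of_real ?L"
      unfolding P_def by (rule poisson_summation[OF L f summable])
    \<comment> \<open>Reindexing by \<open>j \<mapsto> s * j\<close> moves the sign from the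
      character into the argument of the transform.\<close>
    also have "(\<Sum>\<^sub>\<infinity>j::int. fourier f (of_int j / ?L) * uchar (of_int j / ?L * (real m / ?L)))
       = (\<Sum>\<^sub>\<infinity>j::int. fourier f (of_int (s * j) / ?L) * uchar (of_int (s * j) / ?L * (real m / ?L)))"
      by (rule infsum_reindex_bij_betw[OF bij, symmetric])
    also have "\<dots> = (\<Sum>\<^sub>\<infinity>j::int. ?g (of_int j / ?L) * ?u j)"
      using n by (intro infsum_cong) (simp add: mult_ac flip: real_sqrt_mult)
    also have "\<dots> = (\<Sum>l<n. \<Sum>\<^sub>\<infinity>k. ?g (of_int (int l + k * int n) / ?L) * ?u (int l + k * int n))"
    proof (rule infsum_residues[OF n])
      have "(\<lambda>j::int. norm (?g (of_int j / ?L) * ?u j)) summable_on UNIV"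
        using gsum by (simp add: norm_mult)
      then show "(\<lambda>j::int. ?g (of_int j / ?L) * ?u j) summable_on UNIV" by (rule abs_summable_summable)
    qed
    also have "\<dots> = (\<Sum>l<n. \<Sum>\<^sub>\<infinity>k. ?g (real l / ?L + of_int k * ?L) * ?u (int l))"
    proof (intro sum.cong refl infsum_cong)
      fix l k
      have "of_int (int l + k * int n) / ?L = real l / ?L + of_int k * ?L"
        using n by (simp add: field_simps flip: real_sqrt_mult)
      \<comment> \<open>Points and frequencies both carry the factor \<open>1 / sqrt n\<close>, so
        the exponent has denominator \<open>n\<close> and the character sees only the residue of the
        index.\<close>
      moreover have "?u (int l + k * int n) = ?u (int l)"
      proof -
        have "of_int (s * int m * (int l + k * int n)) / real n = of_int (s * int m * int l) / real n + of_int (s * int m * k)"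
          using n by (simp add: field_simps)
        then show ?thesis by (simp only: uchar_add uchar_of_int mult_1_right)
      qed
      ultimately show "?g (of_int (int l + k * int n) / ?L) * ?u (int l + k * int n) = ?g (real l / ?L + of_int k * ?L) * ?u (int l)"
        by (simp only:)
    qed
    also have "\<dots> = (\<Sum>l<n. ?u (int l) * Q l)"
      unfolding Q_def periodize_def infsum_cmult_left' by (simp only: mult.commute)
    finally show ?thesis unfolding gdft_def by simp
  qed
  have QP: "Q l = gdft s n P l" if "l < n" for l
  proof -
    have "gdft s n P l = gdft s n (gdft (- s) n Q) l" by (rule gdft_cong) (rule PQ)
    also have "\<dots> = Q l" using gdft_inverse[OF n that, of "- s" Q] s by auto
    finally show ?thesis ..
  qed
  have "lattice_sum n c ?g = (\<Sum>l<n. c l * Q l)"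
    unfolding Q_def by (rule lattice_sum_periodize[OF n gsum])
  also have "\<dots> = (\<Sum>l<n. c l * gdft s n P l)" by (intro sum.cong) (auto simp: QP)
  also have "\<dots> = (\<Sum>m<n. gdft s n c m * P m)" by (rule gdft_symmetric)
  also have "\<dots> = lattice_sum n (gdft s n c) f"
    unfolding P_def by (rule lattice_sum_periodize[OF n Cc_lattice_summable[OF f L], symmetric])
  finally show ?thesis .
qed

subsection \<open>Summability on lattices\<close>

lemma summable_on_int_inverse_square:
  fixes L :: real
  assumes "L > 0"
  shows "(\<lambda>j::int. 1 / (1 + (of_int j / L)\<^sup>2)) summable_on UNIV"
proof -
  let ?f = "\<lambda>j::int. 1 / (1 + (of_int j / L)\<^sup>2)"
  have nat: "(\<lambda>m::nat. 1 / (1 + (real m / L)\<^sup>2)) summable_on UNIV"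
  proof (rule summable_on_comparison_test)
    \<comment> \<open>The majorant comes from \<open>(m + 1)^2 \<le> 2 (1 + m^2)\<close> and
      \<open>1 + m^2 \<le> (1 + L^2) (1 + (m/L)^2)\<close>.\<close>
    show "(\<lambda>m::nat. (1 + L\<^sup>2) * (1 / (real (Suc m))\<^sup>2) * 2) summable_on UNIV"
    proof (intro summable_on_cmult_left summable_on_cmult_right)
      have "summable (\<lambda>m. 1 / (real (Suc m))\<^sup>2)"
        using inverse_power_summable[of 2, where 'a=real] by (subst summable_Suc_iff) (simp add: field_simps)
      then show "(\<lambda>m. 1 / (real (Suc m))\<^sup>2) summable_on UNIV"
        by (subst summable_on_UNIV_nonneg_real_iff) auto
    qed
    fix m :: nat
    have "(real (Suc m))\<^sup>2 \<le> 2 * (1 + (real m)\<^sup>2)"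
      using sum_squares_ge_zero[of "real m - 1" 0] by (simp add: power2_eq_square algebra_simps)
    also have "1 + (real m)\<^sup>2 \<le> (1 + L\<^sup>2) * (1 + (real m / L)\<^sup>2)"
      using assms by (simp add: field_simps)
    finally have "(real (Suc m))\<^sup>2 \<le> 2 * ((1 + L\<^sup>2) * (1 + (real m / L)\<^sup>2))" by simp
    moreover have "0 < 1 + (real m / L)\<^sup>2" "0 < (real (Suc m))\<^sup>2" by (auto intro: add_pos_nonneg)
    moreover have "1 / b \<le> c * (1 / a) * 2" if "a \<le> 2 * (c * b)" "0 < b" "0 < a" for a b c :: real
      using that by (simp add: field_simps)
    ultimately show "1 / (1 + (real m / L)\<^sup>2) \<le> (1 + L\<^sup>2) * (1 / (real (Suc m))\<^sup>2) * 2"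
      by blast
  qed auto
  have "?f summable_on (range int \<union> range (\<lambda>m. - int (Suc m)))"
  proof (rule summable_on_Un_disjoint)
    show "?f summable_on range int"
      using nat by (subst summable_on_reindex) (auto simp: o_def)
    have "(\<lambda>m::nat. 1 / (1 + (real m / L)\<^sup>2)) summable_on range Suc"
      by (rule summable_on_subset_banach[OF nat]) auto
    then have "((\<lambda>m::nat. 1 / (1 + (real m / L)\<^sup>2)) \<circ> Suc) summable_on UNIV"
      by (subst (asm) summable_on_reindex) auto
    moreover have "?f \<circ> (\<lambda>m. - int (Suc m)) = (\<lambda>m::nat. 1 / (1 + (real m / L)\<^sup>2)) \<circ> Suc"
      by (simp only: fun_eq_iff o_apply of_int_minus of_int_of_nat_eq minus_divide_left[symmetric] power2_minus) simp
    moreover have "inj (\<lambda>m. - int (Suc m))" by (simp add: inj_def)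
    ultimately show "?f summable_on range (\<lambda>m. - int (Suc m))"
      by (simp only: summable_on_reindex)
    have "int a \<noteq> - int (Suc b)" for a b by simp
    then show "range int \<inter> range (\<lambda>m. - int (Suc m)) = {}" by blast
  qed
  moreover have "range int \<union> range (\<lambda>m. - int (Suc m)) = UNIV"
  proof -
    have "j \<in> range int \<union> range (\<lambda>m. - int (Suc m))" for j :: int
    proof (cases "j \<ge> 0")
      case True
      then have "j = int (nat j)" by simp
      then show ?thesis by blast
    next
      case False
      then have "j = - int (Suc (nat (- j - 1)))" by simp
      then show ?thesis by blast
    qed
    then show ?thesis by blast
  qed
  ultimately show ?thesis by simp
qed

text \<open>The seminorms stay explicit because the same bound later shows that lattice sums are
  continuous on Schwartz functions.\<close>

lemma schwartz_lattice_bound: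
  assumes "schwartz f"
  shows "norm (f x) \<le> (sseminorm 0 0 f + sseminorm 0 2 f) * (1 / (1 + x\<^sup>2))"
proof -
  have "norm (f x) + x\<^sup>2 * norm (f x) \<le> sseminorm 0 0 f + sseminorm 0 2 f"
    using sseminorm_upper[OF assms, of x 0 0] sseminorm_upper[OF assms, of x 2 0] by simp
  then have "norm (f x) * (1 + x\<^sup>2) \<le> sseminorm 0 0 f + sseminorm 0 2 f"
    by (simp add: algebra_simps)
  then show ?thesis by (simp add: pos_le_divide_eq add_pos_nonneg)
qed

lemma schwartz_lattice_summable:
  assumes "schwartz f" "L > 0"
  shows "(\<lambda>j::int. norm (f (of_int j / L))) summable_on UNIV"
  by (rule summable_on_comparison_test[OF summable_on_cmult_right[OF summable_on_int_inverse_square[OF assms(2)]]])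
     (use schwartz_lattice_bound[OF assms(1)] in auto)

text \<open>For continuous functions without smoothness, each factor of the transform is controlled
  only in the square-summable sense; the product of two such factors is absolutely summable because
  \<open>a * b \<le> a^2 + b^2\<close>.\<close>

lemma conv_lattice_summable:
  assumes "Cc g" "Cc h" "L > 0"
  shows "(\<lambda>j::int. norm (fourier (conv g h) (of_int j / L))) summable_on UNIV"
proof (rule summable_on_comparison_test)
  show "(\<lambda>j::int. (norm (fourier g (of_int j / L)))\<^sup>2 + (norm (fourier h (of_int j / L)))\<^sup>2) summable_on UNIV"
    by (intro summable_on_add bessel assms)
  fix j :: int
  show "norm (fourier (conv g h) (of_int j / L)) \<le> (norm (fourier g (of_int j / L)))\<^sup>2 + (norm (fourier h (of_int j / L)))\<^sup>2"
    unfolding fourier_conv[OF assms(1,2)] norm_mult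
    by (rule order_trans[OF _ sum_squares_bound]) simp
qed auto

lemma Cc_sum:
  assumes "\<And>i. i < (N::nat) \<Longrightarrow> Cc (F i)"
  shows "Cc (\<lambda>x. \<Sum>i<N. F i x)"
  using assms
proof (induction N)
  case 0
  then show ?case by (simp add: Cc_def)
next
  case (Suc N)
  then have "Cc (\<lambda>x. \<Sum>i<N. F i x)" "Cc (F N)" by auto
  then have c: "continuous_on UNIV (\<lambda>x. (\<Sum>i<N. F i x) + F N x)"
    and b: "bounded ({x. (\<Sum>i<N. F i x) \<noteq> 0} \<union> {x. F N x \<noteq> 0})"
    by (auto simp: Cc_def intro: continuous_on_add)
  have "bounded {x. (\<Sum>i<N. F i x) + F N x \<noteq> 0}"
    by (rule bounded_subset[OF b]) auto
  with c show ?case by (simp add: Cc_def)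
qed

lemma Cc_conv_span_imp_Cc:
  assumes "Cc_conv_span f"
  shows "Cc f"
proof -
  obtain N :: nat and a g h where gh: "\<And>i. i < N \<Longrightarrow> Cc (g i) \<and> Cc (h i)"
    and f: "f = (\<lambda>x. \<Sum>i<N. a i * conv (g i) (h i) x)"
    using assms unfolding Cc_conv_span_def by blast
  show ?thesis unfolding f
    using gh by (intro Cc_sum Cc_mult Cc_conv continuous_on_const) auto
qed

lemma Cc_conv_span_modulation:
  assumes "Cc_conv_span f"
  shows "Cc_conv_span (\<lambda>x. uchar (t * x) * f x)"
proof -
  obtain N :: nat and a g h where gh: "\<And>i. i < N \<Longrightarrow> Cc (g i) \<and> Cc (h i)"
    and f: "f = (\<lambda>x. \<Sum>i<N. a i * conv (g i) (h i) x)"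
    using assms unfolding Cc_conv_span_def by blast
  have "(\<lambda>x. uchar (t * x) * f x) =
      (\<lambda>x. \<Sum>i<N. a i * conv (\<lambda>x. uchar (t * x) * g i x) (\<lambda>x. uchar (t * x) * h i x) x)"
    unfolding f by (simp add: sum_distrib_left conv_modulation[symmetric] mult.left_commute)
  moreover have "\<forall>i<N. Cc (\<lambda>x. uchar (t * x) * g i x) \<and> Cc (\<lambda>x. uchar (t * x) * h i x)"
    using gh by (auto intro!: Cc_mult continuous_intros)
  ultimately have "(\<forall>i<N. Cc (g' i) \<and> Cc (h' i)) \<and>
      (\<lambda>x. uchar (t * x) * f x) = (\<lambda>x. \<Sum>i<N. a i * conv (g' i) (h' i) x)"
    if "g' = (\<lambda>i x. uchar (t * x) * g i x)" "h' = (\<lambda>i x. uchar (t * x) * h i x)" for g' h'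
    unfolding that by (rule conjI[rotated])
  then show ?thesis unfolding Cc_conv_span_def by blast
qed

lemma Cc_conv_span_lattice_summable:
  assumes "Cc_conv_span f" "L > 0"
  shows "(\<lambda>j::int. norm (fourier f (of_int j / L))) summable_on UNIV"
proof -
  obtain N :: nat and a g h where gh: "\<And>i. i < N \<Longrightarrow> Cc (g i) \<and> Cc (h i)"
    and f: "f = (\<lambda>x. \<Sum>i<N. a i * conv (g i) (h i) x)"
    using assms unfolding Cc_conv_span_def by blast
  have "fourier f y = (\<Sum>i<N. a i * fourier (conv (g i) (h i)) y)" for y
  proof -
    have "fourier f y = (\<integral>x. (\<Sum>i<N. a i * (uchar (- (x * y)) * conv (g i) (h i) x)) \<partial>lborel)"
      unfolding fourier_eq f by (simp add: sum_distrib_left mult.left_commute)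
    also have "\<dots> = (\<Sum>i<N. \<integral>x. a i * (uchar (- (x * y)) * conv (g i) (h i) x) \<partial>lborel)"
      using gh by (intro Bochner_Integration.integral_sum integrable_mult_right Cc_integrable Cc_mult Cc_conv)
        (auto intro!: continuous_intros)
    finally show ?thesis by (simp add: fourier_eq)
  qed
  then have le: "norm (fourier f y) \<le> (\<Sum>i<N. norm (a i) * norm (fourier (conv (g i) (h i)) y))" for y
    using sum_norm_le[of "{..<N}" "\<lambda>i. a i * fourier (conv (g i) (h i)) y" "\<lambda>i. norm (a i) * norm (fourier (conv (g i) (h i)) y)"]
    by (simp add: norm_mult)
  have t: "(\<lambda>j::int. norm (a i) * norm (fourier (conv (g i) (h i)) (of_int j / L))) summable_on UNIV" if "i < N" for i
    using gh[OF that] by (intro summable_on_cmult_right conv_lattice_summable assms(2)) auto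
  have "(\<lambda>j::int. \<Sum>i<M. norm (a i) * norm (fourier (conv (g i) (h i)) (of_int j / L))) summable_on UNIV"
    if "M \<le> N" for M
    using that
  proof (induction M)
    case (Suc M)
    then show ?case unfolding sum.lessThan_Suc by (intro summable_on_add t) auto
  qed simp
  from this[OF order_refl]
  have "(\<lambda>j::int. \<Sum>i<N. norm (a i) * norm (fourier (conv (g i) (h i)) (of_int j / L))) summable_on UNIV" .
  then show ?thesis by (rule summable_on_comparison_test) (use le in auto)
qed

subsection \<open>Approximating indicators of intervals\<close>

text \<open>All that a class of test functions must supply in order to detect a density: bounded
  approximations of interval indicators with shrinking supports, ready for dominated
  convergence.\<close>

definition approximates_intervals :: "((real \<Rightarrow> complex) \<Rightarrow> bool) \<Rightarrow> bool" where
  "approximates_intervals X \<longleftrightarrow> (\<forall>a b e. a \<le> b \<longrightarrow> e > 0 \<longrightarrow>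
     (\<exists>f. X f \<and> (\<forall>x. norm (f x) \<le> 1) \<and> (\<forall>x\<in>{a..b}. f x = 1) \<and> (\<forall>x. x \<le> a - e \<or> x \<ge> b + e \<longrightarrow> f x = 0)))"

lemma approximates_intervals_Cc_inf: "approximates_intervals Cc_inf"
  unfolding approximates_intervals_def
proof (intro allI impI)
  fix a b e :: real assume "a \<le> b" "e > 0"
  then show "\<exists>f. Cc_inf f \<and> (\<forall>x. norm (f x) \<le> 1) \<and> (\<forall>x\<in>{a..b}. f x = 1) \<and> (\<forall>x. x \<le> a - e \<or> x \<ge> b + e \<longrightarrow> f x = 0)"
    by (intro exI[of _ "plateau a b e"]) (auto simp: Cc_inf_plateau norm_plateau_le plateau_eq_1 plateau_eq_0)
qed

lemma exists_bump:
  assumes r: "r > 0"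
  obtains h where "Cc (\<lambda>x. of_real (h x))" "\<And>x. h x \<ge> 0" "\<And>x. \<bar>x\<bar> > r \<Longrightarrow> h x = 0" "(\<integral>x. h x \<partial>lborel) = 1"
proof -
  define k :: "real \<Rightarrow> real" where "k x = max 0 (r - \<bar>x\<bar>)" for x
  have cc: "Cc (\<lambda>x. of_real (k x))"
    by (rule CcI[of _ r]) (auto simp: k_def intro!: continuous_intros)
  have "integrable lborel (\<lambda>x. Re (of_real (k x)))"
    by (rule integrable_Re[OF Cc_integrable[OF cc]])
  then have int: "integrable lborel k" by simp
  let ?I = "indicator {-(r/2)..r/2} :: real \<Rightarrow> real"
  have "(\<integral>x. (r / 2) * ?I x \<partial>lborel) = (r / 2) * measure lborel {-(r/2)..r/2}"
    by simp
  then have "0 < (\<integral>x. (r / 2) * ?I x \<partial>lborel)" using r by simp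
  also have "\<dots> \<le> (\<integral>x. k x \<partial>lborel)"
  proof (rule integral_mono[OF _ int])
    show "integrable lborel (\<lambda>x. (r / 2) * ?I x)" by (intro integrable_mult_right integrable_real_indicator) (simp_all add: emeasure_lborel_Icc_eq)
    show "(r / 2) * ?I x \<le> k x" for x by (auto simp: k_def indicator_def)
  qed
  finally have pos: "(\<integral>x. k x \<partial>lborel) > 0" .
  have "Cc (\<lambda>x. of_real (1 / (\<integral>x. k x \<partial>lborel)) * of_real (k x))"
    by (intro Cc_mult cc continuous_on_const)
  then show ?thesis
    using pos by (intro that[of "\<lambda>x. k x / (\<integral>x. k x \<partial>lborel)"]) (auto simp: k_def)
qed

lemma approximates_intervals_Cc_conv_span: "approximates_intervals Cc_conv_span"
  unfolding approximates_intervals_def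
proof (intro allI impI)
  fix a b e :: real assume ab: "a \<le> b" and e: "e > 0"
  \<comment> \<open>The plateau is widened by \<open>r\<close> so that averaging over radius
    \<open>r\<close> keeps the value 1 on \<open>[a, b]\<close>; with a ramp of width
    \<open>r\<close> and the spread \<open>r\<close> of the bump, the support grows by
    \<open>3 r = e\<close> on each side.\<close>
  define r where "r = e / 3"
  have r: "r > 0" using e by (simp add: r_def)
  obtain h where h: "Cc (\<lambda>x. of_real (h x))" "\<And>x. h x \<ge> 0" "\<And>x. \<bar>x\<bar> > r \<Longrightarrow> h x = 0" "(\<integral>x. h x \<partial>lborel) = 1"
    using exists_bump[OF r] by blast
  define g where "g = plateau (a - r) (b + r) r"
  define f where "f = conv g (\<lambda>x. of_real (h x))"
  have g: "Cc g" unfolding g_def using ab r by (intro Cc_inf_imp_Cc Cc_inf_plateau) auto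
  have "integrable lborel (\<lambda>x. Re (of_real (h x)))"
    by (rule integrable_Re[OF Cc_integrable[OF h(1)]])
  then have hi: "integrable lborel h" by simp
  have "Cc_conv_span f"
    unfolding Cc_conv_span_def f_def
    by (rule exI[of _ 1], rule exI[of _ "\<lambda>_. 1"], rule exI[of _ "\<lambda>_. g"], rule exI[of _ "\<lambda>_ x. of_real (h x)"])
       (simp add: g h)
  moreover have "norm (f x) \<le> 1" for x
  proof -
    have "norm (f x) \<le> (\<integral>y. norm (g (x - y) * of_real (h y)) \<partial>lborel)"
      unfolding f_def conv_def by (rule integral_norm_bound)
    also have "\<dots> \<le> (\<integral>y. h y \<partial>lborel)"
    proof (rule integral_mono')
      show "norm (g (x - y) * of_real (h y)) \<le> h y" for y
        unfolding g_def norm_mult using norm_plateau_le h(2) by (simp add: mult_left_le_one_le)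
    qed (use hi h(2) in auto)
    finally show ?thesis using h(4) by simp
  qed
  moreover have "f x = 1" if "x \<in> {a..b}" for x
  proof -
    have "g (x - y) * of_real (h y) = of_real (h y)" for y
      using that h(3)[of y] r by (cases "\<bar>y\<bar> > r") (auto simp: g_def intro!: plateau_eq_1)
    then have "f x = (\<integral>y. complex_of_real (h y) \<partial>lborel)"
      unfolding f_def conv_def by (simp only:)
    then show ?thesis using h(4) by simp
  qed
  moreover have "f x = 0" if "x \<le> a - e \<or> x \<ge> b + e" for x
  proof -
    have "g (x - y) * of_real (h y) = 0" for y
    proof (cases "\<bar>y\<bar> > r")
      case False
      have "g (x - y) = 0" unfolding g_def
        by (rule plateau_eq_0) (use that r ab False in \<open>auto simp: r_def\<close>)
      then show ?thesis by simp
    qed (simp add: h)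
    then show ?thesis unfolding f_def conv_def by (simp only: Bochner_Integration.integral_zero)
  qed
  ultimately show "\<exists>f. Cc_conv_span f \<and> (\<forall>x. norm (f x) \<le> 1) \<and> (\<forall>x\<in>{a..b}. f x = 1) \<and> (\<forall>x. x \<le> a - e \<or> x \<ge> b + e \<longrightarrow> f x = 0)"
    by blast
qed

subsection \<open>Measures supported on a lattice\<close>

lemma radon_measurable:
  assumes "radon \<mu>" "f \<in> borel_measurable borel"
  shows "f \<in> borel_measurable (fst \<mu>)"
  using assms unfolding radon_def by (simp cong: measurable_cong_sets)

lemma radon_integrable_Cc:
  assumes \<mu>: "radon \<mu>" and f: "Cc f"
  shows "integrable (fst \<mu>) (\<lambda>x. f x * snd \<mu> x)"
proof -
  obtain R where R: "\<And>x. \<bar>x\<bar> > R \<Longrightarrow> f x = 0" using Cc_obtain_radius[OF f] by blast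
  obtain B where B: "\<And>x. norm (f x) \<le> B" using Cc_bounded[OF f] by blast
  have "set_integrable (fst \<mu>) {-R..R} (snd \<mu>)" using \<mu> by (auto simp: radon_def)
  then have int: "integrable (fst \<mu>) (\<lambda>x. B * norm (indicator {-R..R} x *\<^sub>R snd \<mu> x))"
    unfolding set_integrable_def by (intro integrable_mult_right integrable_norm)
  have "f \<in> borel_measurable borel"
    using Cc_continuous[OF f] by (rule borel_measurable_continuous_onI)
  then have m: "f \<in> borel_measurable (fst \<mu>)" by (rule radon_measurable[OF \<mu>])
  show ?thesis
  proof (rule Bochner_Integration.integrable_bound[OF int])
    show "(\<lambda>x. f x * snd \<mu> x) \<in> borel_measurable (fst \<mu>)"
      using m \<mu> unfolding radon_def by (intro borel_measurable_times) auto
    show "AE x in fst \<mu>. norm (f x * snd \<mu> x) \<le> norm (B * norm (indicator {-R..R} x *\<^sub>R snd \<mu> x))"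
    proof (rule AE_I2)
      fix x
      show "norm (f x * snd \<mu> x) \<le> norm (B * norm (indicator {-R..R} x *\<^sub>R snd \<mu> x))"
      proof (cases "\<bar>x\<bar> > R")
        case True
        then show ?thesis using R by simp
      next
        case False
        have "norm (f x) \<le> \<bar>B\<bar>" using B[of x] by linarith
        moreover have "x \<in> {-R..R}" using False by auto
        ultimately show ?thesis by (simp add: norm_mult abs_mult mult_right_mono)
      qed
    qed
  qed
qed

lemma mint_diff:
  assumes "radon \<mu>" "Cc f" "Cc g"
  shows "mint \<mu> (\<lambda>x. f x - g x) = mint \<mu> f - mint \<mu> g"
  unfolding mint_def left_diff_distrib
  using assms by (intro Bochner_Integration.integral_diff radon_integrable_Cc)

section \<open>From vanishing integrals to vanishing densities\<close>

lemma radon_sigma_finite: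
  assumes "radon \<mu>"
  shows "sigma_finite_measure (fst \<mu>)"
proof
  have sp: "space (fst \<mu>) = UNIV" using assms sets_eq_imp_space_eq[of "fst \<mu>" borel] by (simp add: radon_def)
  show "\<exists>A. countable A \<and> A \<subseteq> sets (fst \<mu>) \<and> \<Union> A = space (fst \<mu>) \<and> (\<forall>a\<in>A. emeasure (fst \<mu>) a \<noteq> \<infinity>)"
  proof (intro exI[of _ "range (\<lambda>n::nat. {- real n..real n})"] conjI)
    show "\<Union> (range (\<lambda>n::nat. {- real n..real n})) = space (fst \<mu>)"
    proof -
      have "x \<in> \<Union> (range (\<lambda>n::nat. {- real n..real n}))" for x :: real
      proof -
        obtain n :: nat where "\<bar>x\<bar> < real n" using reals_Archimedean2 by blast
        then show ?thesis by (intro UN_I[of n]) auto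
      qed
      then show ?thesis using sp by blast
    qed
    show "range (\<lambda>n::nat. {- real n..real n}) \<subseteq> sets (fst \<mu>)"
      using assms by (auto simp: radon_def)
    show "\<forall>a\<in>range (\<lambda>n::nat. {- real n..real n}). emeasure (fst \<mu>) a \<noteq> \<infinity>"
      using assms unfolding radon_def by (auto simp: less_top[symmetric])
  qed simp
qed

text \<open>Dynkin's argument: closed intervals form an intersection-stable generator of the Borel
  sets, and the vanishing total integral handles complements. A function with zero integral over
  every measurable set is 0 almost everywhere.\<close>

lemma AE_zero_if_interval_integrals_zero:
  fixes u :: "real \<Rightarrow> complex"
  assumes "sigma_finite_measure M" and sets: "sets M = sets borel" and u: "integrable M u"
    and zero: "\<And>a b. (\<integral>x. indicator {a..b} x *\<^sub>R u x \<partial>M) = 0" "(\<integral>x. u x \<partial>M) = 0"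
  shows "AE x in M. u x = 0"
proof -
  interpret sigma_finite_measure M by fact
  have sp: "space M = UNIV" using sets_eq_imp_space_eq[OF sets] by simp
  let ?G = "range (\<lambda>(a, b). {a..b::real})"
  have gen: "sets borel = sigma_sets UNIV ?G"
    using borel_eq_atLeastAtMost by (metis sets_measure_of top_greatest Pow_UNIV)
  have set_int: "set_integrable M A u" if "A \<in> sets M" for A
    using that u unfolding set_integrable_def by (rule integrable_mult_indicator)
  show ?thesis
  proof (rule density_zero[OF u])
    fix A assume "A \<in> sets M"
    then have A: "A \<in> sigma_sets UNIV ?G" using sets gen by simp
    have stable: "Int_stable ?G"
      unfolding Int_stable_def by auto
    have "?G \<subseteq> Pow UNIV" by simp
    from stable this A show "(LINT x:A|M. u x) = 0"
    proof (induction rule: sigma_sets_induct_disjoint)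
      case (basic A)
      then show ?case using zero(1) by (auto simp: set_lebesgue_integral_def)
    next
      case empty
      then show ?case by (simp add: set_lebesgue_integral_def)
    next
      case (compl A)
      then have As: "A \<in> sets M" using sets gen by simp
      have "(LINT x:UNIV - A|M. u x) = (\<integral>x. u x - indicator A x *\<^sub>R u x \<partial>M)"
        unfolding set_lebesgue_integral_def by (intro Bochner_Integration.integral_cong) (auto simp: indicator_def)
      also have "\<dots> = (\<integral>x. u x \<partial>M) - (LINT x:A|M. u x)"
        unfolding set_lebesgue_integral_def
        using u set_int[OF As] by (intro Bochner_Integration.integral_diff) (auto simp: set_integrable_def)
      finally show ?case using compl zero(2) by simp
    next
      case (union A)
      then have As: "A i \<in> sets M" for i using sets gen by auto
      have "(LINT x:(\<Union>i. A i)|M. u x) = (\<Sum>i. LINT x:A i|M. u x)"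
        using union(1) As by (intro lebesgue_integral_countable_add set_int) (auto simp: disjoint_family_on_def)
      then show ?case using union by simp
    qed
  qed
qed

text \<open>Test functions shrinking to an interval give vanishing integrals of
  \<open>g * snd \<mu>\<close> over all intervals by dominated convergence; boundedness of
  \<open>g\<close> and local integrability of the density provide the majorant.\<close>

lemma AE_zero_if_annihilates:
  assumes \<mu>: "radon \<mu>" and X: "approximates_intervals X" "\<And>f. X f \<Longrightarrow> Cc f"
    and g: "continuous_on UNIV g" "\<And>x. norm (g x) \<le> C"
    and zero: "\<And>f. X f \<Longrightarrow> mint \<mu> (\<lambda>x. g x * f x) = 0"
  shows "AE x in fst \<mu>. g x * snd \<mu> x = 0"
proof -
  let ?M = "fst \<mu>" and ?h = "snd \<mu>"
  have gm: "g \<in> borel_measurable ?M"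
    by (intro radon_measurable[OF \<mu>] borel_measurable_continuous_onI g)
  have hm: "?h \<in> borel_measurable ?M" using \<mu> by (simp add: radon_def)
  have sets: "sets ?M = sets borel" using \<mu> by (simp add: radon_def)
  have loc: "integrable ?M (\<lambda>x. indicator {a..b} x *\<^sub>R ?h x)" for a b
    using \<mu> unfolding radon_def set_integrable_def by (auto simp: compact_Icc)
  have C: "C \<ge> 0" using g(2) norm_ge_zero order_trans by blast
  have interval: "(\<integral>x. indicator {a..b} x *\<^sub>R (g x * ?h x) \<partial>?M) = 0" for a b
  proof (cases "a \<le> b")
    case True
    \<comment> \<open>Widths \<open>1 / (k + 1)\<close> never exceed 1, so all approximants are
      supported in \<open>{a-1..b+1}\<close>, on which the dominating function lives.\<close>
    have "\<forall>k. \<exists>f. X f \<and> (\<forall>x. norm (f x) \<le> 1) \<and> (\<forall>x\<in>{a..b}. f x = 1) \<and>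
        (\<forall>x. x \<le> a - 1 / real (Suc k) \<or> x \<ge> b + 1 / real (Suc k) \<longrightarrow> f x = 0)"
      using X(1) True unfolding approximates_intervals_def by simp
    then obtain F where F: "\<And>k. X (F k)" "\<And>k x. norm (F k x) \<le> 1" "\<And>k x. x \<in> {a..b} \<Longrightarrow> F k x = 1"
        "\<And>k x. x \<le> a - 1 / real (Suc k) \<or> x \<ge> b + 1 / real (Suc k) \<Longrightarrow> F k x = 0"
      by metis
    have Fm: "F k \<in> borel_measurable ?M" for k
      by (intro radon_measurable[OF \<mu>] borel_measurable_continuous_onI Cc_continuous X F)
    have lim: "(\<lambda>k. F k x) \<longlonglongrightarrow> indicator {a..b} x" for x
    proof (cases "x \<in> {a..b}")
      case True
      then show ?thesis using F(3) by simp
    next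
      case False
      define \<delta> where "\<delta> = max (a - x) (x - b)"
      have "\<delta> > 0" using False by (auto simp: \<delta>_def)
      then have "eventually (\<lambda>k. 1 / real (Suc k) < \<delta>) sequentially"
        using LIMSEQ_inverse_real_of_nat order_tendstoD(2)[of _ 0 sequentially \<delta>]
        by (simp add: inverse_eq_divide)
      then have "eventually (\<lambda>k. F k x = indicator {a..b} x) sequentially"
      proof eventually_elim
        case (elim k)
        have "F k x = 0" by (rule F(4)) (use elim in \<open>auto simp: \<delta>_def max_def split: if_splits\<close>)
        then show ?case using False by simp
      qed
      then show ?thesis by (rule tendsto_eventually)
    qed
    have "(\<lambda>k. \<integral>x. g x * F k x * ?h x \<partial>?M) \<longlonglongrightarrow> (\<integral>x. indicator {a..b} x *\<^sub>R (g x * ?h x) \<partial>?M)"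
    proof (rule integral_dominated_convergence[where w="\<lambda>x. C * norm (indicator {a-1..b+1} x *\<^sub>R ?h x)"])
      show "(\<lambda>x. indicator {a..b} x *\<^sub>R (g x * ?h x)) \<in> borel_measurable ?M"
        using gm hm by (intro borel_measurable_scaleR borel_measurable_times borel_measurable_indicator) (simp_all add: sets)
      show "(\<lambda>x. g x * F k x * ?h x) \<in> borel_measurable ?M" for k
        using gm hm Fm by (intro borel_measurable_times)
      show "integrable ?M (\<lambda>x. C * norm (indicator {a-1..b+1} x *\<^sub>R ?h x))"
        by (intro integrable_mult_right integrable_norm loc)
      show "AE x in ?M. (\<lambda>k. g x * F k x * ?h x) \<longlonglongrightarrow> indicator {a..b} x *\<^sub>R (g x * ?h x)"
      proof (rule AE_I2)
        fix x
        have "(\<lambda>k. g x * F k x * ?h x) \<longlonglongrightarrow> g x * indicator {a..b} x * ?h x"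
          by (intro tendsto_intros lim)
        then show "(\<lambda>k. g x * F k x * ?h x) \<longlonglongrightarrow> indicator {a..b} x *\<^sub>R (g x * ?h x)"
          by (cases "x \<in> {a..b}") simp_all
      qed
      show "AE x in ?M. norm (g x * F k x * ?h x) \<le> C * norm (indicator {a-1..b+1} x *\<^sub>R ?h x)" for k
      proof (rule AE_I2)
        fix x
        show "norm (g x * F k x * ?h x) \<le> C * norm (indicator {a-1..b+1} x *\<^sub>R ?h x)"
        proof (cases "x \<in> {a-1..b+1}")
          case True
          have "norm (g x) * norm (F k x) \<le> C * 1"
            using g(2) F(2) C by (intro mult_mono) auto
          then show ?thesis using True by (simp add: norm_mult mult_right_mono)
        next
          case False
          have "1 / real (Suc k) \<le> 1" by simp
          moreover have "x < a - 1 \<or> x > b + 1" using False by auto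
          ultimately have "x \<le> a - 1 / real (Suc k) \<or> x \<ge> b + 1 / real (Suc k)" by linarith
          then have "F k x = 0" by (rule F(4))
          then show ?thesis using False by simp
        qed
      qed
    qed
    moreover have "(\<integral>x. g x * F k x * ?h x \<partial>?M) = 0" for k
      using zero[OF F(1)] by (simp add: mint_def)
    ultimately show ?thesis by (simp add: LIMSEQ_const_iff)
  qed simp
  \<comment> \<open>The density is only locally integrable, so the interval criterion is applied on
    each \<open>[-R, R]\<close> separately and the countably many null sets are united.\<close>
  have "AE x in ?M. indicator {- real R..real R} x *\<^sub>R (g x * ?h x) = 0" for R :: nat
  proof (rule AE_zero_if_interval_integrals_zero[OF radon_sigma_finite[OF \<mu>] sets])
    show "integrable ?M (\<lambda>x. indicator {- real R..real R} x *\<^sub>R (g x * ?h x))"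
    proof (rule Bochner_Integration.integrable_bound)
      show "integrable ?M (\<lambda>x. C * norm (indicator {- real R..real R} x *\<^sub>R ?h x))"
        by (intro integrable_mult_right integrable_norm loc)
      show "(\<lambda>x. indicator {- real R..real R} x *\<^sub>R (g x * ?h x)) \<in> borel_measurable ?M"
        using gm hm by (intro borel_measurable_scaleR borel_measurable_times borel_measurable_indicator) (simp_all add: sets)
      show "AE x in ?M. norm (indicator {- real R..real R} x *\<^sub>R (g x * ?h x)) \<le> norm (C * norm (indicator {- real R..real R} x *\<^sub>R ?h x))"
        using g(2) C by (intro AE_I2) (auto simp: norm_mult indicator_def mult_right_mono)
    qed
    show "(\<integral>x. indicator {a..b} x *\<^sub>R indicator {- real R..real R} x *\<^sub>R (g x * ?h x) \<partial>?M) = 0" for a b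
    proof -
      have "indicator {a..b} x *\<^sub>R indicator {- real R..real R} x *\<^sub>R (g x * ?h x)
          = indicator {max a (- real R)..min b (real R)} x *\<^sub>R (g x * ?h x)" for x
        by (auto simp: indicator_def)
      then show ?thesis by (simp only: interval)
    qed
  qed (rule interval)
  then have "AE x in ?M. \<forall>R::nat. indicator {- real R..real R} x *\<^sub>R (g x * ?h x) = 0"
    unfolding AE_all_countable by blast
  then show ?thesis
  proof (rule AE_mp, intro AE_I2 impI)
    fix x assume all: "\<forall>R::nat. indicator {- real R..real R} x *\<^sub>R (g x * ?h x) = 0"
    obtain R :: nat where "\<bar>x\<bar> < real R" using reals_Archimedean2 by blast
    then have "x \<in> {- real R..real R}" by auto
    then show "g x * ?h x = 0" using all[rule_format, of R] by simp
  qed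
qed

text \<open>The weight \<open>d j\<close> is the mass of the point \<open>j / \<alpha>\<close> times
  the density there. Admitting any finite \<open>J\<close> that contains the relevant indices allows
  \<open>J\<close> to be chosen as a singleton or empty when single points are tested.\<close>

lemma lattice_representation:
  assumes \<mu>: "radon \<mu>" and \<alpha>: "\<alpha> > 0"
    and ae: "AE x in fst \<mu>. x * \<alpha> \<notin> \<int> \<longrightarrow> snd \<mu> x = 0"
  obtains d :: "int \<Rightarrow> complex" where
    "\<And>f J. Cc f \<Longrightarrow> finite J \<Longrightarrow> {j. f (of_int j / \<alpha>) \<noteq> 0} \<subseteq> J \<Longrightarrow> mint \<mu> f = (\<Sum>j\<in>J. d j * f (of_int j / \<alpha>))"
proof -
  let ?M = "fst \<mu>" and ?h = "snd \<mu>"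
  define d where "d j = of_real (measure ?M {of_int j / \<alpha>}) * ?h (of_int j / \<alpha>)" for j :: int
  have sets: "sets ?M = sets borel" using \<mu> by (simp add: radon_def)
  have "mint \<mu> f = (\<Sum>j\<in>J. d j * f (of_int j / \<alpha>))"
    if f: "Cc f" and J: "finite J" "{j. f (of_int j / \<alpha>) \<noteq> 0} \<subseteq> J" for f J
  proof -
    let ?I = "\<lambda>(j::int) x. indicator {of_int j / \<alpha>} x *\<^sub>R (f (of_int j / \<alpha>) * ?h (of_int j / \<alpha>))"
    have fin: "emeasure ?M {of_int j / \<alpha>} < \<infinity>" for j :: int using \<mu> by (simp add: radon_def)
    have meas: "{of_int j / \<alpha>} \<in> sets ?M" for j :: int by (simp add: sets)
    have int: "integrable ?M (?I j)" for j
      by (intro integrable_scaleR_left integrable_real_indicator meas fin)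
    have m1: "(\<lambda>x. f x * ?h x) \<in> borel_measurable ?M"
      using radon_integrable_Cc[OF \<mu> f] by (rule borel_measurable_integrable)
    have m2: "(\<lambda>x. \<Sum>j\<in>J. ?I j x) \<in> borel_measurable ?M"
      by (intro borel_measurable_sum borel_measurable_integrable int)
    have pt: "f x * ?h x = (\<Sum>j\<in>J. ?I j x)" if x: "x * \<alpha> \<notin> \<int> \<longrightarrow> ?h x = 0" for x
    proof (cases "\<exists>i\<in>J. x = of_int i / \<alpha>")
      case True
      then obtain i where i: "i \<in> J" "x = of_int i / \<alpha>" by blast
      have "(\<Sum>j\<in>J. ?I j x) = (\<Sum>j\<in>J. if j = i then f x * ?h x else 0)"
        using i \<alpha> by (intro sum.cong) (auto simp: indicator_def)
      then show ?thesis using i J(1) by simp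
    next
      case False
      then have "(\<Sum>j\<in>J. ?I j x) = 0" by (intro sum.neutral) (auto simp: indicator_def)
      moreover have "f x * ?h x = 0"
      proof (cases "x * \<alpha> \<in> \<int>")
        case True
        then obtain i where "x * \<alpha> = of_int i" by (auto elim: Ints_cases)
        then have "x = of_int i / \<alpha>" using \<alpha> by (simp add: field_simps)
        then show ?thesis using False J(2) by auto
      qed (use x in simp)
      ultimately show ?thesis by simp
    qed
    have "mint \<mu> f = (\<integral>x. (\<Sum>j\<in>J. ?I j x) \<partial>?M)"
      unfolding mint_def by (rule integral_cong_AE[OF m1 m2]) (use ae in eventually_elim, rule pt)
    also have "\<dots> = (\<Sum>j\<in>J. \<integral>x. ?I j x \<partial>?M)"
      by (intro Bochner_Integration.integral_sum int)
    also have "\<dots> = (\<Sum>j\<in>J. d j * f (of_int j / \<alpha>))"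
    proof (intro sum.cong refl)
      fix j
      have "(\<integral>x. ?I j x \<partial>?M) = (\<integral>x. indicator {of_int j / \<alpha>} x \<partial>?M) *\<^sub>R (f (of_int j / \<alpha>) * ?h (of_int j / \<alpha>))"
        by (rule integral_scaleR_left) (intro integrable_real_indicator meas fin)
      also have "(\<integral>x. indicator {of_int j / \<alpha>} x \<partial>?M) = measure ?M {of_int j / \<alpha>}"
        using sets_eq_imp_space_eq[OF sets] by simp
      finally show "(\<integral>x. ?I j x \<partial>?M) = d j * f (of_int j / \<alpha>)"
        by (simp add: d_def scaleR_conv_of_real mult_ac)
    qed
    finally show ?thesis .
  qed
  then show ?thesis by (rule that)
qed

section \<open>Point masses of a periodic measure\<close>

lemma plateau_shift: "plateau a b e (x + t) = plateau (a - t) (b - t) e x"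
  unfolding plateau_def by (simp add: add_divide_distrib diff_divide_distrib algebra_simps)

text \<open>Supplies the width of a bump that tests a single point. The non-integer case matters
  because a lattice point moved by \<open>\<alpha>\<close> is not known in advance to be a lattice
  point.\<close>

lemma integer_isolated:
  fixes y :: real
  obtains \<delta> where "0 < \<delta>" "\<delta> \<le> 1" "\<And>i::int. \<bar>of_int i - y\<bar> < \<delta> \<Longrightarrow> of_int i = y"
proof (cases "y \<in> \<int>")
  case True
  then obtain k :: int where k: "y = of_int k" by (auto elim: Ints_cases)
  show ?thesis
  proof (rule that[of 1])
    fix i :: int assume "\<bar>of_int i - y\<bar> < 1"
    then have "\<bar>i - k\<bar> < 1" unfolding k by linarith
    then show "of_int i = y" using k by simp
  qed auto
next
  case False
  define \<delta> where "\<delta> = min (frac y) (1 - frac y)"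
  have "frac y > 0" "frac y < 1" using False frac_gt_0_iff[of y] frac_lt_1[of y] by auto
  then have \<delta>: "0 < \<delta>" "\<delta> \<le> 1" by (auto simp: \<delta>_def)
  show ?thesis
  proof (rule that[OF \<delta>])
    fix i :: int assume i: "\<bar>of_int i - y\<bar> < \<delta>"
    have False
    proof (cases "i \<le> \<lfloor>y\<rfloor>")
      case True
      then have "real_of_int i \<le> of_int \<lfloor>y\<rfloor>" by simp
      then show False using i by (auto simp: \<delta>_def frac_def)
    next
      case False
      then have "real_of_int i \<ge> of_int \<lfloor>y\<rfloor> + 1" by linarith
      then show False using i by (auto simp: \<delta>_def frac_def)
    qed
    then show "of_int i = y" ..
  qed
qed

text \<open>Moving \<open>j / \<alpha>\<close> by \<open>\<alpha>\<close> changes the index from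
  \<open>j\<close> to \<open>j + \<alpha>^2\<close>. Periodicity equates the masses at both places,
  so one nonzero mass forces \<open>\<alpha>^2\<close> to be an integer, which is then a period of
  the weights.\<close>

lemma periodic_lattice_measure:
  assumes \<alpha>: "\<alpha> > 0" and \<mu>: "nontrivial \<mu>"
    and per: "\<And>f. Cc f \<Longrightarrow> mtranslate \<alpha> \<mu> f = mint \<mu> f"
    and d: "\<And>f J. Cc f \<Longrightarrow> finite J \<Longrightarrow> {j. f (of_int j / \<alpha>) \<noteq> 0} \<subseteq> J \<Longrightarrow> mint \<mu> f = (\<Sum>j\<in>J. d j * f (of_int j / \<alpha>))"
  obtains n :: nat where "n > 0" "\<alpha> = sqrt (real n)" "\<And>j. d (j + int n) = d j"
proof -
  have bump: "mint \<mu> (plateau y y (\<delta> / \<alpha>)) = (if y * \<alpha> \<in> \<int> then d \<lfloor>y * \<alpha>\<rfloor> else 0)"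
    if \<delta>: "0 < \<delta>" and iso: "\<And>i::int. \<bar>of_int i - y * \<alpha>\<bar> < \<delta> \<Longrightarrow> of_int i = y * \<alpha>" for y \<delta>
  proof -
    let ?p = "plateau y y (\<delta> / \<alpha>)"
    have e: "\<delta> / \<alpha> > 0" using \<delta> \<alpha> by simp
    have cc: "Cc ?p" using e by (intro Cc_inf_imp_Cc Cc_inf_plateau) auto
    have supp: "of_int j = y * \<alpha>" if "?p (of_int j / \<alpha>) \<noteq> 0" for j :: int
    proof (rule iso)
      have lt: "y - \<delta> / \<alpha> < of_int j / \<alpha>" "of_int j / \<alpha> < y + \<delta> / \<alpha>"
        using that plateau_eq_0[OF e, of "of_int j / \<alpha>" y y] by force+
      show "\<bar>of_int j - y * \<alpha>\<bar> < \<delta>"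
        using mult_strict_right_mono[OF lt(1) \<alpha>] mult_strict_right_mono[OF lt(2) \<alpha>] \<alpha>
        by (simp add: left_diff_distrib distrib_right abs_less_iff)
    qed
    show ?thesis
    proof (cases "y * \<alpha> \<in> \<int>")
      case True
      then obtain k where k: "y * \<alpha> = of_int k" by (auto elim: Ints_cases)
      then have y: "of_int k / \<alpha> = y" using \<alpha> by (simp add: field_simps)
      have "{j. ?p (of_int j / \<alpha>) \<noteq> 0} \<subseteq> {k}" using supp k by auto
      then have "mint \<mu> ?p = (\<Sum>j\<in>{k}. d j * ?p (of_int j / \<alpha>))" by (intro d[OF cc]) auto
      then show ?thesis using True k y plateau_eq_1[OF e, of y y y] by simp
    next
      case False
      then have "{j. ?p (of_int j / \<alpha>) \<noteq> 0} \<subseteq> {}"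
        using supp Ints_of_int by (metis (mono_tags, lifting) Collect_empty_eq subset_refl)
      then have "mint \<mu> ?p = (\<Sum>j\<in>{}. d j * ?p (of_int j / \<alpha>))" by (intro d[OF cc]) auto
      then show ?thesis using False by simp
    qed
  qed
  have shift: "d j = (if of_int j + \<alpha>\<^sup>2 \<in> \<int> then d \<lfloor>of_int j + \<alpha>\<^sup>2\<rfloor> else 0)" for j :: int
  proof -
    let ?y = "of_int j / \<alpha>"
    have y: "?y * \<alpha> = of_int j" "(?y + \<alpha>) * \<alpha> = of_int j + \<alpha>\<^sup>2"
      using \<alpha> by (simp_all add: field_simps power2_eq_square)
    obtain \<delta> where \<delta>: "0 < \<delta>" "\<delta> \<le> 1" "\<And>i::int. \<bar>of_int i - (?y + \<alpha>) * \<alpha>\<bar> < \<delta> \<Longrightarrow> of_int i = (?y + \<alpha>) * \<alpha>"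
      using integer_isolated by blast
    \<comment> \<open>The width was chosen for the translated point; as
      \<open>\<delta> \<le> 1\<close>, it isolates the integer \<open>j\<close> as well.\<close>
    have "d j = mint \<mu> (plateau ?y ?y (\<delta> / \<alpha>))"
      by (subst bump[OF \<delta>(1)]) (use \<delta>(2) in \<open>simp_all only: y\<close>, auto)
    also have "\<dots> = mtranslate \<alpha> \<mu> (plateau (?y + \<alpha>) (?y + \<alpha>) (\<delta> / \<alpha>))"
      unfolding mtranslate_def plateau_shift by simp
    also have "\<dots> = mint \<mu> (plateau (?y + \<alpha>) (?y + \<alpha>) (\<delta> / \<alpha>))"
      using \<delta> \<alpha> by (intro per Cc_inf_imp_Cc Cc_inf_plateau) auto
    also have "\<dots> = (if (?y + \<alpha>) * \<alpha> \<in> \<int> then d \<lfloor>(?y + \<alpha>) * \<alpha>\<rfloor> else 0)"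
      by (rule bump[OF \<delta>(1)]) (rule \<delta>(3))
    finally show ?thesis unfolding y(2) .
  qed
  obtain f where f: "Cc f" "mint \<mu> f \<noteq> 0" using \<mu> by (auto simp: nontrivial_def)
  have "mint \<mu> f = (\<Sum>j\<in>{j. f (of_int j / \<alpha>) \<noteq> 0}. d j * f (of_int j / \<alpha>))"
    using finite_lattice_support[OF f(1) \<alpha>] by (intro d f) auto
  then obtain j0 where "d j0 \<noteq> 0" using f(2) by (metis (no_types, lifting) mult_zero_left sum.neutral)
  then have "of_int j0 + \<alpha>\<^sup>2 \<in> \<int>" using shift[of j0] by (auto split: if_splits)
  then have "\<alpha>\<^sup>2 \<in> \<int>" by simp
  then obtain k :: int where k: "\<alpha>\<^sup>2 = of_int k" by (auto elim: Ints_cases)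
  moreover have "\<alpha>\<^sup>2 > 0" using \<alpha> by simp
  ultimately have "k > 0" by simp
  define n where "n = nat k"
  have n: "\<alpha>\<^sup>2 = real n" "n > 0" using k \<open>k > 0\<close> by (auto simp: n_def)
  have "\<alpha> = sqrt (real n)" using n(1) \<alpha> by (metis abs_of_pos real_sqrt_abs)
  moreover have "d (j + int n) = d j" for j
    using shift[of j] unfolding n(1) by (metis floor_of_int Ints_of_int of_int_add of_int_of_nat_eq)
  ultimately show ?thesis using that n(2) by blast
qed

text \<open>Unordered sums become integrals over counting measure, which makes dominated convergence
  and image measures available for lattice sums.\<close>

lemma integral_count_space_eq_infsum:
  fixes t :: "'a \<Rightarrow> complex"
  assumes "(\<lambda>j. norm (t j)) summable_on UNIV"
  shows "integrable (count_space UNIV) t" "(\<integral>j. t j \<partial>count_space UNIV) = infsum t UNIV"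
proof -
  have a: "Infinite_Set_Sum.abs_summable_on t UNIV"
    using assms abs_summable_equivalent by blast
  then show "integrable (count_space UNIV) t" by (simp add: Infinite_Set_Sum.abs_summable_on_def)
  show "(\<integral>j. t j \<partial>count_space UNIV) = infsum t UNIV"
    using infsetsum_infsum[OF a] by (simp add: infsetsum_def)
qed

lemma lattice_sum_cutoff:
  assumes n: "n > 0" and F: "(\<lambda>j::int. norm (F (of_int j / sqrt (real n)))) summable_on UNIV"
  shows "(\<lambda>N. lattice_sum n c (\<lambda>x. F x * cutoff b N x)) \<longlonglongrightarrow> lattice_sum n c F"
proof -
  let ?x = "\<lambda>j::int. of_int j / sqrt (real n)"
  let ?t = "\<lambda>j::int. c (nat (j mod int n)) * F (?x j)"
  let ?tc = "\<lambda>N (j::int). c (nat (j mod int n)) * (F (?x j) * cutoff b N (?x j))"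
  have s: "(\<lambda>j. norm (?t j)) summable_on UNIV" by (rule lattice_sum_summable[OF n F])
  have le: "norm (?tc N j) \<le> norm (?t j)" for N j
    using mult_left_mono[OF norm_plateau_le, of "norm (?t j)"] by (simp add: norm_mult mult.assoc)
  have sc: "(\<lambda>j. norm (?tc N j)) summable_on UNIV" for N
    by (rule summable_on_comparison_test[OF s]) (use le in auto)
  have "(\<lambda>N. \<integral>j. ?tc N j \<partial>count_space UNIV) \<longlonglongrightarrow> (\<integral>j. ?t j \<partial>count_space UNIV)"
  proof (rule integral_dominated_convergence[where w="\<lambda>j. norm (?t j)"])
    show "integrable (count_space UNIV) (\<lambda>j. norm (?t j))"
      by (intro integrable_norm integral_count_space_eq_infsum s)
    show "AE j in count_space UNIV. (\<lambda>N. ?tc N j) \<longlonglongrightarrow> ?t j"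
    proof (rule AE_I2, rule tendsto_eventually)
      fix j
      have "eventually (\<lambda>N. real N \<ge> \<bar>?x j + b\<bar>) sequentially"
        using filterlim_real_sequentially unfolding filterlim_at_top by blast
      then show "eventually (\<lambda>N. ?tc N j = ?t j) sequentially"
        by eventually_elim (simp add: cutoff_eq_1)
    qed
  qed (use le in auto)
  then show ?thesis
    unfolding lattice_sum_def integral_count_space_eq_infsum(2)[OF s] integral_count_space_eq_infsum(2)[OF sc] .
qed

text \<open>Neighbouring lattice points are \<open>1 / sqrt n\<close> apart, so such a test function
  reads off a single weight. Identities between lattice sums thereby become identities between
  weights.\<close>

lemma lattice_sum_bump:
  assumes n: "n > 0" and m: "m < n"
    and f: "f (real m / sqrt (real n)) = 1"
      "\<And>x. x \<le> real m / sqrt (real n) - 1 / sqrt (real n) \<or> x \<ge> real m / sqrt (real n) + 1 / sqrt (real n) \<Longrightarrow> f x = 0"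
  shows "lattice_sum n c f = c m"
proof -
  have z: "f (of_int j / sqrt (real n)) = 0" if "j \<noteq> int m" for j :: int
  proof (rule f(2))
    have "of_int j \<le> real m - 1 \<or> of_int j \<ge> real m + 1" using that by linarith
    then show "of_int j / sqrt (real n) \<le> real m / sqrt (real n) - 1 / sqrt (real n) \<or>
        of_int j / sqrt (real n) \<ge> real m / sqrt (real n) + 1 / sqrt (real n)"
      using n by (auto simp: diff_divide_distrib[symmetric] add_divide_distrib[symmetric] intro!: divide_right_mono)
  qed
  have "lattice_sum n c f = (\<Sum>\<^sub>\<infinity>j\<in>{int m}. c (nat (j mod int n)) * f (of_int j / sqrt (real n)))"
    unfolding lattice_sum_def by (rule infsum_cong_neutral) (use z in auto)
  then show ?thesis using m f(1) by simp
qed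

lemma lattice_sum_cmult: "lattice_sum n (\<lambda>l. a * c l) f = a * lattice_sum n c f"
  unfolding lattice_sum_def by (simp add: mult.assoc infsum_cmult_right')

lemma lattice_sum_cong: "n > 0 \<Longrightarrow> (\<And>l. l < n \<Longrightarrow> c l = d l) \<Longrightarrow> lattice_sum n c f = lattice_sum n d f"
  unfolding lattice_sum_def by (simp add: nat_less_iff)

text \<open>Both notions of eigenmeasure enter only through \<open>lim\<close>.\<close>

lemma periodic_fourier_invariant:
  fixes s :: int
  assumes \<alpha>: "\<alpha> > 0" and \<mu>: "radon \<mu>" "nontrivial \<mu>"
    and per: "\<And>f. Cc f \<Longrightarrow> mtranslate \<alpha> \<mu> f = mint \<mu> f"
    and s: "s = 1 \<or> s = - 1" and a: "a \<noteq> 0"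
    and X: "\<And>f. X f \<Longrightarrow> Cc f" "approximates_intervals X"
      "\<And>f t. X f \<Longrightarrow> X (\<lambda>x. uchar (t * x) * f x)"
      "\<And>f L. X f \<Longrightarrow> L > 0 \<Longrightarrow> (\<lambda>j::int. norm (fourier f (of_int j / L))) summable_on UNIV"
    and lim: "\<And>f b. X f \<Longrightarrow> (\<lambda>N. mint \<mu> (\<lambda>x. fourier f (of_int s * x) * cutoff b N x)) \<longlonglongrightarrow> a * mint \<mu> f"
  obtains n c where "n > 0" "\<alpha> = sqrt (real n)" "\<And>m. m < n \<Longrightarrow> gdft s n c m = a * c m"
    "\<And>f. Cc f \<Longrightarrow> mint \<mu> f = lattice_sum n c f"
proof -
  let ?e = "\<lambda>x. uchar (- of_int s * \<alpha> * x)"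
  have ccH: "Cc (\<lambda>x. fourier f (of_int s * x) * cutoff b N x)" if "X f" for f b N
    by (intro Cc_mult Cc_inf_imp_Cc[OF Cc_inf_cutoff]
        continuous_on_compose2[OF continuous_on_fourier[OF X(1)[OF that], of UNIV]] continuous_intros) auto
  have inv: "mint \<mu> (\<lambda>x. ?e x * f x) = mint \<mu> f" if f: "X f" for f
  proof -
    \<comment> \<open>The transform of \<open>?e f\<close> at \<open>s x\<close> is that of
      \<open>f\<close> at \<open>s (x + \<alpha>)\<close>, and the cutoff centred at
      \<open>- \<alpha>\<close> is the translate of the one centred at 0, so the whole integrand is
      a translate by \<open>\<alpha>\<close>.\<close>
    have "mint \<mu> (\<lambda>x. fourier (\<lambda>x. ?e x * f x) (of_int s * x) * cutoff \<alpha> N x)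
        = mint \<mu> (\<lambda>x. fourier f (of_int s * x) * cutoff 0 N x)" for N
    proof -
      have "fourier (\<lambda>x. ?e x * f x) y = fourier f (y + of_int s * \<alpha>)" for y
        using fourier_modulation[of "of_int s * \<alpha>" f y] by simp
      moreover have "cutoff 0 N (x + \<alpha>) = cutoff \<alpha> N x" for x
      proof -
        have "- 0 - real N - \<alpha> = - \<alpha> - real N" "real N - 0 - \<alpha> = real N - \<alpha>" by auto
        then show ?thesis by (simp only: plateau_shift)
      qed
      ultimately have "mint \<mu> (\<lambda>x. fourier (\<lambda>x. ?e x * f x) (of_int s * x) * cutoff \<alpha> N x)
          = mtranslate \<alpha> \<mu> (\<lambda>x. fourier f (of_int s * x) * cutoff 0 N x)"
        unfolding mtranslate_def by (simp only: distrib_left)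
      also have "\<dots> = mint \<mu> (\<lambda>x. fourier f (of_int s * x) * cutoff 0 N x)"
        by (rule per[OF ccH[OF f]])
      finally show ?thesis .
    qed
    \<comment> \<open>The hypothesis \<open>lim\<close> is used with centre parameter
      \<open>\<alpha>\<close> for the modulated function and 0 for \<open>f\<close>; both limits
      belong to the same sequence.\<close>
    then have "(\<lambda>N. mint \<mu> (\<lambda>x. fourier f (of_int s * x) * cutoff 0 N x)) \<longlonglongrightarrow> a * mint \<mu> (\<lambda>x. ?e x * f x)"
      using lim[OF X(3)[OF f, of "- of_int s * \<alpha>"], of \<alpha>] by simp
    then have "a * mint \<mu> (\<lambda>x. ?e x * f x) = a * mint \<mu> f"
      using lim[OF f, of 0] LIMSEQ_unique by blast
    then show ?thesis using a by simp
  qed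
  have "AE x in fst \<mu>. (1 - ?e x) * snd \<mu> x = 0"
  proof (rule AE_zero_if_annihilates[OF \<mu>(1) X(2,1)])
    show "continuous_on UNIV (\<lambda>x. 1 - ?e x)" by (intro continuous_intros)
    show "norm (1 - ?e x) \<le> 2" for x using norm_triangle_ineq4[of 1 "?e x"] by simp
    show "mint \<mu> (\<lambda>x. (1 - ?e x) * f x) = 0" if f: "X f" for f
      using mint_diff[OF \<mu>(1) X(1)[OF f] X(1)[OF X(3)[OF f, of "- of_int s * \<alpha>"]]] inv[OF f]
      by (simp add: left_diff_distrib)
  qed
  then have "AE x in fst \<mu>. x * \<alpha> \<notin> \<int> \<longrightarrow> snd \<mu> x = 0"
  proof eventually_elim
    case (elim x)
    have "- of_int s * \<alpha> * x \<in> \<int> \<longleftrightarrow> x * \<alpha> \<in> \<int>"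
      using s by (auto simp: mult.commute)
    then show ?case using elim uchar_eq_1_iff[of "- of_int s * \<alpha> * x"] by auto
  qed
  from lattice_representation[OF \<mu>(1) \<alpha> this]
  obtain d where d: "\<And>f J. Cc f \<Longrightarrow> finite J \<Longrightarrow> {j. f (of_int j / \<alpha>) \<noteq> 0} \<subseteq> J \<Longrightarrow> mint \<mu> f = (\<Sum>j\<in>J. d j * f (of_int j / \<alpha>))"
    by blast
  obtain n where n: "n > 0" "\<alpha> = sqrt (real n)" "\<And>j. d (j + int n) = d j"
    using periodic_lattice_measure[OF \<alpha> \<mu>(2) per d] by blast
  define c where "c m = d (int m)" for m
  have dper: "d (j + k * int n) = d j" for j k
  proof -
    have nat: "d (j + int i * int n) = d j" for i j
    proof (induction i)
      case (Suc i)
      then show ?case using n(3)[of "j + int i * int n"] by (simp add: algebra_simps)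
    qed simp
    show ?thesis
    proof (cases "k \<ge> 0")
      case True
      then show ?thesis using nat[of j "nat k"] by simp
    next
      case False
      then show ?thesis using nat[of "j + k * int n" "nat (- k)"] by simp
    qed
  qed
  have dc: "d j = c (nat (j mod int n))" for j
    using dper[of "j mod int n" "j div int n"] n(1) by (simp add: c_def)
  have rep: "mint \<mu> f = lattice_sum n c f" if f: "Cc f" for f
  proof -
    let ?J = "{j::int. f (of_int j / \<alpha>) \<noteq> 0}"
    have J: "finite ?J" by (rule finite_lattice_support[OF f \<alpha>])
    have "mint \<mu> f = (\<Sum>j\<in>?J. d j * f (of_int j / \<alpha>))" by (rule d[OF f J order_refl])
    also have "\<dots> = (\<Sum>\<^sub>\<infinity>j\<in>?J. d j * f (of_int j / \<alpha>))" using J by simp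
    also have "\<dots> = (\<Sum>\<^sub>\<infinity>j. d j * f (of_int j / \<alpha>))" by (rule infsum_cong_neutral) auto
    finally show ?thesis unfolding lattice_sum_def dc n(2) .
  qed
  \<comment> \<open>With \<open>\<mu>\<close> known to be a lattice sum, the limit in
    \<open>lim\<close> can be evaluated: it is the lattice sum of the transform, which Poisson
    summation turns into a lattice sum of \<open>f\<close> with transformed weights.\<close>
  have dual: "lattice_sum n (gdft s n c) f = a * lattice_sum n c f" if f: "X f" for f
  proof -
    let ?g = "\<lambda>x. fourier f (of_int s * x)"
    have L: "sqrt (real n) > 0" using n by simp
    have sum: "(\<lambda>j::int. norm (fourier f (of_int j / sqrt (real n)))) summable_on UNIV" by (rule X(4)[OF f L])
    have bij: "bij_betw (\<lambda>j. s * j) UNIV (UNIV :: int set)"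
      by (rule bij_betw_byWitness[where f'="\<lambda>j. s * j"]) (use s in auto)
    have gs: "(\<lambda>j::int. norm (?g (of_int j / sqrt (real n)))) summable_on UNIV"
      using sum summable_on_reindex_bij_betw[OF bij, of "\<lambda>j. norm (fourier f (of_int j / sqrt (real n)))"] by simp
    have "(\<lambda>N. lattice_sum n c (\<lambda>x. ?g x * cutoff 0 N x)) \<longlonglongrightarrow> lattice_sum n c ?g"
      by (rule lattice_sum_cutoff[OF n(1) gs])
    moreover have "(\<lambda>N. lattice_sum n c (\<lambda>x. ?g x * cutoff 0 N x)) \<longlonglongrightarrow> a * lattice_sum n c f"
      using lim[OF f, of 0] unfolding rep[OF ccH[OF f]] rep[OF X(1)[OF f]] .
    ultimately have "lattice_sum n c ?g = a * lattice_sum n c f" using LIMSEQ_unique by blast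
    then show ?thesis using lattice_sum_fourier[OF n(1) X(1)[OF f] s sum] by simp
  qed
  have "gdft s n c m = a * c m" if m: "m < n" for m
  proof -
    have "1 / sqrt (real n) > 0" using n(1) by simp
    then obtain f where f: "X f" "\<forall>x\<in>{real m / sqrt (real n)..real m / sqrt (real n)}. f x = 1"
      "\<forall>x. x \<le> real m / sqrt (real n) - 1 / sqrt (real n) \<or> x \<ge> real m / sqrt (real n) + 1 / sqrt (real n) \<longrightarrow> f x = 0"
      using X(2) unfolding approximates_intervals_def by (metis order_refl)
    have b: "lattice_sum n c' f = c' m" for c' using f n(1) m by (intro lattice_sum_bump) auto
    show ?thesis using dual[OF f(1)] unfolding b .
  qed
  then show ?thesis using that n rep by blast
qed

subsection \<open>Eigenmeasures\<close>

lemma mint_mscale: "mint (mscale a \<mu>) f = a * mint \<mu> f"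
proof -
  have "mint (mscale a \<mu>) f = (\<integral>x. a * (f x * snd \<mu> x) \<partial>fst \<mu>)"
    by (simp add: mint_def mscale_def mult_ac)
  then show ?thesis by (simp add: mint_def)
qed

lemma radon_mscale:
  assumes "radon \<mu>"
  shows "radon (mscale a \<mu>)"
proof -
  have "set_integrable (fst \<mu>) K (\<lambda>x. a * snd \<mu> x)" if "compact K" for K
    using assms that unfolding radon_def by (intro set_integrable_mult_right) auto
  then show ?thesis using assms unfolding radon_def mscale_def by auto
qed

lemma eigenmeasure_cutoff_limit:
  assumes "eigenmeasure \<mu> lam" "Cc_inf f"
  shows "(\<lambda>N. mint \<mu> (\<lambda>x. fourier f (of_int 1 * x) * cutoff b N x)) \<longlonglongrightarrow> lam * mint \<mu> f"
proof -
  obtain \<nu> where \<nu>: "dist_fourier_is \<mu> \<nu>" "meq \<nu> (mscale lam \<mu>)"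
    using assms unfolding eigenmeasure_def by blast
  obtain T where T: "tempered_ext \<mu> T" "\<And>\<phi>. Cc_inf \<phi> \<Longrightarrow> T (fourier \<phi>) = mint \<nu> \<phi>"
    using \<nu>(1) unfolding dist_fourier_is_def by blast
  have "T (fourier f) = lam * mint \<mu> f"
    using T(2)[OF assms(2)] \<nu>(2) Cc_inf_imp_Cc[OF assms(2)] unfolding meq_def by (simp add: mint_mscale)
  then show ?thesis
    using tempered_ext_cutoff[OF T(1) schwartz_fourier[OF assms(2)], of b] by simp
qed

text \<open>Absolute convergence is granted for \<open>\<nu>\<close>, while \<open>meq\<close>
  compares \<open>\<nu>\<close> with \<open>lam\<close> times \<open>\<mu>\<close> only on
  \<open>Cc\<close>. Hence dominated convergence is used under \<open>\<nu>\<close>, each truncation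
  is transferred to \<open>\<mu>\<close>, and the factor \<open>lam\<close> is divided out.\<close>

lemma strict_eigenmeasure_cutoff_limit:
  assumes "strict_eigenmeasure \<mu> lam" "Cc_conv_span f" "lam \<noteq> 0"
  shows "(\<lambda>N. mint \<mu> (\<lambda>x. fourier f (of_int (- 1) * x) * cutoff b N x)) \<longlonglongrightarrow> inverse lam * mint \<mu> f"
proof -
  obtain \<nu> where \<nu>: "strict_fourier_is \<mu> \<nu>" "meq \<nu> (mscale lam \<mu>)"
    using assms unfolding strict_eigenmeasure_def by blast
  let ?g = "\<lambda>x. fourier f (of_int (- 1) * x)"
  have g: "fourier_check f = ?g" by (simp add: fourier_check_def fun_eq_iff)
  have rad: "radon \<nu>" using \<nu>(1) by (simp add: strict_fourier_is_def)
  have "mintegrable \<nu> (fourier_check f)" "mint \<mu> f = mint \<nu> (fourier_check f)"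
    using \<nu>(1) assms(2) by (simp_all add: strict_fourier_is_def)
  then have int: "integrable (fst \<nu>) (\<lambda>x. ?g x * snd \<nu> x)" and eq: "mint \<mu> f = mint \<nu> ?g"
    unfolding g mintegrable_def .
  have cc: "Cc (\<lambda>x. ?g x * cutoff b N x)" for N
    by (intro Cc_mult Cc_inf_imp_Cc[OF Cc_inf_cutoff]
        continuous_on_compose2[OF continuous_on_fourier[OF Cc_conv_span_imp_Cc[OF assms(2)], of UNIV]] continuous_intros) auto
  have "(\<lambda>N. \<integral>x. ?g x * cutoff b N x * snd \<nu> x \<partial>fst \<nu>) \<longlonglongrightarrow> (\<integral>x. ?g x * snd \<nu> x \<partial>fst \<nu>)"
  proof (rule integral_dominated_convergence[where w="\<lambda>x. norm (?g x * snd \<nu> x)"])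
    show "(\<lambda>x. ?g x * snd \<nu> x) \<in> borel_measurable (fst \<nu>)" using int by (rule borel_measurable_integrable)
    show "(\<lambda>x. ?g x * cutoff b N x * snd \<nu> x) \<in> borel_measurable (fst \<nu>)" for N
      using radon_integrable_Cc[OF rad cc] by (rule borel_measurable_integrable)
    show "integrable (fst \<nu>) (\<lambda>x. norm (?g x * snd \<nu> x))" using int by (rule integrable_norm)
    show "AE x in fst \<nu>. (\<lambda>N. ?g x * cutoff b N x * snd \<nu> x) \<longlonglongrightarrow> ?g x * snd \<nu> x"
    proof (rule AE_I2, rule tendsto_eventually)
      fix x
      have "eventually (\<lambda>N. real N \<ge> \<bar>x + b\<bar>) sequentially"
        using filterlim_real_sequentially unfolding filterlim_at_top by blast
      then show "eventually (\<lambda>N. ?g x * cutoff b N x * snd \<nu> x = ?g x * snd \<nu> x) sequentially"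
        by eventually_elim (simp add: cutoff_eq_1)
    qed
    show "AE x in fst \<nu>. norm (?g x * cutoff b N x * snd \<nu> x) \<le> norm (?g x * snd \<nu> x)" for N
    proof (rule AE_I2)
      fix x
      show "norm (?g x * cutoff b N x * snd \<nu> x) \<le> norm (?g x * snd \<nu> x)"
        using mult_left_mono[OF norm_plateau_le[of "- b - real N" "real N - b" 1 x], of "norm (?g x * snd \<nu> x)"]
        by (simp add: norm_mult mult_ac)
    qed
  qed
  then have "(\<lambda>N. mint \<nu> (\<lambda>x. ?g x * cutoff b N x)) \<longlonglongrightarrow> mint \<nu> ?g"
    unfolding mint_def .
  moreover have "mint \<nu> (\<lambda>x. ?g x * cutoff b N x) = lam * mint \<mu> (\<lambda>x. ?g x * cutoff b N x)" for N
    using \<nu>(2) cc unfolding meq_def mint_mscale by blast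
  ultimately have "(\<lambda>N. lam * mint \<mu> (\<lambda>x. ?g x * cutoff b N x)) \<longlonglongrightarrow> mint \<mu> f"
    unfolding eq by simp
  from tendsto_mult_left[OF this, of "inverse lam"] show ?thesis
    using assms(3) by (simp add: mult.assoc[symmetric])
qed

lemma Cc_inf_modulation: "Cc_inf f \<Longrightarrow> Cc_inf (\<lambda>x. uchar (t * x) * f x)"
  by (intro Cc_inf_mult smooth_uchar)

section \<open>Lattice sums as eigenmeasures\<close>

lemma tempered_ext_lattice_sum:
  assumes n: "n > 0" and rep: "\<And>f. Cc f \<Longrightarrow> mint \<mu> f = lattice_sum n c f"
  shows "tempered_ext \<mu> (lattice_sum n c)"
  unfolding tempered_ext_def
proof (intro conjI allI impI)
  have L: "sqrt (real n) > 0" using n by simp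
  let ?x = "\<lambda>j::int. of_int j / sqrt (real n)"
  have summ: "(\<lambda>j. norm (c (nat (j mod int n)) * f (?x j))) summable_on UNIV" if "schwartz f" for f
    by (rule lattice_sum_summable[OF n schwartz_lattice_summable[OF that L]])
  show "lattice_sum n c (\<lambda>x. \<phi> x + \<psi> x) = lattice_sum n c \<phi> + lattice_sum n c \<psi>" if "schwartz \<phi>" "schwartz \<psi>" for \<phi> \<psi>
    unfolding lattice_sum_def distrib_left
    by (rule infsum_add; rule abs_summable_summable, rule summ, rule that)
  show "lattice_sum n c (\<lambda>x. a * \<phi> x) = a * lattice_sum n c \<phi>" for a \<phi>
    unfolding lattice_sum_def infsum_cmult_right'[symmetric] by (intro infsum_cong) simp
  show "lattice_sum n c \<phi> = mint \<mu> \<phi>" if "Cc_inf \<phi>" for \<phi>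
    using rep[OF Cc_inf_imp_Cc[OF that]] by simp
  define B where "B = (\<Sum>l<n. norm (c l))"
  have B0: "B \<ge> 0" by (auto simp: B_def intro: sum_nonneg)
  let ?w = "\<lambda>j. 1 / (1 + (?x j)\<^sup>2)"
  define W where "W = infsum ?w UNIV"
  have W0: "W \<ge> 0" unfolding W_def by (rule infsum_nonneg) simp
  have wsum: "?w summable_on UNIV" by (rule summable_on_int_inverse_square[OF L])
  show "\<exists>N C. \<forall>\<phi>. schwartz \<phi> \<longrightarrow> norm (lattice_sum n c \<phi>) \<le> C * (\<Sum>j\<le>N. \<Sum>k\<le>N. sseminorm j k \<phi>)"
  \<comment> \<open>Order 2 is the highest one in \<open>schwartz_lattice_bound\<close>;
    \<open>B\<close> bounds the weights and \<open>W\<close> is the sum of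
    \<open>1 / (1 + x^2)\<close> over the lattice.\<close>
  proof (rule exI[of _ 2], rule exI[of _ "B * W"], intro allI impI)
    fix \<phi> assume \<phi>: "schwartz \<phi>"
    let ?s = "sseminorm 0 0 \<phi> + sseminorm 0 2 \<phi>"
    have s0: "?s \<ge> 0" using sseminorm_nonneg[OF \<phi>] by simp
    have "norm (lattice_sum n c \<phi>) \<le> (\<Sum>\<^sub>\<infinity>j. norm (c (nat (j mod int n)) * \<phi> (?x j)))"
      unfolding lattice_sum_def by (rule norm_infsum_bound[OF summ[OF \<phi>]])
    also have "\<dots> \<le> (\<Sum>\<^sub>\<infinity>j. (B * ?s) * ?w j)"
    proof (rule infsum_mono[OF summ[OF \<phi>] summable_on_cmult_right[OF wsum]])
      fix j :: int
      have "nat (j mod int n) < n" using n by (simp add: nat_less_iff)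
      then have "norm (c (nat (j mod int n))) \<le> B"
        unfolding B_def by (intro member_le_sum) auto
      then have "norm (c (nat (j mod int n))) * norm (\<phi> (?x j)) \<le> B * (?s * ?w j)"
        using schwartz_lattice_bound[OF \<phi>, of "?x j"] B0 by (intro mult_mono) auto
      then show "norm (c (nat (j mod int n)) * \<phi> (?x j)) \<le> (B * ?s) * ?w j"
        by (simp only: norm_mult mult.assoc)
    qed
    also have "\<dots> = (B * W) * ?s"
      unfolding W_def infsum_cmult_right' by (simp add: mult_ac)
    also have "\<dots> \<le> (B * W) * (\<Sum>j\<le>2. \<Sum>k\<le>2. sseminorm j k \<phi>)"
    proof (rule mult_left_mono)
      have "?s \<le> (\<Sum>k\<le>2. sseminorm 0 k \<phi>)"
        using sseminorm_nonneg[OF \<phi>] by (simp add: numeral_2_eq_2)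
      also have "\<dots> \<le> (\<Sum>j\<le>2. \<Sum>k\<le>2. sseminorm j k \<phi>)"
        using sseminorm_nonneg[OF \<phi>] by (intro member_le_sum[of "0::nat"] sum_nonneg) auto
      finally show "?s \<le> (\<Sum>j\<le>2. \<Sum>k\<le>2. sseminorm j k \<phi>)" .
    qed (use B0 W0 in simp)
    finally show "norm (lattice_sum n c \<phi>) \<le> B * W * (\<Sum>j\<le>2. \<Sum>k\<le>2. sseminorm j k \<phi>)" .
  qed
qed

lemma lattice_eigenmeasure:
  assumes n: "n > 0" and \<mu>: "radon \<mu>" "nontrivial \<mu>"
    and rep: "\<And>f. Cc f \<Longrightarrow> mint \<mu> f = lattice_sum n c f"
    and eig: "\<And>m. m < n \<Longrightarrow> gdft 1 n c m = lam * c m"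
  shows "eigenmeasure \<mu> lam"
proof -
  have T: "tempered_ext \<mu> (lattice_sum n c)" by (rule tempered_ext_lattice_sum[OF n rep])
  have "lattice_sum n c (fourier \<phi>) = mint (mscale lam \<mu>) \<phi>" if \<phi>: "Cc_inf \<phi>" for \<phi>
  proof -
    have "(\<lambda>j::int. norm (fourier \<phi> (of_int j / sqrt (real n)))) summable_on UNIV"
      using n by (intro schwartz_lattice_summable schwartz_fourier \<phi>) auto
    from lattice_sum_fourier[OF n Cc_inf_imp_Cc[OF \<phi>] _ this, of 1 c]
    have "lattice_sum n c (fourier \<phi>) = lattice_sum n (gdft 1 n c) \<phi>" by simp
    also have "\<dots> = lam * lattice_sum n c \<phi>"
      unfolding lattice_sum_cmult[symmetric] by (rule lattice_sum_cong[OF n eig])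
    finally show ?thesis using rep[OF Cc_inf_imp_Cc[OF \<phi>]] by (simp add: mint_mscale)
  qed
  then have "dist_fourier_is \<mu> (mscale lam \<mu>)"
    unfolding dist_fourier_is_def using T radon_mscale[OF \<mu>(1)] by blast
  then show ?thesis
    unfolding eigenmeasure_def tempered_def meq_def using \<mu> T by blast
qed

text \<open>Counting measure carried to the lattice, with the weights as density; adding
  \<open>1 / 2\<close> before \<open>floor\<close> rounds to the nearest index and gives a Borel
  function on the line. A concrete pair is built because knowing \<open>mint \<mu>\<close> on
  \<open>Cc\<close> does not by itself show that transforms are integrable against the given pair
  \<open>\<mu>\<close>.\<close>

definition lattice_measure :: "nat \<Rightarrow> (nat \<Rightarrow> complex) \<Rightarrow> cmeasure" where
  "lattice_measure n c = (distr (count_space UNIV) borel (\<lambda>j::int. of_int j / sqrt (real n)),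
     \<lambda>x. c (nat (\<lfloor>x * sqrt (real n) + 1 / 2\<rfloor> mod int n)))"

lemma lattice_measure_density:
  assumes "n > 0"
  shows "snd (lattice_measure n c) (of_int j / sqrt (real n)) = c (nat (j mod int n))"
proof -
  have "\<lfloor>of_int j / sqrt (real n) * sqrt (real n) + 1 / 2\<rfloor> = j"
    using assms by simp
  then show ?thesis by (simp add: lattice_measure_def)
qed

lemma lattice_measure_measurable:
  "snd (lattice_measure n c) \<in> borel_measurable (fst (lattice_measure n c))"
proof -
  have "(\<lambda>x::real. \<lfloor>x * sqrt (real n) + 1 / 2\<rfloor>) \<in> borel \<rightarrow>\<^sub>M count_space UNIV" by measurable
  then have "(\<lambda>k::int. c (nat (k mod int n))) \<circ> (\<lambda>x::real. \<lfloor>x * sqrt (real n) + 1 / 2\<rfloor>) \<in> borel_measurable borel"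
    by (rule measurable_comp) simp
  then show ?thesis by (simp add: lattice_measure_def o_def)
qed

lemma lattice_measure_mint:
  assumes n: "n > 0" and f: "f \<in> borel_measurable borel"
    and summable: "(\<lambda>j::int. norm (f (of_int j / sqrt (real n)))) summable_on UNIV"
  shows "mintegrable (lattice_measure n c) f" "mint (lattice_measure n c) f = lattice_sum n c f"
proof -
  let ?x = "\<lambda>j::int. of_int j / sqrt (real n)"
  let ?h = "snd (lattice_measure n c)"
  have m: "(\<lambda>x. f x * ?h x) \<in> borel_measurable borel"
    using f lattice_measure_measurable[of n c] by (intro borel_measurable_times) (auto simp: lattice_measure_def)
  have eq: "f (?x j) * ?h (?x j) = c (nat (j mod int n)) * f (?x j)" for j
    by (simp add: lattice_measure_density[OF n])
  note s = integral_count_space_eq_infsum[OF lattice_sum_summable[where F=f and c=c, OF n summable]]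
  have "integrable (distr (count_space UNIV) borel ?x) (\<lambda>x. f x * ?h x)"
    using s(1) by (subst integrable_distr_eq) (simp_all add: m eq)
  then show "mintegrable (lattice_measure n c) f" by (simp add: mintegrable_def lattice_measure_def)
  have "(\<integral>x. f x * ?h x \<partial>distr (count_space UNIV) borel ?x) = (\<integral>j. f (?x j) * ?h (?x j) \<partial>count_space UNIV)"
    by (rule integral_distr[OF _ m]) simp
  also have "\<dots> = lattice_sum n c f" unfolding eq s(2) lattice_sum_def ..
  finally show "mint (lattice_measure n c) f = lattice_sum n c f" by (simp add: mint_def lattice_measure_def)
qed

lemma radon_lattice_measure:
  assumes n: "n > 0"
  shows "radon (lattice_measure n c)"
proof -
  let ?x = "\<lambda>j::int. of_int j / sqrt (real n)"
  have fin: "finite {j. ?x j \<in> K}" if "compact K" for K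
  proof -
    have "bounded K" using that by (rule compact_imp_bounded)
    then obtain R where R: "\<And>x. x \<in> K \<Longrightarrow> \<bar>x\<bar> \<le> R" "R > 0"
      unfolding bounded_pos by auto
    have "finite {j. plateau (- R) R 1 (?x j) \<noteq> 0}"
      using R n by (intro finite_lattice_support Cc_inf_imp_Cc Cc_inf_plateau) auto
    moreover have "plateau (- R) R 1 (?x j) \<noteq> 0" if "?x j \<in> K" for j
    proof -
      have "- R \<le> ?x j" "?x j \<le> R" using R(1)[OF that] by linarith+
      then show ?thesis by (subst plateau_eq_1) auto
    qed
    ultimately show ?thesis by (auto elim!: rev_finite_subset)
  qed
  have "emeasure (fst (lattice_measure n c)) K < \<infinity>" if "compact K" for K
  proof -
    have "emeasure (fst (lattice_measure n c)) K = emeasure (count_space UNIV) {j. ?x j \<in> K}"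
      using borel_compact[OF that] by (simp add: lattice_measure_def emeasure_distr vimage_def)
    then show ?thesis using fin[OF that] by (simp add: of_nat_less_top)
  qed
  moreover have "set_integrable (fst (lattice_measure n c)) K (snd (lattice_measure n c))" if "compact K" for K
  proof -
    have "(\<lambda>j. norm (indicator K (?x j) :: complex)) summable_on UNIV"
    proof (rule summable_on_cong_neutral[THEN iffD1])
      show "(\<lambda>j. norm (indicator K (?x j) :: complex)) summable_on {j. ?x j \<in> K}"
        using fin[OF that] by (rule summable_on_finite)
    qed auto
    from lattice_measure_mint(1)[OF n _ this] borel_compact[OF that]
    have "integrable (fst (lattice_measure n c)) (\<lambda>x. indicator K x * snd (lattice_measure n c) x)"
      by (simp add: mintegrable_def)
    moreover have "indicator K x * snd (lattice_measure n c) x = indicat_real K x *\<^sub>R snd (lattice_measure n c) x" for x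
      by (simp add: indicator_def)
    ultimately show ?thesis by (simp add: set_integrable_def)
  qed
  ultimately show ?thesis
    unfolding radon_def using lattice_measure_measurable by (auto simp: lattice_measure_def)
qed

lemma gdft_eigen_inverse:
  assumes n: "n > 0" and s: "s = 1 \<or> s = - 1" and a: "a \<noteq> 0"
    and eig: "\<And>m. m < n \<Longrightarrow> gdft s n c m = a * c m" and m: "m < n"
  shows "gdft (- s) n c m = inverse a * c m"
proof -
  have "c m = gdft (- s) n (gdft s n c) m" by (rule gdft_inverse[OF n m s, symmetric])
  also have "\<dots> = a * gdft (- s) n c m"
    unfolding gdft_cmult[symmetric] by (rule gdft_cong[OF eig])
  finally show ?thesis using a by (simp add: field_simps)
qed

text \<open>The transform is the concrete lattice measure with weights \<open>lam * c\<close>.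
  Applying it to \<open>fourier_check f\<close> brings in the inverse matrix, whose eigenvalue
  \<open>inverse lam\<close> on \<open>c\<close> cancels the factor \<open>lam\<close>.\<close>

lemma lattice_strict_eigenmeasure:
  assumes n: "n > 0" and \<mu>: "radon \<mu>" "nontrivial \<mu>" and lam: "lam \<noteq> 0"
    and rep: "\<And>f. Cc f \<Longrightarrow> mint \<mu> f = lattice_sum n c f"
    and eig: "\<And>m. m < n \<Longrightarrow> gdft 1 n c m = lam * c m"
  shows "strict_eigenmeasure \<mu> lam"
proof -
  have L: "sqrt (real n) > 0" using n by simp
  define \<nu> where "\<nu> = lattice_measure n (\<lambda>l. lam * c l)"
  have "mintegrable \<nu> (fourier_check f) \<and> mint \<mu> f = mint \<nu> (fourier_check f)" if f: "Cc_conv_span f" for f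
  proof -
    have cc: "Cc f" by (rule Cc_conv_span_imp_Cc[OF f])
    let ?g = "\<lambda>x. fourier f (of_int (- 1) * x)"
    have g: "fourier_check f = ?g" by (simp add: fourier_check_def fun_eq_iff)
    have sum: "(\<lambda>j::int. norm (fourier f (of_int j / sqrt (real n)))) summable_on UNIV"
      by (rule Cc_conv_span_lattice_summable[OF f L])
    have bij: "bij_betw (\<lambda>j. - j) UNIV (UNIV :: int set)"
      by (rule bij_betw_byWitness[where f'="\<lambda>j. - j"]) auto
    have gs: "(\<lambda>j::int. norm (?g (of_int j / sqrt (real n)))) summable_on UNIV"
      using sum summable_on_reindex_bij_betw[OF bij, of "\<lambda>j. norm (fourier f (of_int j / sqrt (real n)))"] by simp
    have "continuous_on UNIV ?g"
      by (rule continuous_on_compose2[OF continuous_on_fourier[OF cc, of UNIV]]) (auto intro!: continuous_intros)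
    then have gm: "?g \<in> borel_measurable borel" by (rule borel_measurable_continuous_onI)
    have "mint \<nu> ?g = lam * lattice_sum n c ?g"
      unfolding \<nu>_def lattice_measure_mint(2)[OF n gm gs] by (rule lattice_sum_cmult)
    also have "lattice_sum n c ?g = lattice_sum n (gdft (- 1) n c) f"
      by (rule lattice_sum_fourier[OF n cc _ sum]) simp
    also have "\<dots> = inverse lam * lattice_sum n c f"
      unfolding lattice_sum_cmult[symmetric]
      by (rule lattice_sum_cong[OF n]) (rule gdft_eigen_inverse[OF n _ lam eig], auto)
    finally have "mint \<nu> ?g = mint \<mu> f" using lam rep[OF cc] by simp
    then show ?thesis
      unfolding g using lattice_measure_mint(1)[OF n gm gs] by (simp add: \<nu>_def)
  qed
  then have "strict_fourier_is \<mu> \<nu>"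
    unfolding strict_fourier_is_def using radon_lattice_measure[OF n] by (simp add: \<nu>_def)
  moreover have "meq \<nu> (mscale lam \<mu>)"
    unfolding meq_def
  proof (intro allI impI)
    fix f assume f: "Cc f"
    have "f \<in> borel_measurable borel"
      by (rule borel_measurable_continuous_onI[OF Cc_continuous[OF f]])
    then have "mint \<nu> f = lattice_sum n (\<lambda>l. lam * c l) f"
      unfolding \<nu>_def by (rule lattice_measure_mint(2)[OF n _ Cc_lattice_summable[OF f L]])
    then show "mint \<nu> f = mint (mscale lam \<mu>) f"
      using rep[OF f] by (simp add: lattice_sum_cmult mint_mscale)
  qed
  ultimately show ?thesis
    unfolding strict_eigenmeasure_def tempered_def using \<mu> tempered_ext_lattice_sum[OF n rep] by blast
qed

theorem theorem4p2:
  fixes \<alpha> :: real and lam :: complex and \<mu> :: cmeasure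
  assumes "\<alpha> > 0"
    and "lam ^ 4 = 1"
    and "radon \<mu>"
    and "nontrivial \<mu>"
    and "\<forall>f. Cc f \<longrightarrow> mtranslate \<alpha> \<mu> f = mint \<mu> f"
  shows "(eigenmeasure \<mu> lam \<longleftrightarrow> strict_eigenmeasure \<mu> lam)
       \<and> (strict_eigenmeasure \<mu> lam \<longleftrightarrow>
          (\<exists>n::nat. \<alpha> = sqrt (real n) \<and>
             (\<exists>c :: nat \<Rightarrow> complex. (\<forall>k<n. dft n c k = lam * c k) \<and>
                (\<forall>f. Cc f \<longrightarrow> mint \<mu> f =
                   (\<Sum>m<n. \<Sum>\<^sub>\<infinity>k::int. c m * f (real m / sqrt (real n) + real_of_int k * sqrt (real n)))))))"
proof -
  have lam: "lam \<noteq> 0" using assms(2) by auto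
  have per: "\<And>f. Cc f \<Longrightarrow> mtranslate \<alpha> \<mu> f = mint \<mu> f" using assms(5) by blast
  \<comment> \<open>Condition (3) in terms of \<open>lattice_sum\<close> and \<open>gdft\<close>,
    with \<open>n > 0\<close> made explicit; in the theorem \<open>n = 0\<close> is excluded by
    \<open>\<alpha> > 0\<close>.\<close>
  define Lat where "Lat \<longleftrightarrow> (\<exists>n c. n > 0 \<and> \<alpha> = sqrt (real n) \<and> (\<forall>m<n. gdft 1 n c m = lam * c m) \<and>
      (\<forall>f. Cc f \<longrightarrow> mint \<mu> f = lattice_sum n c f))"
  have Lat_iff: "Lat \<longleftrightarrow> (\<exists>n::nat. \<alpha> = sqrt (real n) \<and>
             (\<exists>c :: nat \<Rightarrow> complex. (\<forall>k<n. dft n c k = lam * c k) \<and>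
                (\<forall>f. Cc f \<longrightarrow> mint \<mu> f =
                   (\<Sum>m<n. \<Sum>\<^sub>\<infinity>k::int. c m * f (real m / sqrt (real n) + real_of_int k * sqrt (real n))))))"
  proof -
    have pos: "n > 0" if "\<alpha> = sqrt (real n)" for n using that assms(1) by (cases n) auto
    have ls: "lattice_sum n c f = (\<Sum>m<n. \<Sum>\<^sub>\<infinity>k::int. c m * f (real m / sqrt (real n) + real_of_int k * sqrt (real n)))"
      if "n > 0" "Cc f" for n c f
      using that by (intro lattice_sum_eq Cc_lattice_summable) auto
    have "(n > 0 \<and> \<alpha> = sqrt (real n) \<and> (\<forall>m<n. gdft 1 n c m = lam * c m) \<and> (\<forall>f. Cc f \<longrightarrow> mint \<mu> f = lattice_sum n c f)) \<longleftrightarrow>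
      (\<alpha> = sqrt (real n) \<and> (\<forall>k<n. dft n c k = lam * c k) \<and> (\<forall>f. Cc f \<longrightarrow> mint \<mu> f =
         (\<Sum>m<n. \<Sum>\<^sub>\<infinity>k::int. c m * f (real m / sqrt (real n) + real_of_int k * sqrt (real n)))))" for n c
      unfolding dft_eq_gdft using pos[of n] ls[of n _ c] by (cases "\<alpha> = sqrt (real n)") simp_all
    then show ?thesis unfolding Lat_def by (simp only: ex_simps)
  qed
  have "eigenmeasure \<mu> lam" "strict_eigenmeasure \<mu> lam" if Lat
    using that lattice_eigenmeasure[OF _ assms(3,4)] lattice_strict_eigenmeasure[OF _ assms(3,4) lam]
    unfolding Lat_def by blast+
  moreover have Lat if eig: "eigenmeasure \<mu> lam"
  proof (rule periodic_fourier_invariant[where X=Cc_inf and s=1 and a=lam, OF assms(1,3,4) per])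
    show "(\<lambda>j::int. norm (fourier f (of_int j / L))) summable_on UNIV" if "Cc_inf f" "L > 0" for f L
      using that by (intro schwartz_lattice_summable schwartz_fourier)
    show "Lat" if "n > 0" "\<alpha> = sqrt (real n)" "\<And>m. m < n \<Longrightarrow> gdft 1 n c m = lam * c m"
        "\<And>f. Cc f \<Longrightarrow> mint \<mu> f = lattice_sum n c f" for n c
      unfolding Lat_def using that by blast
  qed (simp_all only: lam Cc_inf_imp_Cc approximates_intervals_Cc_inf Cc_inf_modulation
      eigenmeasure_cutoff_limit[OF eig] simp_thms not_False_eq_True)
  moreover have Lat if strict: "strict_eigenmeasure \<mu> lam"
  proof (rule periodic_fourier_invariant[where X=Cc_conv_span and s="-1" and a="inverse lam", OF assms(1,3,4) per])
    show inv: "inverse lam \<noteq> 0" using lam by simp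
    show "Lat" if nc: "n > 0" "\<alpha> = sqrt (real n)" "\<And>m. m < n \<Longrightarrow> gdft (- 1) n c m = inverse lam * c m"
        "\<And>f. Cc f \<Longrightarrow> mint \<mu> f = lattice_sum n c f" for n c
    proof -
      \<comment> \<open>The strict case yields an eigenvector of the inverse matrix for
        \<open>inverse lam\<close>; inverting once more gives the eigenvalue \<open>lam\<close> of
        the original matrix.\<close>
      have "gdft 1 n c m = lam * c m" if "m < n" for m
        using gdft_eigen_inverse[OF nc(1) _ inv nc(3) that] by simp
      then show ?thesis unfolding Lat_def using nc by blast
    qed
  qed (simp_all only: Cc_conv_span_imp_Cc approximates_intervals_Cc_conv_span Cc_conv_span_modulation
      Cc_conv_span_lattice_summable strict_eigenmeasure_cutoff_limit[OF strict _ lam] simp_thms)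
  ultimately show ?thesis unfolding Lat_iff[symmetric] by blast
qed

end
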